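(* Let $(H,\mu_H,\Delta_H,\alpha_H)$ be a Hom-bialgebra such that $\alpha_H$ is bijective. (i) Let $(M,\alpha_M)$ and $(N,\alpha_N)$ be two Yetter-Drinfeld modules over $H$, and define the linear maps $$H\otimes(M\otimes N)\to M\otimes N,\quad h\otimes(m\otimes n)\mapsto\alpha_H^{-2}(h_1)\cdot m\otimes\alpha_H^{-2}(h_2)\cdot n,$$ $$M\otimes N\to H\otimes(M\otimes N),\quad m\otimes n\mapsto m_{(-1)}n_{(-1)}\otimes(m_{(0)}\otimes n_{(0)}).$$ Then $(M\otimes N,\alpha_M\otimes\alpha_N)$ with these structures becomes a Yetter-Drinfeld module over $H$, denoted by $M\tilde\otimes N$. (ii) ${}_H^H\mathcal{YD}$ is a quasi-braided pre-tensor category, with tensor product $\tilde\otimes$ as in (i) and associativity constraints $\mathfrak a_{M,N,P}$ and quasi-braiding $c_{M,N}$ defined by $$\mathfrak a_{M,N,P}:(M\tilde\otimes N)\tilde\otimes P\to M\tilde\otimes(N\tilde\otimes P),\quad\mathfrak a_{M,N,P}((m\otimes n)\otimes p)=\alpha_M(m)\otimes(n\otimes\alpha_P^{-1}(p)),$$ $$c_{M,N}:M\tilde\otimes N\to N\tilde\otimes M,\quad c_{M,N}(m\otimes n)=\alpha_N^{-1}(\alpha_H^{-1}(m_{(-1)})\cdot n)\otimes\alpha_M^{-1}(m_{(0)}).$$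
   Context: Everything is over a field $k$, $\otimes=\otimes_k$; (co)algebras are not assumed (co)unital. Sweedler notation: $\Delta(h)=h_1\otimes h_2$; multiplications are written by juxtaposition. A Hom-bialgebra is $(H,\mu,\Delta,\alpha)$ with $\mu:H\otimes H\to H$, $\Delta:H\to H\otimes H$, $\alpha:H\to H$ linear such that for all $h,h',h''$: $\alpha(hh')=\alpha(h)\alpha(h')$; $\alpha(h)(h'h'')=(hh')\alpha(h'')$; $\Delta(h_1)\otimes\alpha(h_2)=\alpha(h_1)\otimes\Delta(h_2)$; $\Delta(hh')=h_1h'_1\otimes h_2h'_2$; $\Delta(\alpha(h))=\alpha(h_1)\otimes\alpha(h_2)$. Let $(H,\mu_H,\Delta_H,\alpha_H)$ be a Hom-bialgebra, $M$ a linear space, $\alpha_M:M\to M$ linear. $(M,\alpha_M)$ is a left $H$-module if there is a linear map $H\otimes M\to M$, $h\otimes m\mapsto h\cdot m$, with $\alpha_M(h\cdot m)=\alpha_H(h)\cdot\alpha_M(m)$ and $\alpha_H(h)\cdot(h'\cdot m)=(hh')\cdot\alpha_M(m)$. It is a left $H$-comodule if there is a linear map $\lambda_M:M\to H\otimes M$, $\lambda_M(m)=m_{(-1)}\otimes m_{(0)}$, with $(\alpha_H\otimes\alpha_M)\circ\lambda_M=\lambda_M\circ\alpha_M$ and $(\Delta_H\otimes\alpha_M)\circ\lambda_M=(\alpha_H\otimes\lambda_M)\circ\lambda_M$. A morphism $f:M\to N$ of left $H$-modules is a linear map with $\alpha_N\circ f=f\circ\alpha_M$ and $f(h\cdot m)=h\cdot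 f(m)$; a morphism of left $H$-comodules is a linear map with $\alpha_N\circ f=f\circ\alpha_M$ and $(id_H\otimes f)\circ\lambda_M=\lambda_N\circ f$. $(M,\alpha_M)$ is a (left-left) Yetter-Drinfeld module over $H$ if it is both a left $H$-module and a left $H$-comodule and, for all $h\in H$, $m\in M$, $$(h_1\cdot m)_{(-1)}\alpha_H^2(h_2)\otimes(h_1\cdot m)_{(0)}=\alpha_H^2(h_1)\alpha_H(m_{(-1)})\otimes\alpha_H(h_2)\cdot m_{(0)}.$$ For $\alpha_H$ bijective, ${}_H^H\mathcal{YD}$ is the category whose objects are Yetter-Drinfeld modules $(M,\alpha_M)$ over $H$ with $\alpha_M$ bijective, and whose morphisms are the maps that are morphisms of both left $H$-modules and left $H$-comodules. A pre-tensor category $(\mathcal C,\otimes,a)$ satisfies all the axioms of a tensor (monoidal) category except that no unit object or unit constraints are required: $\otimes$ is a bifunctor and $a_{U,V,W}:(U\otimes V)\otimes W\to U\otimes(V\otimes W)$ is a natural isomorphism satisfying the pentagon axiom. A quasi-braiding is a family of natural morphisms $c_{V,W}:V\otimes W\to W\otimes V$ (not required to be isomorphisms) satisfying the two hexagon axioms $a_{V,W,U}\circ c_{U,V\otimes W}\circ a_{U,V,W}=(id_V\otimes c_{U,W})\circ a_{V,U,W}\circ(c_{U,V}\otimes id_W)$ and $a_{W,U,V}^{-1}\circ c_{U\otimes V,W}\circ a_{U,V,W}^{-1}=(c_{U,W}\otimes id_V)\circ a_{U,W,V}^{-1}\circ(id_U\otimes c_{V,W})$. Then $(\mathcal C,\otimes,a,c)$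 is a quasi-braided pre-tensor category. *)

theory Defs
  imports "HOL-Algebra.Module" "HOL-Library.FuncSet"
begin

section \<open>A universe closed under tensor products\<close>

text \<open>
  Vector spaces over a field \<open>K\<close> are modules \<open>module K M\<close> in the sense of HOL-Algebra (the fields
  \<open>mult\<close> and \<open>one\<close> of the module record are irrelevant).  In order to speak about a category that is
  closed under tensor products, all carriers are subsets of one type \<open>'a univ\<close>, whose elements are
  atoms and finite formal sums of pairs of elements.  Any set of type \<open>'a set\<close> is a carrier via
  \<open>Atom\<close>, and \<open>'a\<close> is arbitrary.
\<close>

datatype 'a univ = Atom 'a | Formal (summands: "('a univ \<times> 'a univ) list")

definition linear_map ::
  "('k, 'r) ring_scheme \<Rightarrow> ('k, 'v, 'm) module_scheme \<Rightarrow> ('k, 'w, 'n) module_scheme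
    \<Rightarrow> ('v \<Rightarrow> 'w) \<Rightarrow> bool"
  where "linear_map K M N f \<longleftrightarrow>
    f \<in> carrier M \<rightarrow> carrier N \<and>
    (\<forall>x\<in>carrier M. \<forall>y\<in>carrier M. f (x \<oplus>\<^bsub>M\<^esub> y) = f x \<oplus>\<^bsub>N\<^esub> f y) \<and>
    (\<forall>r\<in>carrier K. \<forall>x\<in>carrier M. f (r \<odot>\<^bsub>M\<^esub> x) = r \<odot>\<^bsub>N\<^esub> f x)"

definition bilinear_map ::
  "('k, 'r) ring_scheme \<Rightarrow> ('k, 'v, 'm) module_scheme \<Rightarrow> ('k, 'w, 'n) module_scheme
    \<Rightarrow> ('k, 'u, 'p) module_scheme \<Rightarrow> ('v \<Rightarrow> 'w \<Rightarrow> 'u) \<Rightarrow> bool"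
  where "bilinear_map K M N U F \<longleftrightarrow>
    (\<forall>y\<in>carrier N. linear_map K M U (\<lambda>x. F x y)) \<and>
    (\<forall>x\<in>carrier M. linear_map K N U (F x))"


section \<open>Tensor products of vector spaces\<close>

text \<open>
  A list \<open>[(m\<^sub>1,n\<^sub>1), \<dots>, (m\<^sub>r,n\<^sub>r)]\<close> stands for \<open>m\<^sub>1 \<otimes> n\<^sub>1 + \<dots> + m\<^sub>r \<otimes> n\<^sub>r\<close>.  The tensor product is the
  quotient of the monoid of such lists by the congruence generated by commutativity and
  \<open>K\<close>-bilinearity; it is a group, since \<open>(\<ominus>m) \<otimes> n\<close> is a negative of \<open>m \<otimes> n\<close>.
\<close>

inductive tensor_eq ::
  "('k, 'r) ring_scheme \<Rightarrow> ('k, 'a univ, 'm) module_scheme \<Rightarrow> ('k, 'a univ, 'n) module_scheme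
    \<Rightarrow> ('a univ \<times> 'a univ) list \<Rightarrow> ('a univ \<times> 'a univ) list \<Rightarrow> bool"
  for K M N where
  refl: "set X \<subseteq> carrier M \<times> carrier N \<Longrightarrow> tensor_eq K M N X X"
| sym: "tensor_eq K M N X Y \<Longrightarrow> tensor_eq K M N Y X"
| trans: "tensor_eq K M N X Y \<Longrightarrow> tensor_eq K M N Y Z \<Longrightarrow> tensor_eq K M N X Z"
| append: "tensor_eq K M N X X' \<Longrightarrow> tensor_eq K M N Y Y' \<Longrightarrow> tensor_eq K M N (X @ Y) (X' @ Y')"
| comm: "set X \<subseteq> carrier M \<times> carrier N \<Longrightarrow> set Y \<subseteq> carrier M \<times> carrier N
    \<Longrightarrow> tensor_eq K M N (X @ Y) (Y @ X)"
| zero: "n \<in> carrier N \<Longrightarrow> tensor_eq K M N [(\<zero>\<^bsub>M\<^esub>, n)] []"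
| add_left: "m \<in> carrier M \<Longrightarrow> m' \<in> carrier M \<Longrightarrow> n \<in> carrier N
    \<Longrightarrow> tensor_eq K M N [(m \<oplus>\<^bsub>M\<^esub> m', n)] [(m, n), (m', n)]"
| add_right: "m \<in> carrier M \<Longrightarrow> n \<in> carrier N \<Longrightarrow> n' \<in> carrier N
    \<Longrightarrow> tensor_eq K M N [(m, n \<oplus>\<^bsub>N\<^esub> n')] [(m, n), (m, n')]"
| scale: "r \<in> carrier K \<Longrightarrow> m \<in> carrier M \<Longrightarrow> n \<in> carrier N
    \<Longrightarrow> tensor_eq K M N [(r \<odot>\<^bsub>M\<^esub> m, n)] [(m, r \<odot>\<^bsub>N\<^esub> n)]"

text \<open>
  A congruence class is represented inside the universe by a chosen member, so that
  \<open>summands t\<close> is an expression of \<open>t\<close> as a finite sum of pure tensors.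
\<close>

definition tensor_class ::
  "('k, 'r) ring_scheme \<Rightarrow> ('k, 'a univ, 'm) module_scheme \<Rightarrow> ('k, 'a univ, 'n) module_scheme
    \<Rightarrow> ('a univ \<times> 'a univ) list \<Rightarrow> 'a univ"
  where "tensor_class K M N X = Formal (SOME Y. tensor_eq K M N X Y)"

definition tensor ::
  "('k, 'r) ring_scheme \<Rightarrow> ('k, 'a univ, 'm) module_scheme \<Rightarrow> ('k, 'a univ, 'n) module_scheme
    \<Rightarrow> ('k, 'a univ) module"
  where "tensor K M N =
    \<lparr>carrier = {tensor_class K M N X | X. set X \<subseteq> carrier M \<times> carrier N},
     mult = undefined, one = undefined,
     zero = tensor_class K M N [],
     add = (\<lambda>s t. tensor_class K M N (summands s @ summands t)),
     smult = (\<lambda>r t. tensor_class K M N (map (\<lambda>(m, n). (r \<odot>\<^bsub>M\<^esub> m, n)) (summands t)))\<rparr>"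

definition tns ::
  "('k, 'r) ring_scheme \<Rightarrow> ('k, 'a univ, 'm) module_scheme \<Rightarrow> ('k, 'a univ, 'n) module_scheme
    \<Rightarrow> 'a univ \<Rightarrow> 'a univ \<Rightarrow> 'a univ"
  where "tns K M N m n = tensor_class K M N [(m, n)]"

text \<open>
  Sweedler notation: if \<open>t = t\<^sub>1 \<otimes> t\<^sub>2\<close> (summation understood) and \<open>F\<close> is bilinear with values in \<open>U\<close>,
  then \<open>sweedler U t (\<lambda>t\<^sub>1 t\<^sub>2. F t\<^sub>1 t\<^sub>2)\<close> is \<open>F t\<^sub>1 t\<^sub>2\<close> (summation understood).  As a function of \<open>t\<close>, it is
  the linear map with \<open>m \<otimes> n \<mapsto> F m n\<close>; see \<open>sweedler_linear\<close> and \<open>sweedler_tns\<close> below.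
\<close>

definition sweedler ::
  "('k, 'u, 'p) module_scheme \<Rightarrow> 'a univ \<Rightarrow> ('a univ \<Rightarrow> 'a univ \<Rightarrow> 'u) \<Rightarrow> 'u"
  where "sweedler U t F = foldr (\<lambda>(m, n) u. F m n \<oplus>\<^bsub>U\<^esub> u) (summands t) \<zero>\<^bsub>U\<^esub>"

definition tensor_map ::
  "('k, 'r) ring_scheme \<Rightarrow> ('k, 'a univ, 'm) module_scheme \<Rightarrow> ('k, 'a univ, 'n) module_scheme
    \<Rightarrow> ('a univ \<Rightarrow> 'a univ) \<Rightarrow> ('a univ \<Rightarrow> 'a univ) \<Rightarrow> 'a univ \<Rightarrow> 'a univ"
  \<comment> \<open>\<open>f \<otimes> g\<close>, where \<open>M\<close> and \<open>N\<close> are the codomains of \<open>f\<close> and \<open>g\<close>\<close>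
  where "tensor_map K M N f g t =
    sweedler (tensor K M N) t (\<lambda>x y. tns K M N (f x) (g y))"

definition rebracket ::
  "('k, 'r) ring_scheme \<Rightarrow> ('k, 'a univ, 'm) module_scheme \<Rightarrow> ('k, 'a univ, 'n) module_scheme
    \<Rightarrow> ('k, 'a univ, 'p) module_scheme \<Rightarrow> 'a univ \<Rightarrow> 'a univ"
  \<comment> \<open>the canonical identification of \<open>(M \<otimes> N) \<otimes> P\<close> with \<open>M \<otimes> (N \<otimes> P)\<close>\<close>
  where "rebracket K M N P t =
    sweedler (tensor K M (tensor K N P)) t (\<lambda>x p.
      sweedler (tensor K M (tensor K N P)) x (\<lambda>m n.
        tns K M (tensor K N P) m (tns K N P n p)))"

subsection \<open>The universal property\<close>

lemma tensor_eq_wf: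
  assumes "module K M" "module K N" "tensor_eq K M N X Y"
  shows "set X \<subseteq> carrier M \<times> carrier N \<and> set Y \<subseteq> carrier M \<times> carrier N"
proof -
  interpret M: module K M by fact
  interpret N: module K N by fact
  show ?thesis using assms(3) by induction auto
qed

lemma tensor_class_eqI:
  assumes "tensor_eq K M N X Y"
  shows "tensor_class K M N X = tensor_class K M N Y"
proof -
  have "tensor_eq K M N X = tensor_eq K M N Y"
    using tensor_eq.trans[OF assms] tensor_eq.trans[OF tensor_eq.sym[OF assms]]
    by (intro ext iffI) simp_all
  then show ?thesis by (simp add: tensor_class_def)
qed

lemma summands_tensor_class:
  assumes "set X \<subseteq> carrier M \<times> carrier N"
  shows "tensor_eq K M N X (summands (tensor_class K M N X))"
  using someI[of "tensor_eq K M N X", OF tensor_eq.refl[OF assms]] by (simp add: tensor_class_def)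

lemma tensor_class_eq_iff:
  assumes "set X \<subseteq> carrier M \<times> carrier N" "set Y \<subseteq> carrier M \<times> carrier N"
  shows "tensor_class K M N X = tensor_class K M N Y \<longleftrightarrow> tensor_eq K M N X Y"
proof
  assume "tensor_class K M N X = tensor_class K M N Y"
  with summands_tensor_class[OF assms(1), of K] have "tensor_eq K M N X (summands (tensor_class K M N Y))"
    by simp
  then show "tensor_eq K M N X Y"
    by (rule tensor_eq.trans) (rule tensor_eq.sym[OF summands_tensor_class[OF assms(2)]])
qed (rule tensor_class_eqI)

lemma tensor_add_class:
  assumes "set X \<subseteq> carrier M \<times> carrier N" "set Y \<subseteq> carrier M \<times> carrier N"
  shows "tensor_class K M N X \<oplus>\<^bsub>tensor K M N\<^esub> tensor_class K M N Y = tensor_class K M N (X @ Y)"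
  using assms
  by (auto simp: tensor_def intro!: tensor_class_eqI tensor_eq.append tensor_eq.sym[OF summands_tensor_class])

lemma tensor_eq_smult:
  assumes "module K M" "module K N" "r \<in> carrier K" "tensor_eq K M N X Y"
  shows "tensor_eq K M N (map (\<lambda>(m, n). (r \<odot>\<^bsub>M\<^esub> m, n)) X) (map (\<lambda>(m, n). (r \<odot>\<^bsub>M\<^esub> m, n)) Y)"
proof -
  interpret M: module K M by fact
  interpret N: module K N by fact
  from assms(4) show ?thesis
  proof induction
    case (refl X)
    then show ?case using assms(3) by (intro tensor_eq.refl) auto
  next
    case (comm X Y)
    then have "set (map (\<lambda>(m, n). (r \<odot>\<^bsub>M\<^esub> m, n)) X) \<subseteq> carrier M \<times> carrier N"
      "set (map (\<lambda>(m, n). (r \<odot>\<^bsub>M\<^esub> m, n)) Y) \<subseteq> carrier M \<times> carrier N"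
      using assms(3) by auto
    then show ?case by (simp add: tensor_eq.comm del: set_map)
  next
    case (scale s m n)
    have "r \<odot>\<^bsub>M\<^esub> (s \<odot>\<^bsub>M\<^esub> m) = s \<odot>\<^bsub>M\<^esub> (r \<odot>\<^bsub>M\<^esub> m)"
      using scale assms(3) by (metis M.smult_assoc1 M.R.m_comm)
    then show ?case using scale assms(3) by (auto intro: tensor_eq.scale)
  next
    case (sym X Y)
    then show ?case by (rule_tac tensor_eq.sym)
  next
    case (trans X Y Z)
    then show ?case by (rule_tac tensor_eq.trans)
  next
    case (append X X' Y Y')
    then show ?case by (simp add: tensor_eq.append)
  qed (use assms(3) in \<open>simp_all add: M.smult_r_distr tensor_eq.zero tensor_eq.add_left
         tensor_eq.add_right\<close>)
qed

lemma tensor_smult_class: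
  assumes "module K M" "module K N" "r \<in> carrier K" "set X \<subseteq> carrier M \<times> carrier N"
  shows "r \<odot>\<^bsub>tensor K M N\<^esub> tensor_class K M N X
    = tensor_class K M N (map (\<lambda>(m, n). (r \<odot>\<^bsub>M\<^esub> m, n)) X)"
  using tensor_eq_smult[OF assms(1-3) summands_tensor_class[OF assms(4), of K]]
  by (simp add: tensor_def tensor_class_eqI tensor_eq.sym)

lemma tensor_carrierE:
  assumes "t \<in> carrier (tensor K M N)"
  obtains X where "set X \<subseteq> carrier M \<times> carrier N" "t = tensor_class K M N X"
  using assms by (auto simp: tensor_def)

lemma tensor_carrierI:
  "set X \<subseteq> carrier M \<times> carrier N \<Longrightarrow> tensor_class K M N X \<in> carrier (tensor K M N)"
  by (auto simp: tensor_def)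

lemma tensor_zero: "\<zero>\<^bsub>tensor K M N\<^esub> = tensor_class K M N []"
  by (simp add: tensor_def)

lemma tensor_eq_pointwise:
  assumes "set X \<subseteq> carrier M \<times> carrier N"
    "\<And>p. p \<in> set X \<Longrightarrow> tensor_eq K M N (f p) (g p)"
  shows "tensor_eq K M N (concat (map f X)) (concat (map g X))"
  using assms by (induction X) (auto intro: tensor_eq.append tensor_eq.refl)

lemma tensor_eq_merge:
  assumes "\<And>p. p \<in> set X \<Longrightarrow> f p \<in> carrier M \<times> carrier N"
    "\<And>p. p \<in> set X \<Longrightarrow> g p \<in> carrier M \<times> carrier N"
  shows "tensor_eq K M N (concat (map (\<lambda>p. [f p, g p]) X)) (map f X @ map g X)"
  using assms
proof (induction X)
  case Nil
  then show ?case by (simp add: tensor_eq.refl)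
next
  case (Cons p X)
  have IH: "tensor_eq K M N (concat (map (\<lambda>p. [f p, g p]) X)) (map f X @ map g X)"
    using Cons by simp
  have fg: "set (map f X) \<subseteq> carrier M \<times> carrier N" "set (map g X) \<subseteq> carrier M \<times> carrier N"
    "set [f p] \<subseteq> carrier M \<times> carrier N" "set [g p] \<subseteq> carrier M \<times> carrier N"
    using Cons.prems by (force simp: image_subset_iff)+
  have 1: "tensor_eq K M N ([f p, g p] @ concat (map (\<lambda>p. [f p, g p]) X)) ([f p, g p] @ (map f X @ map g X))"
    by (rule tensor_eq.append[OF tensor_eq.refl IH]) (use fg in auto)
  have 2: "tensor_eq K M N ([f p, g p] @ (map f X @ map g X)) ([f p] @ (map f X @ [g p]) @ map g X)"
    using tensor_eq.append[OF tensor_eq.refl[of "[f p]"] tensor_eq.append[OF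
        tensor_eq.comm[of "[g p]" M N "map f X" K] tensor_eq.refl[of "map g X"]]] fg
    by simp
  show ?case using tensor_eq.trans[OF 1 2] by simp
qed

lemma module_tensor:
  assumes "module K M" "module K N"
  shows "module K (tensor K M N)"
proof -
  interpret M: module K M by fact
  interpret N: module K N by fact
  let ?c = "tensor_class K M N"
  have neg: "?c (map (\<lambda>(m, n). (\<ominus>\<^bsub>M\<^esub> m, n)) X @ X) = ?c []"
    if "set X \<subseteq> carrier M \<times> carrier N" for X
  proof -
    have pt: "tensor_eq K M N [(\<ominus>\<^bsub>M\<^esub> fst p, snd p), p] []" if "p \<in> set X" for p
    proof -
      obtain m n where p: "p = (m, n)" "m \<in> carrier M" "n \<in> carrier N"
        using \<open>p \<in> set X\<close> \<open>set X \<subseteq> _\<close> by auto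
      have 1: "tensor_eq K M N [(\<ominus>\<^bsub>M\<^esub> m \<oplus>\<^bsub>M\<^esub> m, n)] [(\<ominus>\<^bsub>M\<^esub> m, n), (m, n)]"
        using p by (intro tensor_eq.add_left) auto
      have 2: "tensor_eq K M N [(\<ominus>\<^bsub>M\<^esub> m \<oplus>\<^bsub>M\<^esub> m, n)] []"
        using p tensor_eq.zero[of n N K M] by (simp add: M.l_neg)
      show ?thesis using tensor_eq.trans[OF tensor_eq.sym[OF 1] 2] p by simp
    qed
    have 1: "tensor_eq K M N (concat (map (\<lambda>p. [(\<ominus>\<^bsub>M\<^esub> fst p, snd p), p]) X)) (concat (map (\<lambda>_. []) X))"
      by (rule tensor_eq_pointwise[OF that pt])
    have 2: "tensor_eq K M N (concat (map (\<lambda>p. [(\<ominus>\<^bsub>M\<^esub> fst p, snd p), p]) X))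
        (map (\<lambda>p. (\<ominus>\<^bsub>M\<^esub> fst p, snd p)) X @ map (\<lambda>p. p) X)"
      by (rule tensor_eq_merge) (use that in auto)
    have 3: "concat (map (\<lambda>_. []) X) = []"
      by simp
    show ?thesis
      using tensor_class_eqI[OF tensor_eq.trans[OF tensor_eq.sym[OF 2] 1]]
      unfolding 3 by (simp add: case_prod_unfold)
  qed
  show ?thesis
  proof (rule moduleI)
    show "cring K" by (rule M.R.is_cring)
    show "abelian_group (tensor K M N)"
    proof (rule abelian_groupI)
      fix x y assume "x \<in> carrier (tensor K M N)" "y \<in> carrier (tensor K M N)"
      then show "x \<oplus>\<^bsub>tensor K M N\<^esub> y \<in> carrier (tensor K M N)"
        by (elim tensor_carrierE) (auto simp: tensor_add_class intro!: tensor_carrierI)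
      show "x \<oplus>\<^bsub>tensor K M N\<^esub> y = y \<oplus>\<^bsub>tensor K M N\<^esub> x"
        using \<open>x \<in> _\<close> \<open>y \<in> _\<close>
        by (elim tensor_carrierE) (auto simp: tensor_add_class intro!: tensor_class_eqI tensor_eq.comm)
    next
      show "\<zero>\<^bsub>tensor K M N\<^esub> \<in> carrier (tensor K M N)"
        by (auto simp: tensor_zero intro!: tensor_carrierI)
    next
      fix x y z assume "x \<in> carrier (tensor K M N)" "y \<in> carrier (tensor K M N)" "z \<in> carrier (tensor K M N)"
      then show "x \<oplus>\<^bsub>tensor K M N\<^esub> y \<oplus>\<^bsub>tensor K M N\<^esub> z = x \<oplus>\<^bsub>tensor K M N\<^esub> (y \<oplus>\<^bsub>tensor K M N\<^esub> z)"
        by (elim tensor_carrierE) (simp add: tensor_add_class)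
    next
      fix x assume "x \<in> carrier (tensor K M N)"
      then obtain X where X: "set X \<subseteq> carrier M \<times> carrier N" "x = ?c X" by (rule tensor_carrierE)
      then show "\<zero>\<^bsub>tensor K M N\<^esub> \<oplus>\<^bsub>tensor K M N\<^esub> x = x"
        by (simp add: tensor_zero tensor_add_class)
      have nX: "set (map (\<lambda>(m, n). (\<ominus>\<^bsub>M\<^esub> m, n)) X) \<subseteq> carrier M \<times> carrier N"
        using X by auto
      show "\<exists>y\<in>carrier (tensor K M N). y \<oplus>\<^bsub>tensor K M N\<^esub> x = \<zero>\<^bsub>tensor K M N\<^esub>"
        using tensor_add_class[OF nX X(1), of K] neg[OF X(1)] tensor_carrierI[OF nX, of K] X(2)
        by (auto simp: tensor_zero)
    qed
  next
    fix r x assume r: "r \<in> carrier K" and "x \<in> carrier (tensor K M N)"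
    then obtain X where X: "set X \<subseteq> carrier M \<times> carrier N" "x = ?c X" by (auto elim: tensor_carrierE)
    then have rX: "set (map (\<lambda>(m, n). (r \<odot>\<^bsub>M\<^esub> m, n)) X) \<subseteq> carrier M \<times> carrier N"
      using r by auto
    with X r show "r \<odot>\<^bsub>tensor K M N\<^esub> x \<in> carrier (tensor K M N)"
      by (simp only: tensor_smult_class[OF assms] tensor_carrierI)
    fix y assume "y \<in> carrier (tensor K M N)"
    then obtain Y where Y: "set Y \<subseteq> carrier M \<times> carrier N" "y = ?c Y" by (auto elim: tensor_carrierE)
    then have "set (map (\<lambda>(m, n). (r \<odot>\<^bsub>M\<^esub> m, n)) Y) \<subseteq> carrier M \<times> carrier N"
      using r by auto
    with X Y rX r show "r \<odot>\<^bsub>tensor K M N\<^esub> (x \<oplus>\<^bsub>tensor K M N\<^esub> y)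
        = r \<odot>\<^bsub>tensor K M N\<^esub> x \<oplus>\<^bsub>tensor K M N\<^esub> r \<odot>\<^bsub>tensor K M N\<^esub> y"
      by (simp add: tensor_smult_class[OF assms] tensor_add_class)
  next
    fix r s x assume r: "r \<in> carrier K" "s \<in> carrier K" and "x \<in> carrier (tensor K M N)"
    then obtain X where X: "set X \<subseteq> carrier M \<times> carrier N" "x = ?c X" by (auto elim: tensor_carrierE)
    let ?m = "\<lambda>r (m, n). (r \<odot>\<^bsub>M\<^esub> m, n)"
    have car: "set (map (?m r) X) \<subseteq> carrier M \<times> carrier N" if "r \<in> carrier K" for r
      using X(1) that by auto
    have 1: "tensor_eq K M N (concat (map (\<lambda>p. [?m (r \<oplus>\<^bsub>K\<^esub> s) p]) X)) (concat (map (\<lambda>p. [?m r p, ?m s p]) X))"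
      using X(1) r by (intro tensor_eq_pointwise) (force simp: M.smult_l_distr intro!: tensor_eq.add_left)+
    have 2: "tensor_eq K M N (concat (map (\<lambda>p. [?m r p, ?m s p]) X)) (map (?m r) X @ map (?m s) X)"
      using car[OF r(1)] car[OF r(2)] by (intro tensor_eq_merge) auto
    have "concat (map (\<lambda>p. [?m (r \<oplus>\<^bsub>K\<^esub> s) p]) X) = map (?m (r \<oplus>\<^bsub>K\<^esub> s)) X"
      by simp
    with tensor_eq.trans[OF 1 2] have "tensor_eq K M N (map (?m (r \<oplus>\<^bsub>K\<^esub> s)) X) (map (?m r) X @ map (?m s) X)"
      by (simp only:)
    then show "(r \<oplus>\<^bsub>K\<^esub> s) \<odot>\<^bsub>tensor K M N\<^esub> x = r \<odot>\<^bsub>tensor K M N\<^esub> x \<oplus>\<^bsub>tensor K M N\<^esub> s \<odot>\<^bsub>tensor K M N\<^esub> x"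
      using X r car[OF r(1)] car[OF r(2)]
      by (simp add: tensor_smult_class[OF assms] tensor_add_class tensor_class_eqI del: set_map)
    have "map (?m (r \<otimes>\<^bsub>K\<^esub> s)) X = map (?m r) (map (?m s) X)"
      using X(1) r by (auto simp: M.smult_assoc1)
    then show "(r \<otimes>\<^bsub>K\<^esub> s) \<odot>\<^bsub>tensor K M N\<^esub> x = r \<odot>\<^bsub>tensor K M N\<^esub> (s \<odot>\<^bsub>tensor K M N\<^esub> x)"
      using X r car[OF r(2)] by (simp add: tensor_smult_class[OF assms] del: set_map map_map)
  next
    fix x assume "x \<in> carrier (tensor K M N)"
    then obtain X where X: "set X \<subseteq> carrier M \<times> carrier N" "x = ?c X" by (auto elim: tensor_carrierE)
    then have "map (\<lambda>(m, n). (\<one>\<^bsub>K\<^esub> \<odot>\<^bsub>M\<^esub> m, n)) X = X"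
      by (intro map_idI) auto
    with X show "\<one>\<^bsub>K\<^esub> \<odot>\<^bsub>tensor K M N\<^esub> x = x"
      by (simp add: tensor_smult_class[OF assms])
  qed
qed

lemma tns_bilinear:
  assumes "module K M" "module K N"
  shows "bilinear_map K M N (tensor K M N) (tns K M N)"
proof -
  interpret M: module K M by fact
  interpret N: module K N by fact
  show ?thesis
    by (auto simp: bilinear_map_def linear_map_def tns_def tensor_add_class tensor_smult_class[OF assms]
        intro!: tensor_class_eqI tensor_carrierI tensor_eq.add_left tensor_eq.add_right
          tensor_eq.sym[OF tensor_eq.scale])
qed

context
  fixes K :: "('k, 'r) ring_scheme" and M :: "('k, 'a univ, 'm) module_scheme"
    and N :: "('k, 'a univ, 'n) module_scheme" and U :: "('k, 'u, 'p) module_scheme" and F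
  assumes M: "module K M" and N: "module K N" and U: "module K U"
    and F: "bilinear_map K M N U F"
begin

interpretation M: module K M by (rule M)
interpretation N: module K N by (rule N)
interpretation U: module K U by (rule U)

private definition ev where
  "ev X = foldr (\<lambda>(m, n) u. F m n \<oplus>\<^bsub>U\<^esub> u) X \<zero>\<^bsub>U\<^esub>"

private lemma F_simps:
  "\<lbrakk>m \<in> carrier M; n \<in> carrier N\<rbrakk> \<Longrightarrow> F m n \<in> carrier U"
  "\<lbrakk>m \<in> carrier M; m' \<in> carrier M; n \<in> carrier N\<rbrakk> \<Longrightarrow> F (m \<oplus>\<^bsub>M\<^esub> m') n = F m n \<oplus>\<^bsub>U\<^esub> F m' n"
  "\<lbrakk>m \<in> carrier M; n \<in> carrier N; n' \<in> carrier N\<rbrakk> \<Longrightarrow> F m (n \<oplus>\<^bsub>N\<^esub> n') = F m n \<oplus>\<^bsub>U\<^esub> F m n'"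
  "\<lbrakk>r \<in> carrier K; m \<in> carrier M; n \<in> carrier N\<rbrakk> \<Longrightarrow> F (r \<odot>\<^bsub>M\<^esub> m) n = r \<odot>\<^bsub>U\<^esub> F m n"
  "\<lbrakk>r \<in> carrier K; m \<in> carrier M; n \<in> carrier N\<rbrakk> \<Longrightarrow> F m (r \<odot>\<^bsub>N\<^esub> n) = r \<odot>\<^bsub>U\<^esub> F m n"
  using F by (auto simp: bilinear_map_def linear_map_def)

private lemma F_zero: "n \<in> carrier N \<Longrightarrow> F \<zero>\<^bsub>M\<^esub> n = \<zero>\<^bsub>U\<^esub>"
  using F_simps(4)[of "\<zero>\<^bsub>K\<^esub>" "\<zero>\<^bsub>M\<^esub>" n] F_simps(1)[of "\<zero>\<^bsub>M\<^esub>" n] by simp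

private lemma ev_closed: "set X \<subseteq> carrier M \<times> carrier N \<Longrightarrow> ev X \<in> carrier U"
  by (induction X) (auto simp: ev_def F_simps)

private lemma ev_append:
  "set X \<subseteq> carrier M \<times> carrier N \<Longrightarrow> set Y \<subseteq> carrier M \<times> carrier N
    \<Longrightarrow> ev (X @ Y) = ev X \<oplus>\<^bsub>U\<^esub> ev Y"
proof (induction X)
  case Nil
  then show ?case using ev_closed[of Y] by (simp add: ev_def)
next
  case (Cons p X)
  then show ?case
    using ev_closed[of X] ev_closed[of Y] by (cases p) (auto simp: ev_def F_simps U.a_assoc)
qed

private lemma ev_cong: "tensor_eq K M N X Y \<Longrightarrow> ev X = ev Y"
proof (induction rule: tensor_eq.induct)
  case (append X X' Y Y')
  then show ?case
    using tensor_eq_wf[OF M N append.hyps(1)] tensor_eq_wf[OF M N append.hyps(2)]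
    by (simp add: ev_append)
next
  case (comm X Y)
  then show ?case by (simp add: ev_append ev_closed U.a_comm)
qed (auto simp: ev_def F_simps F_zero U.a_assoc)

private lemma ev_smult:
  "r \<in> carrier K \<Longrightarrow> set X \<subseteq> carrier M \<times> carrier N
    \<Longrightarrow> ev (map (\<lambda>(m, n). (r \<odot>\<^bsub>M\<^esub> m, n)) X) = r \<odot>\<^bsub>U\<^esub> ev X"
proof (induction X)
  case (Cons p X)
  then show ?case
    using ev_closed[of X] by (cases p) (auto simp: ev_def F_simps U.smult_r_distr)
qed (simp add: ev_def)

private lemma sweedler_class:
  "set X \<subseteq> carrier M \<times> carrier N \<Longrightarrow> sweedler U (tensor_class K M N X) F = ev X"
  using ev_cong[OF tensor_eq.sym[OF summands_tensor_class]] by (simp add: sweedler_def ev_def)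

lemma sweedler_linear: "linear_map K (tensor K M N) U (\<lambda>t. sweedler U t F)"
  unfolding linear_map_def
proof (intro conjI ballI funcsetI)
  fix t assume "t \<in> carrier (tensor K M N)"
  then obtain X where X: "set X \<subseteq> carrier M \<times> carrier N" "t = tensor_class K M N X"
    by (rule tensor_carrierE)
  then show "sweedler U t F \<in> carrier U" by (simp add: sweedler_class ev_closed)
  {
    fix s assume "s \<in> carrier (tensor K M N)"
    then obtain Y where Y: "set Y \<subseteq> carrier M \<times> carrier N" "s = tensor_class K M N Y"
      by (rule tensor_carrierE)
    with X show "sweedler U (t \<oplus>\<^bsub>tensor K M N\<^esub> s) F = sweedler U t F \<oplus>\<^bsub>U\<^esub> sweedler U s F"
      by (simp add: sweedler_class ev_append tensor_add_class)
  }
next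
  fix r t assume r: "r \<in> carrier K" and "t \<in> carrier (tensor K M N)"
  then obtain X where X: "set X \<subseteq> carrier M \<times> carrier N" "t = tensor_class K M N X"
    by (auto elim: tensor_carrierE)
  then have "set (map (\<lambda>(m, n). (r \<odot>\<^bsub>M\<^esub> m, n)) X) \<subseteq> carrier M \<times> carrier N"
    using r by auto
  with X r show "sweedler U (r \<odot>\<^bsub>tensor K M N\<^esub> t) F = r \<odot>\<^bsub>U\<^esub> sweedler U t F"
    by (simp add: sweedler_class ev_smult tensor_smult_class[OF M N] del: set_map)
qed

lemma sweedler_tns:
  "\<lbrakk>m \<in> carrier M; n \<in> carrier N\<rbrakk> \<Longrightarrow> sweedler U (tns K M N m n) F = F m n"
  by (simp add: tns_def sweedler_class) (simp add: ev_def F_simps)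

end

lemma linear_map_tensor_eqI:
  assumes "module K M" "module K N" "module K U"
    and f: "linear_map K (tensor K M N) U f" and g: "linear_map K (tensor K M N) U g"
    and fg: "\<And>m n. \<lbrakk>m \<in> carrier M; n \<in> carrier N\<rbrakk> \<Longrightarrow> f (tns K M N m n) = g (tns K M N m n)"
    and t: "t \<in> carrier (tensor K M N)"
  shows "f t = g t"
proof -
  interpret T: module K "tensor K M N" by (rule module_tensor) fact+
  interpret U: module K U by fact
  have zero: "h \<zero>\<^bsub>tensor K M N\<^esub> = \<zero>\<^bsub>U\<^esub>" if "linear_map K (tensor K M N) U h" for h
  proof -
    have "h (\<zero>\<^bsub>K\<^esub> \<odot>\<^bsub>tensor K M N\<^esub> \<zero>\<^bsub>tensor K M N\<^esub>) = \<zero>\<^bsub>K\<^esub> \<odot>\<^bsub>U\<^esub> h \<zero>\<^bsub>tensor K M N\<^esub>"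
      using that unfolding linear_map_def by blast
    moreover have "h \<zero>\<^bsub>tensor K M N\<^esub> \<in> carrier U"
      using that T.M.zero_closed unfolding linear_map_def by blast
    ultimately show ?thesis by simp
  qed
  obtain X where X: "set X \<subseteq> carrier M \<times> carrier N" "t = tensor_class K M N X"
    using t by (rule tensor_carrierE)
  from X(1) have "f (tensor_class K M N X) = g (tensor_class K M N X)"
  proof (induction X)
    case Nil
    then show ?case using zero[OF f] zero[OF g] by (simp add: tensor_zero)
  next
    case (Cons p X)
    obtain m n where p: "p = (m, n)" "m \<in> carrier M" "n \<in> carrier N" using Cons.prems by auto
    have "tensor_class K M N (p # X) = tns K M N m n \<oplus>\<^bsub>tensor K M N\<^esub> tensor_class K M N X"
      using p Cons.prems by (simp add: tns_def tensor_add_class)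
    moreover have "tns K M N m n \<in> carrier (tensor K M N)" "tensor_class K M N X \<in> carrier (tensor K M N)"
      using p Cons.prems by (auto simp: tns_def intro!: tensor_carrierI)
    ultimately show ?case using f g fg p Cons by (simp add: linear_map_def)
  qed
  then show ?thesis using X by simp
qed


section \<open>Hom-bialgebras and Yetter-Drinfeld modules\<close>

record ('k, 'a) hom_space = "('k, 'a univ) module" +
  twist :: "'a univ \<Rightarrow> 'a univ"

record ('k, 'a) hom_bialg = "('k, 'a) hom_space" +
  hmult :: "'a univ \<Rightarrow> 'a univ"
  hcomult :: "'a univ \<Rightarrow> 'a univ"

record ('k, 'a) hom_yd = "('k, 'a) hom_space" +
  action :: "'a univ \<Rightarrow> 'a univ"
  coaction :: "'a univ \<Rightarrow> 'a univ"

definition twist_inv :: "('k, 'a, 'm) hom_space_scheme \<Rightarrow> 'a univ \<Rightarrow> 'a univ"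
  where "twist_inv M = inv_into (carrier M) (twist M)"

definition prd ::
  "('k, 'r) ring_scheme \<Rightarrow> ('k, 'a, 'h) hom_bialg_scheme \<Rightarrow> 'a univ \<Rightarrow> 'a univ \<Rightarrow> 'a univ"
  where "prd K H h h' = hmult H (tns K H H h h')"

definition act ::
  "('k, 'r) ring_scheme \<Rightarrow> ('k, 'a, 'h) hom_bialg_scheme \<Rightarrow> ('k, 'a, 'm) hom_yd_scheme
    \<Rightarrow> 'a univ \<Rightarrow> 'a univ \<Rightarrow> 'a univ"
  where "act K H M h m = action M (tns K H M h m)"

locale hom_space = field K + module K M
  for K :: "('k, 'r) ring_scheme" and M :: "('k, 'a, 'm) hom_space_scheme" +
  assumes twist_linear: "linear_map K M M (twist M)"

locale hom_bialgebra = hom_space K H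
  for K :: "('k, 'r) ring_scheme" and H :: "('k, 'a, 'h) hom_bialg_scheme" +
  assumes hmult_linear: "linear_map K (tensor K H H) H (hmult H)"
    and hcomult_linear: "linear_map K H (tensor K H H) (hcomult H)"
    and twist_prd: "\<lbrakk>h \<in> carrier H; h' \<in> carrier H\<rbrakk>
      \<Longrightarrow> twist H (prd K H h h') = prd K H (twist H h) (twist H h')"
    and hom_associative: "\<lbrakk>h \<in> carrier H; h' \<in> carrier H; h'' \<in> carrier H\<rbrakk>
      \<Longrightarrow> prd K H (twist H h) (prd K H h' h'') = prd K H (prd K H h h') (twist H h'')"
    and hom_coassociative: "h \<in> carrier H
      \<Longrightarrow> rebracket K H H H (tensor_map K (tensor K H H) H (hcomult H) (twist H) (hcomult H h))
        = tensor_map K H (tensor K H H) (twist H) (hcomult H) (hcomult H h)"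
    and hcomult_prd: "\<lbrakk>h \<in> carrier H; h' \<in> carrier H\<rbrakk>
      \<Longrightarrow> hcomult H (prd K H h h') =
          sweedler (tensor K H H) (hcomult H h) (\<lambda>h\<^sub>1 h\<^sub>2.
            sweedler (tensor K H H) (hcomult H h') (\<lambda>h'\<^sub>1 h'\<^sub>2.
              tns K H H (prd K H h\<^sub>1 h'\<^sub>1) (prd K H h\<^sub>2 h'\<^sub>2)))"
    and hcomult_twist: "h \<in> carrier H
      \<Longrightarrow> hcomult H (twist H h) = tensor_map K H H (twist H) (twist H) (hcomult H h)"

locale left_hom_module = H: hom_bialgebra K H + M: hom_space K M
  for K :: "('k, 'r) ring_scheme" and H :: "('k, 'a, 'h) hom_bialg_scheme"
    and M :: "('k, 'a, 'm) hom_yd_scheme" +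
  assumes action_linear: "linear_map K (tensor K H M) M (action M)"
    and twist_act: "\<lbrakk>h \<in> carrier H; m \<in> carrier M\<rbrakk>
      \<Longrightarrow> twist M (act K H M h m) = act K H M (twist H h) (twist M m)"
    and act_act: "\<lbrakk>h \<in> carrier H; h' \<in> carrier H; m \<in> carrier M\<rbrakk>
      \<Longrightarrow> act K H M (twist H h) (act K H M h' m) = act K H M (prd K H h h') (twist M m)"

locale left_hom_comodule = H: hom_bialgebra K H + M: hom_space K M
  for K :: "('k, 'r) ring_scheme" and H :: "('k, 'a, 'h) hom_bialg_scheme"
    and M :: "('k, 'a, 'm) hom_yd_scheme" +
  assumes coaction_linear: "linear_map K M (tensor K H M) (coaction M)"
    and coaction_twist: "m \<in> carrier M
      \<Longrightarrow> tensor_map K H M (twist H) (twist M) (coaction M m) = coaction M (twist M m)"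
    and coaction_coaction: "m \<in> carrier M
      \<Longrightarrow> rebracket K H H M (tensor_map K (tensor K H H) M (hcomult H) (twist M) (coaction M m))
        = tensor_map K H (tensor K H M) (twist H) (coaction M) (coaction M m)"

locale yetter_drinfeld = left_hom_module K H M + left_hom_comodule K H M
  for K :: "('k, 'r) ring_scheme" and H :: "('k, 'a, 'h) hom_bialg_scheme"
    and M :: "('k, 'a, 'm) hom_yd_scheme" +
  assumes yd_compatible: "\<lbrakk>h \<in> carrier H; m \<in> carrier M\<rbrakk>
    \<Longrightarrow> sweedler (tensor K H M) (hcomult H h) (\<lambda>h\<^sub>1 h\<^sub>2.
          sweedler (tensor K H M) (coaction M (act K H M h\<^sub>1 m)) (\<lambda>x y.
            tns K H M (prd K H x (twist H (twist H h\<^sub>2))) y))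
      = sweedler (tensor K H M) (hcomult H h) (\<lambda>h\<^sub>1 h\<^sub>2.
          sweedler (tensor K H M) (coaction M m) (\<lambda>x y.
            tns K H M (prd K H (twist H (twist H h\<^sub>1)) (twist H x)) (act K H M (twist H h\<^sub>2) y)))"

definition hom_module_morphism ::
  "('k, 'r) ring_scheme \<Rightarrow> ('k, 'a, 'h) hom_bialg_scheme \<Rightarrow> ('k, 'a, 'm) hom_yd_scheme
    \<Rightarrow> ('k, 'a, 'n) hom_yd_scheme \<Rightarrow> ('a univ \<Rightarrow> 'a univ) \<Rightarrow> bool"
  where "hom_module_morphism K H M N f \<longleftrightarrow>
    linear_map K M N f \<and>
    (\<forall>m\<in>carrier M. twist N (f m) = f (twist M m)) \<and>
    (\<forall>h\<in>carrier H. \<forall>m\<in>carrier M. f (act K H M h m) = act K H N h (f m))"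

definition hom_comodule_morphism ::
  "('k, 'r) ring_scheme \<Rightarrow> ('k, 'a, 'h) hom_bialg_scheme \<Rightarrow> ('k, 'a, 'm) hom_yd_scheme
    \<Rightarrow> ('k, 'a, 'n) hom_yd_scheme \<Rightarrow> ('a univ \<Rightarrow> 'a univ) \<Rightarrow> bool"
  where "hom_comodule_morphism K H M N f \<longleftrightarrow>
    linear_map K M N f \<and>
    (\<forall>m\<in>carrier M. twist N (f m) = f (twist M m)) \<and>
    (\<forall>m\<in>carrier M. tensor_map K H N (\<lambda>h. h) f (coaction M m) = coaction N (f m))"

definition yd_tensor ::
  "('k, 'r) ring_scheme \<Rightarrow> ('k, 'a, 'h) hom_bialg_scheme \<Rightarrow> ('k, 'a) hom_yd
    \<Rightarrow> ('k, 'a) hom_yd \<Rightarrow> ('k, 'a) hom_yd"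
  where "yd_tensor K H M N = (let T = tensor K M N in
    \<lparr>carrier = carrier T, mult = mult T, one = one T, zero = zero T, add = add T, smult = smult T,
     twist = tensor_map K M N (twist M) (twist N),
     action = (\<lambda>t. sweedler T t (\<lambda>h x. sweedler T x (\<lambda>m n. sweedler T (hcomult H h) (\<lambda>h\<^sub>1 h\<^sub>2.
       tns K M N (act K H M (twist_inv H (twist_inv H h\<^sub>1)) m)
                 (act K H N (twist_inv H (twist_inv H h\<^sub>2)) n))))),
     coaction = (\<lambda>x. sweedler (tensor K H T) x (\<lambda>m n.
       sweedler (tensor K H T) (coaction M m) (\<lambda>m' m\<^sub>0.
         sweedler (tensor K H T) (coaction N n) (\<lambda>n' n\<^sub>0.
           tns K H T (prd K H m' n') (tns K M N m\<^sub>0 n\<^sub>0)))))\<rparr>)"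


section \<open>Quasi-braided pre-tensor categories\<close>

record ('o, 'm) cat =
  obj :: "'o set"
  arr :: "'m set"
  dom :: "'m \<Rightarrow> 'o"
  cod :: "'m \<Rightarrow> 'o"
  idn :: "'o \<Rightarrow> 'm"
  cmp :: "'m \<Rightarrow> 'm \<Rightarrow> 'm" (infixr \<open>\<cdot>\<index>\<close> 65)

definition homs :: "('o, 'm, 'x) cat_scheme \<Rightarrow> 'o \<Rightarrow> 'o \<Rightarrow> 'm set"
  where "homs C A B = {f \<in> arr C. dom C f = A \<and> cod C f = B}"

definition inverse_arrows :: "('o, 'm, 'x) cat_scheme \<Rightarrow> 'm \<Rightarrow> 'm \<Rightarrow> bool"
  where "inverse_arrows C f g \<longleftrightarrow>
    g \<in> homs C (cod C f) (dom C f) \<and> g \<cdot>\<^bsub>C\<^esub> f = idn C (dom C f) \<and> f \<cdot>\<^bsub>C\<^esub> g = idn C (cod C f)"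

definition is_iso :: "('o, 'm, 'x) cat_scheme \<Rightarrow> 'm \<Rightarrow> bool"
  where "is_iso C f \<longleftrightarrow> f \<in> arr C \<and> (\<exists>g. inverse_arrows C f g)"

definition inv_arr :: "('o, 'm, 'x) cat_scheme \<Rightarrow> 'm \<Rightarrow> 'm"
  where "inv_arr C f = (THE g. inverse_arrows C f g)"

locale category =
  fixes C :: "('o, 'm, 'x) cat_scheme" (structure)
  assumes dom_obj: "f \<in> arr C \<Longrightarrow> dom C f \<in> obj C"
    and cod_obj: "f \<in> arr C \<Longrightarrow> cod C f \<in> obj C"
    and idn_hom: "A \<in> obj C \<Longrightarrow> idn C A \<in> homs C A A"
    and cmp_hom: "\<lbrakk>f \<in> homs C A B; g \<in> homs C B D\<rbrakk> \<Longrightarrow> g \<cdot> f \<in> homs C A D"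
    and cmp_idn: "f \<in> homs C A B \<Longrightarrow> f \<cdot> idn C A = f"
    and idn_cmp: "f \<in> homs C A B \<Longrightarrow> idn C B \<cdot> f = f"
    and cmp_assoc: "\<lbrakk>f \<in> homs C A B; g \<in> homs C B D; h \<in> homs C D E\<rbrakk>
      \<Longrightarrow> (h \<cdot> g) \<cdot> f = h \<cdot> (g \<cdot> f)"

locale pretensor_category = category C
  for C :: "('o, 'm, 'x) cat_scheme" (structure) +
  fixes tob :: "'o \<Rightarrow> 'o \<Rightarrow> 'o" (infixr \<open>\<boxtimes>\<close> 75)
    and tar :: "'m \<Rightarrow> 'm \<Rightarrow> 'm" (infixr \<open>\<diamondop>\<close> 75)
    and a :: "'o \<Rightarrow> 'o \<Rightarrow> 'o \<Rightarrow> 'm"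
  assumes tob_obj: "\<lbrakk>U \<in> obj C; V \<in> obj C\<rbrakk> \<Longrightarrow> U \<boxtimes> V \<in> obj C"
    and tar_hom: "\<lbrakk>f \<in> homs C U U'; g \<in> homs C V V'\<rbrakk> \<Longrightarrow> f \<diamondop> g \<in> homs C (U \<boxtimes> V) (U' \<boxtimes> V')"
    and tar_idn: "\<lbrakk>U \<in> obj C; V \<in> obj C\<rbrakk> \<Longrightarrow> idn C U \<diamondop> idn C V = idn C (U \<boxtimes> V)"
    and tar_cmp: "\<lbrakk>f \<in> homs C U U'; f' \<in> homs C U' U''; g \<in> homs C V V'; g' \<in> homs C V' V''\<rbrakk>
      \<Longrightarrow> (f' \<cdot> f) \<diamondop> (g' \<cdot> g) = (f' \<diamondop> g') \<cdot> (f \<diamondop> g)"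
    and assoc_hom: "\<lbrakk>U \<in> obj C; V \<in> obj C; W \<in> obj C\<rbrakk>
      \<Longrightarrow> a U V W \<in> homs C ((U \<boxtimes> V) \<boxtimes> W) (U \<boxtimes> (V \<boxtimes> W))"
    and assoc_iso: "\<lbrakk>U \<in> obj C; V \<in> obj C; W \<in> obj C\<rbrakk> \<Longrightarrow> is_iso C (a U V W)"
    and assoc_natural: "\<lbrakk>f \<in> homs C U U'; g \<in> homs C V V'; h \<in> homs C W W'\<rbrakk>
      \<Longrightarrow> a U' V' W' \<cdot> ((f \<diamondop> g) \<diamondop> h) = (f \<diamondop> (g \<diamondop> h)) \<cdot> a U V W"
    and pentagon: "\<lbrakk>U \<in> obj C; V \<in> obj C; W \<in> obj C; X \<in> obj C\<rbrakk>
      \<Longrightarrow> a U V (W \<boxtimes> X) \<cdot> a (U \<boxtimes> V) W X =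
          (idn C U \<diamondop> a V W X) \<cdot> a U (V \<boxtimes> W) X \<cdot> (a U V W \<diamondop> idn C X)"

locale quasi_braided_pretensor_category = pretensor_category C tob tar a
  for C :: "('o, 'm, 'x) cat_scheme" (structure)
    and tob :: "'o \<Rightarrow> 'o \<Rightarrow> 'o" (infixr \<open>\<boxtimes>\<close> 75)
    and tar :: "'m \<Rightarrow> 'm \<Rightarrow> 'm" (infixr \<open>\<diamondop>\<close> 75)
    and a :: "'o \<Rightarrow> 'o \<Rightarrow> 'o \<Rightarrow> 'm" +
  fixes c :: "'o \<Rightarrow> 'o \<Rightarrow> 'm"
  assumes braid_hom: "\<lbrakk>V \<in> obj C; W \<in> obj C\<rbrakk> \<Longrightarrow> c V W \<in> homs C (V \<boxtimes> W) (W \<boxtimes> V)"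
    and braid_natural: "\<lbrakk>f \<in> homs C V V'; g \<in> homs C W W'\<rbrakk>
      \<Longrightarrow> c V' W' \<cdot> (f \<diamondop> g) = (g \<diamondop> f) \<cdot> c V W"
    and hexagon1: "\<lbrakk>U \<in> obj C; V \<in> obj C; W \<in> obj C\<rbrakk>
      \<Longrightarrow> a V W U \<cdot> c U (V \<boxtimes> W) \<cdot> a U V W =
          (idn C V \<diamondop> c U W) \<cdot> a V U W \<cdot> (c U V \<diamondop> idn C W)"
    and hexagon2: "\<lbrakk>U \<in> obj C; V \<in> obj C; W \<in> obj C\<rbrakk>
      \<Longrightarrow> inv_arr C (a W U V) \<cdot> c (U \<boxtimes> V) W \<cdot> inv_arr C (a U V W) =
          (c U W \<diamondop> idn C V) \<cdot> inv_arr C (a U W V) \<cdot> (idn C U \<diamondop> c V W)"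


section \<open>The category of Yetter-Drinfeld modules\<close>

text \<open>
  An arrow is a triple of its domain, its underlying function and its codomain.  The function is
  \<open>extensional\<close>, i.e. \<open>undefined\<close> outside the carrier of the domain, so that arrows are equal if and
  only if they agree on that carrier.
\<close>

type_synonym ('k, 'a) yd_arr = "('k, 'a) hom_yd \<times> ('a univ \<Rightarrow> 'a univ) \<times> ('k, 'a) hom_yd"

definition yd_objects ::
  "('k, 'r) ring_scheme \<Rightarrow> ('k, 'a, 'h) hom_bialg_scheme \<Rightarrow> ('k, 'a) hom_yd set"
  where "yd_objects K H =
    {M. yetter_drinfeld K H M \<and> bij_betw (twist M) (carrier M) (carrier M)}"

definition YD ::
  "('k, 'r) ring_scheme \<Rightarrow> ('k, 'a, 'h) hom_bialg_scheme \<Rightarrow> (('k, 'a) hom_yd, ('k, 'a) yd_arr) cat"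
  where "YD K H =
    \<lparr>obj = yd_objects K H,
     arr = {(M, f, N). M \<in> yd_objects K H \<and> N \<in> yd_objects K H \<and> f \<in> extensional (carrier M) \<and>
       hom_module_morphism K H M N f \<and> hom_comodule_morphism K H M N f},
     dom = (\<lambda>(M, f, N). M),
     cod = (\<lambda>(M, f, N). N),
     idn = (\<lambda>M. (M, \<lambda>x\<in>carrier M. x, M)),
     cmp = (\<lambda>(_, g, P) (M, f, _). (M, compose (carrier M) g f, P))\<rparr>"

definition yd_tensor_arr ::
  "('k, 'r) ring_scheme \<Rightarrow> ('k, 'a, 'h) hom_bialg_scheme
    \<Rightarrow> ('k, 'a) yd_arr \<Rightarrow> ('k, 'a) yd_arr \<Rightarrow> ('k, 'a) yd_arr"
  where "yd_tensor_arr K H = (\<lambda>(M, f, M') (N, g, N').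
    (yd_tensor K H M N,
     restrict (tensor_map K M' N' f g) (carrier (yd_tensor K H M N)),
     yd_tensor K H M' N'))"

definition yd_assoc ::
  "('k, 'r) ring_scheme \<Rightarrow> ('k, 'a, 'h) hom_bialg_scheme
    \<Rightarrow> ('k, 'a) hom_yd \<Rightarrow> ('k, 'a) hom_yd \<Rightarrow> ('k, 'a) hom_yd \<Rightarrow> ('k, 'a) yd_arr"
  where "yd_assoc K H M N P =
    (let S = yd_tensor K H (yd_tensor K H M N) P; T = yd_tensor K H M (yd_tensor K H N P) in
    (S,
     \<lambda>t\<in>carrier S. sweedler T t (\<lambda>x p. sweedler T x (\<lambda>m n.
       tns K M (yd_tensor K H N P) (twist M m) (tns K N P n (twist_inv P p)))),
     T))"

definition yd_braid ::
  "('k, 'r) ring_scheme \<Rightarrow> ('k, 'a, 'h) hom_bialg_scheme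
    \<Rightarrow> ('k, 'a) hom_yd \<Rightarrow> ('k, 'a) hom_yd \<Rightarrow> ('k, 'a) yd_arr"
  where "yd_braid K H M N =
    (let S = yd_tensor K H M N; T = yd_tensor K H N M in
    (S,
     \<lambda>t\<in>carrier S. sweedler T t (\<lambda>m n. sweedler T (coaction M m) (\<lambda>m' m\<^sub>0.
       tns K N M (twist_inv N (act K H N (twist_inv H m') n)) (twist_inv M m\<^sub>0))),
     T))"

end

theory Submission
  imports Defs
begin

text \<open>
  A multilinear expression over Sweedler components is a nested sum \<open>comult_sum\<close> (over \<open>\<Delta>(h)\<close>) or
  \<open>coact_sum\<close> (over \<open>\<lambda>(m)\<close>) with values in an arbitrary vector space.  Testing the axioms of a
  Yetter-Drinfeld module against multilinear maps turns them into rewrite rules for such sums, and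
  since \<open>\<alpha>\<close> is invertible, coassociativity may be applied to any trilinear summand.  By the universal
  property of the tensor product every identity has to be checked on pure tensors only.  There,
  compatibility for \<open>M \<otimes> N\<close> follows by using compatibility for \<open>N\<close> on \<open>h\<^sub>2\<close> and then, after an
  application of coassociativity, compatibility for \<open>M\<close> on \<open>h\<^sub>1\<close>; the braiding is a module map
  by one application of compatibility, a comodule map by one more between two uses of
  coassociativity of \<open>M\<close>; the first hexagon is coassociativity of the coaction and the second one
  is associativity of the action.
\<close>

section \<open>Linear maps and Sweedler sums\<close>

text \<open>The obstacle is that Sweedler components are entries of a list picked by choice:
  \<open>\<Delta>(h)\<close> may be rewritten as another sum only under a bilinear summand, so each
  step owes linearity in every variable and membership in the carriers. The calculus is built so
  that the simplifier pays this debt: linearity rules follow the shape of a term, congruence rules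
  supply carrier membership of bound variables, and sums are pulled to the outside. What remains to
  be written by hand are the uses of coassociativity and compatibility and the exchanges of sums.
  The powers of the twists in the statement match this bookkeeping. With \<open>\<alpha>\<close> to
  the power -2 in the diagonal action, compatibility read at \<open>\<beta> (\<beta> h)\<close>
  applies as it stands; the twist and inverse twist on the outer factors of the associator are the
  shift by which Hom-associativity and Hom-coassociativity differ from the strict laws.\<close>

lemma linear_map_closed: "linear_map K M N f \<Longrightarrow> x \<in> carrier M \<Longrightarrow> f x \<in> carrier N"
  by (auto simp: linear_map_def)

lemma linear_map_add:
  "\<lbrakk>linear_map K M N f; x \<in> carrier M; y \<in> carrier M\<rbrakk> \<Longrightarrow> f (x \<oplus>\<^bsub>M\<^esub> y) = f x \<oplus>\<^bsub>N\<^esub> f y"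
  by (auto simp: linear_map_def)

lemma linear_map_smult:
  "\<lbrakk>linear_map K M N f; r \<in> carrier K; x \<in> carrier M\<rbrakk> \<Longrightarrow> f (r \<odot>\<^bsub>M\<^esub> x) = r \<odot>\<^bsub>N\<^esub> f x"
  by (auto simp: linear_map_def)

lemma linear_map_zero:
  assumes "module K M" "module K N" "linear_map K M N f"
  shows "f \<zero>\<^bsub>M\<^esub> = \<zero>\<^bsub>N\<^esub>"
proof -
  interpret M: module K M by fact
  interpret N: module K N by fact
  have "f (\<zero>\<^bsub>K\<^esub> \<odot>\<^bsub>M\<^esub> \<zero>\<^bsub>M\<^esub>) = \<zero>\<^bsub>K\<^esub> \<odot>\<^bsub>N\<^esub> f \<zero>\<^bsub>M\<^esub>"
    using assms(3) by (intro linear_map_smult[of K M N]) auto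
  then show ?thesis using linear_map_closed[OF assms(3) M.zero_closed] by simp
qed

lemma linear_map_comp:
  "linear_map K N P g \<Longrightarrow> linear_map K M N f \<Longrightarrow> linear_map K M P (\<lambda>x. g (f x))"
  by (auto simp: linear_map_def Pi_iff)

lemma linear_map_id: "linear_map K M M (\<lambda>x. x)"
  by (auto simp: linear_map_def)

lemma linear_map_cong:
  assumes "module K M" "\<And>x. x \<in> carrier M \<Longrightarrow> f x = g x"
  shows "linear_map K M N f = linear_map K M N g"
proof -
  interpret M: module K M by fact
  show ?thesis using assms(2) by (auto simp: linear_map_def Pi_iff)
qed

lemma bilinear_map_comp:
  "\<lbrakk>bilinear_map K M N U F; linear_map K V M f; linear_map K W N g\<rbrakk>
    \<Longrightarrow> bilinear_map K V W U (\<lambda>x y. F (f x) (g y))"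
  by (auto simp: bilinear_map_def linear_map_closed
      intro: linear_map_comp[where f = f] linear_map_comp[where f = g])

lemma linear_map_inv_into:
  assumes "module K M" and f: "linear_map K M N f" and bij: "bij_betw f (carrier M) (carrier N)"
  shows "linear_map K N M (inv_into (carrier M) f)"
proof -
  interpret M: module K M by fact
  let ?g = "inv_into (carrier M) f"
  have g: "?g y \<in> carrier M" "f (?g y) = y" if "y \<in> carrier N" for y
    using bij that by (auto simp: bij_betw_def inv_into_into f_inv_into_f)
  have gf: "?g (f x) = x" if "x \<in> carrier M" for x
    using bij that by (simp add: bij_betw_def)
  show ?thesis unfolding linear_map_def
  proof (intro conjI ballI funcsetI)
    fix y z assume "y \<in> carrier N" "z \<in> carrier N"
    then show "?g (y \<oplus>\<^bsub>N\<^esub> z) = ?g y \<oplus>\<^bsub>M\<^esub> ?g z"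
      using gf[of "?g y \<oplus>\<^bsub>M\<^esub> ?g z"] g by (simp add: linear_map_add[OF f])
  next
    fix r y assume "r \<in> carrier K" "y \<in> carrier N"
    then show "?g (r \<odot>\<^bsub>N\<^esub> y) = r \<odot>\<^bsub>M\<^esub> ?g y"
      using gf[of "r \<odot>\<^bsub>M\<^esub> ?g y"] g by (simp add: linear_map_smult[OF f])
  qed (rule g)
qed

section \<open>Sums over the chosen summands of a tensor\<close>

lemma summands_carrier:
  assumes "module K M" "module K N" "t \<in> carrier (tensor K M N)"
  shows "set (summands t) \<subseteq> carrier M \<times> carrier N"
proof -
  obtain X where "set X \<subseteq> carrier M \<times> carrier N" "t = tensor_class K M N X"
    using assms(3) by (rule tensor_carrierE)
  \<comment> \<open>The chosen list is related to \<open>X\<close> by \<open>tensor_eq\<close>, and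
    that relation only holds between lists of carrier pairs.\<close>
  then show ?thesis
    using tensor_eq_wf[OF assms(1,2) summands_tensor_class[of X M N K]] by simp
qed

text \<open>Both sides fold over the same chosen list, so agreement on carrier elements is enough,
  whatever \<open>F\<close> and \<open>G\<close> are. The later congruence rules for rewriting under
  Sweedler variables rest on this.\<close>

lemma sweedler_cong:
  assumes "module K M" "module K N" "t \<in> carrier (tensor K M N)"
    and "\<And>x y. \<lbrakk>x \<in> carrier M; y \<in> carrier N\<rbrakk> \<Longrightarrow> F x y = G x y"
  shows "sweedler U t F = sweedler U t G"
  unfolding sweedler_def using summands_carrier[OF assms(1-3)]
  by (intro foldr_cong) (auto simp: assms(4))

context
  fixes K :: "('k, 'r) ring_scheme" and M :: "('k, 'a univ, 'm) module_scheme"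
    and N :: "('k, 'a univ, 'n) module_scheme" and U :: "('k, 'u, 'p) module_scheme" and t
  assumes M: "module K M" and N: "module K N" and U: "module K U"
    and t: "t \<in> carrier (tensor K M N)"
begin

interpretation U: module K U by (rule U)

lemma summands_induct [consumes 0, case_names Nil Cons]:
  assumes "P []"
    and "\<And>m n X. \<lbrakk>m \<in> carrier M; n \<in> carrier N; set X \<subseteq> carrier M \<times> carrier N; P X\<rbrakk>
      \<Longrightarrow> P ((m, n) # X)"
  shows "P (summands t)"
proof -
  have "set X \<subseteq> carrier M \<times> carrier N \<Longrightarrow> P X" for X
    by (induction X) (auto simp: assms)
  then show ?thesis using summands_carrier[OF M N t] by blast
qed

lemma sweedler_closed:
  assumes "\<And>x y. \<lbrakk>x \<in> carrier M; y \<in> carrier N\<rbrakk> \<Longrightarrow> F x y \<in> carrier U"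
  shows "sweedler U t F \<in> carrier U"
  unfolding sweedler_def by (induction rule: summands_induct) (auto simp: assms)

lemma linear_map_sweedler:
  assumes "\<And>x y. \<lbrakk>x \<in> carrier M; y \<in> carrier N\<rbrakk> \<Longrightarrow> F x y \<in> carrier U"
    and V: "module K V" and g: "linear_map K U V g"
  shows "g (sweedler U t F) = sweedler V t (\<lambda>x y. g (F x y))"
proof -
  \<comment> \<open>Membership of the partial sums in \<open>carrier U\<close> is carried through
    the induction because \<open>g\<close> is additive only there.\<close>
  have "foldr (\<lambda>(m, n) u. F m n \<oplus>\<^bsub>U\<^esub> u) (summands t) \<zero>\<^bsub>U\<^esub> \<in> carrier U \<and>
      g (foldr (\<lambda>(m, n) u. F m n \<oplus>\<^bsub>U\<^esub> u) (summands t) \<zero>\<^bsub>U\<^esub>)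
      = foldr (\<lambda>(m, n) u. g (F m n) \<oplus>\<^bsub>V\<^esub> u) (summands t) \<zero>\<^bsub>V\<^esub>"
    by (induction rule: summands_induct)
      (auto simp: assms(1) linear_map_add[OF g] linear_map_zero[OF U V g])
  then show ?thesis by (simp add: sweedler_def)
qed

lemma sweedler_param_linear:
  assumes "\<And>x y. \<lbrakk>x \<in> carrier M; y \<in> carrier N\<rbrakk> \<Longrightarrow> linear_map K V U (\<lambda>v. F v x y)"
  shows "linear_map K V U (\<lambda>v. sweedler U t (F v))"
  unfolding sweedler_def
proof (induction rule: summands_induct)
  case Nil
  then show ?case by (auto simp: linear_map_def)
next
  case (Cons m n X)
  note lin = assms[OF Cons(1,2)]
  show ?case
    using lin Cons(4)
    by (auto simp: linear_map_def Pi_iff U.smult_r_distr U.a_ac)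
qed

lemma sweedler_add:
  assumes "\<And>x y. \<lbrakk>x \<in> carrier M; y \<in> carrier N\<rbrakk> \<Longrightarrow> F x y \<in> carrier U"
    and "\<And>x y. \<lbrakk>x \<in> carrier M; y \<in> carrier N\<rbrakk> \<Longrightarrow> G x y \<in> carrier U"
  shows "sweedler U t (\<lambda>x y. F x y \<oplus>\<^bsub>U\<^esub> G x y) = sweedler U t F \<oplus>\<^bsub>U\<^esub> sweedler U t G"
proof -
  let ?s = "\<lambda>F. foldr (\<lambda>(m, n) u. F m n \<oplus>\<^bsub>U\<^esub> u) (summands t) \<zero>\<^bsub>U\<^esub>"
  have "?s F \<in> carrier U \<and> ?s G \<in> carrier U \<and> ?s (\<lambda>x y. F x y \<oplus>\<^bsub>U\<^esub> G x y) = ?s F \<oplus>\<^bsub>U\<^esub> ?s G"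
    by (induction rule: summands_induct) (auto simp: assms U.a_ac)
  then show ?thesis by (simp add: sweedler_def)
qed

lemma sweedler_zero: "sweedler U t (\<lambda>x y. \<zero>\<^bsub>U\<^esub>) = \<zero>\<^bsub>U\<^esub>"
  unfolding sweedler_def by (induction rule: summands_induct) auto

end

text \<open>The inner sum is additive in its summand, so it passes through each addition of the
  outer fold.\<close>

lemma sweedler_swap:
  assumes "module K M" "module K N" "module K M'" "module K N'" "module K U"
    and t: "t \<in> carrier (tensor K M N)" and s: "s \<in> carrier (tensor K M' N')"
    and F: "\<And>x y z w. \<lbrakk>x \<in> carrier M; y \<in> carrier N; z \<in> carrier M'; w \<in> carrier N'\<rbrakk>
      \<Longrightarrow> F x y z w \<in> carrier U"
  shows "sweedler U t (\<lambda>x y. sweedler U s (F x y)) = sweedler U s (\<lambda>z w. sweedler U t (\<lambda>x y. F x y z w))"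
proof -
  interpret U: module K U by fact
  note sw = sweedler_closed[OF assms(3-5) s] sweedler_add[OF assms(3-5) s] sweedler_zero[OF assms(3-5) s]
  let ?s = "\<lambda>X F. foldr (\<lambda>(m, n) u. F m n \<oplus>\<^bsub>U\<^esub> u) X \<zero>\<^bsub>U\<^esub>"
  \<comment> \<open>The outer sum is generalized from \<open>summands t\<close> to an arbitrary list
    \<open>X\<close>, as the tail of a chosen representative need not itself be one.\<close>
  have "(\<forall>z\<in>carrier M'. \<forall>w\<in>carrier N'. ?s X (\<lambda>x y. F x y z w) \<in> carrier U) \<and>
      ?s X (\<lambda>x y. sweedler U s (F x y)) = sweedler U s (\<lambda>z w. ?s X (\<lambda>x y. F x y z w))"
    if "set X \<subseteq> carrier M \<times> carrier N" for X
    using that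
  proof (induction X)
    case (Cons p X)
    obtain m n where p: "p = (m, n)" "m \<in> carrier M" "n \<in> carrier N" using Cons.prems by auto
    have "sweedler U s (\<lambda>z w. F m n z w \<oplus>\<^bsub>U\<^esub> ?s X (\<lambda>x y. F x y z w))
        = sweedler U s (F m n) \<oplus>\<^bsub>U\<^esub> sweedler U s (\<lambda>z w. ?s X (\<lambda>x y. F x y z w))"
      using Cons p by (intro sw) (auto simp: F)
    then show ?case using Cons p by (auto simp: F)
  qed (simp add: sw)
  from this[OF summands_carrier[OF assms(1,2) t]] show ?thesis
    by (simp add: sweedler_def[of U t])
qed

lemma linear_map_of_sweedler:
  assumes "module K M" "module K N" "module K U" "bilinear_map K M N U F"
    and "linear_map K V (tensor K M N) f"
  shows "linear_map K V U (\<lambda>x. sweedler U (f x) F)"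
  by (rule linear_map_comp[OF sweedler_linear assms(5)]) fact+

section \<open>Tensor products of linear maps and rebracketing\<close>

lemma tns_closed:
  "m \<in> carrier M \<Longrightarrow> n \<in> carrier N \<Longrightarrow> tns K M N m n \<in> carrier (tensor K M N)"
  by (auto simp: tns_def intro: tensor_carrierI)

lemma linear_map_tns_left:
  assumes "module K M" "module K N" "linear_map K V M f" "n \<in> carrier N"
  shows "linear_map K V (tensor K M N) (\<lambda>x. tns K M N (f x) n)"
  using tns_bilinear[OF assms(1,2)] assms(4)
  by (intro linear_map_comp[OF _ assms(3)]) (simp add: bilinear_map_def)

lemma linear_map_tns_right:
  assumes "module K M" "module K N" "linear_map K V N f" "m \<in> carrier M"
  shows "linear_map K V (tensor K M N) (\<lambda>x. tns K M N m (f x))"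
  using tns_bilinear[OF assms(1,2)] assms(4)
  by (intro linear_map_comp[OF _ assms(3)]) (simp add: bilinear_map_def)

lemma bilinear_map_tns:
  assumes "module K M" "module K N" "linear_map K V M f" "linear_map K W N g"
  shows "bilinear_map K V W (tensor K M N) (\<lambda>x y. tns K M N (f x) (g y))"
  using assms by (auto simp: bilinear_map_def linear_map_closed intro!: linear_map_tns_left linear_map_tns_right)

lemma tensor_map_linear:
  assumes "module K V" "module K W" "module K M" "module K N"
    and "linear_map K V M f" "linear_map K W N g"
  shows "linear_map K (tensor K V W) (tensor K M N) (tensor_map K M N f g)"
  unfolding tensor_map_def
  by (intro sweedler_linear module_tensor bilinear_map_tns assms)

lemma tensor_map_tns:
  assumes "module K V" "module K W" "module K M" "module K N"
    and "linear_map K V M f" "linear_map K W N g" "v \<in> carrier V" "w \<in> carrier W"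
  shows "tensor_map K M N f g (tns K V W v w) = tns K M N (f v) (g w)"
  unfolding tensor_map_def
  by (intro sweedler_tns[where F = "\<lambda>x y. tns K M N (f x) (g y)"] module_tensor bilinear_map_tns assms)

text \<open>The linear map induced by \<open>F\<close> is moved into the sum that defines
  \<open>f \<otimes> g\<close>, where it meets pure tensors only. Axioms stated with
  \<open>tensor_map\<close> become statements about summands through this rule.\<close>

lemma sweedler_tensor_map:
  assumes "module K V" "module K W" "module K M" "module K N" "module K U"
    and f: "linear_map K V M f" and g: "linear_map K W N g"
    and t: "t \<in> carrier (tensor K V W)" and F: "bilinear_map K M N U F"
  shows "sweedler U (tensor_map K M N f g t) F = sweedler U t (\<lambda>x y. F (f x) (g y))"
  unfolding tensor_map_def
  by (subst linear_map_sweedler[OF assms(1,2) module_tensor[OF assms(3,4)] t _ assms(5)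
        sweedler_linear[OF assms(3-5) F]])
    (auto intro!: tns_closed sweedler_cong[OF assms(1,2) t] sweedler_tns[OF assms(3-5) F]
      simp: linear_map_closed[OF f] linear_map_closed[OF g])

lemma rebracket_bilinear:
  assumes M: "module K M" "module K N" "module K P"
  shows "bilinear_map K (tensor K M N) P (tensor K M (tensor K N P)) (\<lambda>x p.
      sweedler (tensor K M (tensor K N P)) x (\<lambda>m n. tns K M (tensor K N P) m (tns K N P n p)))"
proof -
  note mods = M module_tensor[OF M(2,3)] module_tensor[OF M(1) module_tensor[OF M(2,3)]] 
  have inner: "bilinear_map K M N (tensor K M (tensor K N P)) (\<lambda>m n. tns K M (tensor K N P) m (tns K N P n p))"
    if "p \<in> carrier P" for p
    using that by (intro bilinear_map_tns linear_map_id linear_map_tns_left mods)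
  show ?thesis
    unfolding bilinear_map_def
    by (auto intro!: sweedler_linear[OF mods(1,2,5)] inner
        sweedler_param_linear[OF mods(1,2,5)] linear_map_tns_right[OF mods(1,4)] linear_map_tns_right[OF mods(2,3)]
        linear_map_id)
qed

lemma sweedler_rebracket:
  assumes M: "module K M" "module K N" "module K P" and U: "module K U"
    and t: "t \<in> carrier (tensor K (tensor K M N) P)"
    and g: "linear_map K (tensor K M (tensor K N P)) U g"
  shows "g (rebracket K M N P t) = sweedler U t (\<lambda>x p. sweedler U x (\<lambda>m n.
      g (tns K M (tensor K N P) m (tns K N P n p))))"
proof -
  note mods = M module_tensor[OF M(2,3)] module_tensor[OF M(1) module_tensor[OF M(2,3)]]
     module_tensor[OF M(1,2)]
  show ?thesis
    unfolding rebracket_def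
    by (subst linear_map_sweedler[OF mods(6,3,5) t _ U g])
      (auto intro!: sweedler_cong[OF mods(6,3) t] linear_map_sweedler[OF M(1,2) mods(5) _ _ U g]
         sweedler_closed[OF mods(1,2,5)] tns_closed)
qed

text \<open>By currying, a trilinear \<open>F\<close> induces a linear map on
  \<open>M \<otimes> (N \<otimes> P)\<close>; applied to both sides of
  \<open>rebracket K M N P t = s\<close> it gives the two nested sums. Coassociativity of
  \<open>H\<close> and of comodules is exploited through this test.\<close>

lemma sweedler_coassoc:
  assumes M: "module K M" "module K N" "module K P" and U: "module K U"
    and t: "t \<in> carrier (tensor K (tensor K M N) P)" "rebracket K M N P t = s"
    and F: "\<And>y z. \<lbrakk>y \<in> carrier N; z \<in> carrier P\<rbrakk> \<Longrightarrow> linear_map K M U (\<lambda>x. F x y z)"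
      "\<And>x z. \<lbrakk>x \<in> carrier M; z \<in> carrier P\<rbrakk> \<Longrightarrow> linear_map K N U (\<lambda>y. F x y z)"
      "\<And>x y. \<lbrakk>x \<in> carrier M; y \<in> carrier N\<rbrakk> \<Longrightarrow> linear_map K P U (\<lambda>z. F x y z)"
  shows "sweedler U t (\<lambda>x p. sweedler U x (\<lambda>m n. F m n p)) = sweedler U s (\<lambda>m y. sweedler U y (F m))"
proof -
  note mods = M U module_tensor[OF M(2,3)] module_tensor[OF M(1,2)]
  have bil: "bilinear_map K N P U (F m)" if "m \<in> carrier M" for m
    using F that by (simp add: bilinear_map_def)
  have G: "bilinear_map K M (tensor K N P) U (\<lambda>m y. sweedler U y (F m))"
    unfolding bilinear_map_def
    by (auto intro!: sweedler_linear mods bil sweedler_param_linear[OF mods(2,3,4)] F)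
  have "sweedler U (rebracket K M N P t) (\<lambda>m y. sweedler U y (F m))
      = sweedler U t (\<lambda>x p. sweedler U x (\<lambda>m n.
          sweedler U (tns K M (tensor K N P) m (tns K N P n p)) (\<lambda>m y. sweedler U y (F m))))"
    by (rule sweedler_rebracket[OF M U t(1) sweedler_linear[OF mods(1,5,4) G]])
  also have "\<dots> = sweedler U t (\<lambda>x p. sweedler U x (\<lambda>m n. F m n p))"
    by (intro sweedler_cong[OF mods(6,3) t(1)] sweedler_cong[OF M(1,2)])
      (simp_all add: sweedler_tns[OF mods(1,5,4) G] sweedler_tns[OF mods(2,3,4) bil] tns_closed)
  finally show ?thesis using t(2) by simp
qed

section \<open>Dependence of the tensor product on the module records\<close>

lemma tensor_eq_cong:
  assumes "tensor_eq K M N X Y"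
    and "carrier M = carrier M'" "add M = add M'" "zero M = zero M'" "smult M = smult M'"
    and "carrier N = carrier N'" "add N = add N'" "zero N = zero N'" "smult N = smult N'"
  shows "tensor_eq K M' N' X Y"
  using assms(1)
proof induction
  case (refl X)
  then show ?case by (rule_tac tensor_eq.refl) (simp add: assms)
next
  case (sym X Y)
  then show ?case by (rule_tac tensor_eq.sym)
next
  case (trans X Y Z)
  then show ?case by (rule_tac tensor_eq.trans)
next
  case (append X X' Y Y')
  then show ?case by (rule_tac tensor_eq.append)
next
  case (comm X Y)
  then show ?case by (rule_tac tensor_eq.comm) (simp_all add: assms)
next
  case (zero n)
  then show ?case using tensor_eq.zero[of n N' K M'] by (simp add: assms)
next
  case (add_left m m' n)
  then show ?case using tensor_eq.add_left[of m M' m' n N' K] by (simp add: assms)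
next
  case (add_right m n n')
  then show ?case using tensor_eq.add_right[of m M' n N' n' K] by (simp add: assms)
next
  case (scale r m n)
  then show ?case using tensor_eq.scale[of r K m M' n N'] by (simp add: assms)
qed

lemma tensor_class_cong:
  assumes "carrier M = carrier M'" "add M = add M'" "zero M = zero M'" "smult M = smult M'"
    and "carrier N = carrier N'" "add N = add N'" "zero N = zero N'" "smult N = smult N'"
  shows "tensor_class K M N = tensor_class K M' N'"
proof -
  have "tensor_eq K M N = tensor_eq K M' N'"
    using tensor_eq_cong[of K M N _ _ M' N'] tensor_eq_cong[of K M' N' _ _ M N] assms
    by (intro ext iffI) simp_all
  then show ?thesis by (simp add: tensor_class_def fun_eq_iff)
qed

text \<open>\<open>yd_tensor K H M N\<close> and \<open>tensor K M N\<close> are different records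
  with the same underlying vector space. Equal relations have equal \<open>SOME\<close> choices, so
  tensor products built over them are equal and not merely isomorphic, and either may stand for the
  other as a tensor factor.\<close>

lemma tensor_cong:
  assumes "carrier M = carrier M'" "add M = add M'" "zero M = zero M'" "smult M = smult M'"
    and "carrier N = carrier N'" "add N = add N'" "zero N = zero N'" "smult N = smult N'"
  shows "tensor K M N = tensor K M' N'" "tns K M N = tns K M' N'"
  using assms tensor_class_cong[OF assms, of K]
  by (auto simp: tensor_def tns_def fun_eq_iff)


section \<open>Sweedler calculus for Yetter-Drinfeld modules\<close>

text \<open>A constant separate from \<open>sweedler\<close>, so that congruence rules can place the
  bound variables in \<open>carrier H\<close> and rewrite rules can match on the comultiplied
  element; \<open>coact_sum\<close> serves the same end for coactions.\<close>

definition comult_sum ::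
  "('k, 'a, 'h) hom_bialg_scheme \<Rightarrow> ('k, 'u, 'p) module_scheme \<Rightarrow> 'a univ
    \<Rightarrow> ('a univ \<Rightarrow> 'a univ \<Rightarrow> 'u) \<Rightarrow> 'u"
  where "comult_sum H U h F = sweedler U (hcomult H h) F"

definition coact_sum ::
  "('k, 'a, 'm) hom_yd_scheme \<Rightarrow> ('k, 'u, 'p) module_scheme \<Rightarrow> 'a univ
    \<Rightarrow> ('a univ \<Rightarrow> 'a univ \<Rightarrow> 'u) \<Rightarrow> 'u"
  where "coact_sum M U m F = sweedler U (coaction M m) F"

text \<open>
  As a congruence rule, this keeps the simplifier from rewriting the body of \<open>f\<close>, whose bound variable
  is not known to lie in a carrier.
\<close>

lemma linear_map_weak_cong: "linear_map K M N f = linear_map K M N f"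
  by simp

section \<open>Hom-bialgebras with bijective twist\<close>

locale bij_hom_bialgebra = hom_bialgebra K H
  for K :: "('k, 'r) ring_scheme" and H :: "('k, 'a, 'h) hom_bialg_scheme" +
  assumes bij_twist: "bij_betw (twist H) (carrier H) (carrier H)"
begin

abbreviation twH ("\<alpha>") where "\<alpha> \<equiv> twist H"
abbreviation twinvH ("\<beta>") where "\<beta> \<equiv> twist_inv H"
abbreviation prdH (infixl "\<star>" 72) where "h \<star> h' \<equiv> prd K H h h'"
abbreviation actH ("(_ \<triangleright>\<^bsub>_\<^esub> _)" [72, 0, 71] 71) where "h \<triangleright>\<^bsub>M\<^esub> m \<equiv> act K H M h m"
abbreviation yd :: "('k, 'a) hom_yd \<Rightarrow> bool" where "yd M \<equiv> yetter_drinfeld K H M"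
abbreviation lin where "lin \<equiv> linear_map K"
abbreviation D where "D \<equiv> comult_sum H"
abbreviation C where "C \<equiv> coact_sum"
abbreviation tensor_yd (infixr "\<boxtimes>" 75) where "M \<boxtimes> N \<equiv> yd_tensor K H M N"

lemmas [cong] = linear_map_weak_cong

lemma module_H [simp]: "module K H"
  by (rule module_axioms)

lemma obj_bij: "M \<in> yd_objects K H \<Longrightarrow> bij_betw (twist M) (carrier M) (carrier M)"
  by (simp add: yd_objects_def)

lemma obj_yd [simp]: "M \<in> yd_objects K H \<Longrightarrow> yd M"
  by (simp add: yd_objects_def)

declare module_tensor [simp]

lemma tensor_yd_fields:
  "carrier (M \<boxtimes> N) = carrier (tensor K M N)" "add (M \<boxtimes> N) = add (tensor K M N)"
  "zero (M \<boxtimes> N) = zero (tensor K M N)" "smult (M \<boxtimes> N) = smult (tensor K M N)"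
  by (simp_all add: yd_tensor_def Let_def)

lemma module_tensor_yd [simp]:
  fixes M N :: "('k, 'a) hom_yd"
  assumes "module K M" "module K N"
  shows "module K (M \<boxtimes> N)"
proof -
  interpret T: module K "tensor K M N" using assms by (rule module_tensor)
  have neg: "\<exists>y\<in>carrier (tensor K M N). y \<oplus>\<^bsub>tensor K M N\<^esub> x = \<zero>\<^bsub>tensor K M N\<^esub>"
    if "x \<in> carrier (tensor K M N)" for x
    using that by (intro bexI[of _ "\<ominus>\<^bsub>tensor K M N\<^esub> x"]) (simp_all add: T.l_neg)
  show ?thesis
    by (intro moduleI abelian_groupI)
      (auto simp: tensor_yd_fields T.a_ac is_cring T.smult_l_distr T.smult_r_distr T.smult_assoc1
        intro: neg)
qed

text \<open>
  \<open>M \<boxtimes> N\<close> is preferred to \<open>tensor K M N\<close> as the vector space underlying it; the types tell this case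
  from \<open>tensor K H M\<close>, which is left alone.
\<close>

lemma module_level [simp]:
  fixes M N :: "('k, 'a) hom_yd"
  shows "carrier (tensor K M N) = carrier (M \<boxtimes> N)"
    "lin (tensor K M N) U f = lin (M \<boxtimes> N) U f"
    "lin W (tensor K M N) g = lin W (M \<boxtimes> N) g"
    "sweedler (tensor K M N) = sweedler (M \<boxtimes> N)"
    "D (tensor K M N) h G = D (M \<boxtimes> N) h G"
    "C P (tensor K M N) p G = C P (M \<boxtimes> N) p G"
    "tensor K V (tensor K M N) = tensor K V (M \<boxtimes> N)"
    "tensor K (tensor K M N) V = tensor K (M \<boxtimes> N) V"
    "tns K V (tensor K M N) = tns K V (M \<boxtimes> N)"
    "tns K (tensor K M N) V = tns K (M \<boxtimes> N) V"
proof -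
  show "tensor K V (tensor K M N) = tensor K V (M \<boxtimes> N)" "tensor K (tensor K M N) V = tensor K (M \<boxtimes> N) V"
    "tns K V (tensor K M N) = tns K V (M \<boxtimes> N)" "tns K (tensor K M N) V = tns K (M \<boxtimes> N) V"
    by (rule tensor_cong; simp add: tensor_yd_fields)+
qed (simp_all add: tensor_yd_fields linear_map_def sweedler_def comult_sum_def coact_sum_def fun_eq_iff)

lemma hcomult_closed: "h \<in> carrier H \<Longrightarrow> hcomult H h \<in> carrier (tensor K H H)"
  by (rule linear_map_closed[OF hcomult_linear])

lemma bilinear_prd: "bilinear_map K H H H (prd K H)"
  unfolding bilinear_map_def prd_def
  by (auto intro!: linear_map_comp[OF hmult_linear] linear_map_tns_left linear_map_tns_right linear_map_id)

text \<open>
  The part of the structure that the calculus of sums relies on; \<open>M \<boxtimes> N\<close> has it before it is known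
  to be a Yetter-Drinfeld module.
\<close>

definition yd_data :: "('k, 'a) hom_yd \<Rightarrow> bool"
  where "yd_data M \<longleftrightarrow> module K M \<and> lin M M (twist M) \<and> bilinear_map K H M M (act K H M) \<and>
    lin M (tensor K H M) (coaction M)"

lemma yd_data_module [simp]: "yd_data M \<Longrightarrow> module K M"
  and twist_linear_yd: "yd_data M \<Longrightarrow> lin M M (twist M)"
  and bilinear_act: "yd_data M \<Longrightarrow> bilinear_map K H M M (act K H M)"
  and coaction_linear_yd: "yd_data M \<Longrightarrow> lin M (tensor K H M) (coaction M)"
  by (simp_all add: yd_data_def)

lemma coaction_closed: "yd_data M \<Longrightarrow> m \<in> carrier M \<Longrightarrow> coaction M m \<in> carrier (tensor K H M)"
  by (rule linear_map_closed[OF coaction_linear_yd])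

lemma bilinear_act_of_action:
  assumes "module K M" "lin (tensor K H M) M (action M)"
  shows "bilinear_map K H M M (act K H M)"
  unfolding bilinear_map_def act_def using assms(1)
  by (auto intro!: linear_map_comp[OF assms(2)] linear_map_tns_left linear_map_tns_right linear_map_id)

lemma yd_yd_data [simp]: "yd M \<Longrightarrow> yd_data M"
  unfolding yd_data_def yetter_drinfeld_def left_hom_comodule_def left_hom_comodule_axioms_def
    left_hom_module_def left_hom_module_axioms_def hom_space_def hom_space_axioms_def
  by (blast intro: bilinear_act_of_action)

lemma twist_inv_linear_yd: "M \<in> yd_objects K H \<Longrightarrow> lin M M (twist_inv M)"
  unfolding twist_inv_def by (rule linear_map_inv_into) (simp_all add: twist_linear_yd obj_bij)

lemma twist_inv_linear: "lin H H \<beta>"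
  unfolding twist_inv_def by (rule linear_map_inv_into) (simp_all add: twist_linear bij_twist)

lemma closed [simp]:
  "h \<in> carrier H \<Longrightarrow> \<alpha> h \<in> carrier H"
  "h \<in> carrier H \<Longrightarrow> \<beta> h \<in> carrier H"
  "h \<in> carrier H \<Longrightarrow> h' \<in> carrier H \<Longrightarrow> h \<star> h' \<in> carrier H"
  "yd_data M \<Longrightarrow> h \<in> carrier H \<Longrightarrow> m \<in> carrier M \<Longrightarrow> h \<triangleright>\<^bsub>M\<^esub> m \<in> carrier M"
  "yd_data M \<Longrightarrow> m \<in> carrier M \<Longrightarrow> twist M m \<in> carrier M"
  "M \<in> yd_objects K H \<Longrightarrow> m \<in> carrier M \<Longrightarrow> twist_inv M m \<in> carrier M"
  using linear_map_closed[OF twist_linear] linear_map_closed[OF twist_inv_linear] bilinear_prd bilinear_act[of M]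
    linear_map_closed[OF twist_linear_yd] linear_map_closed[OF twist_inv_linear_yd]
  by (auto simp: bilinear_map_def linear_map_def)

lemma tns_closed_simp [simp]:
  "m \<in> carrier M \<Longrightarrow> n \<in> carrier N \<Longrightarrow> tns K M N m n \<in> carrier (tensor K M N)"
  by (rule tns_closed)

lemma tns_closed_yd [simp]:
  fixes M N :: "('k, 'a) hom_yd"
  shows "m \<in> carrier M \<Longrightarrow> n \<in> carrier N \<Longrightarrow> tns K M N m n \<in> carrier (M \<boxtimes> N)"
  using tns_closed[of m M n N K] by simp

lemma twist_twist_inv [simp]:
  "h \<in> carrier H \<Longrightarrow> \<alpha> (\<beta> h) = h"
  "h \<in> carrier H \<Longrightarrow> \<beta> (\<alpha> h) = h"
  "M \<in> yd_objects K H \<Longrightarrow> m \<in> carrier M \<Longrightarrow> twist M (twist_inv M m) = m"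
  "M \<in> yd_objects K H \<Longrightarrow> m \<in> carrier M \<Longrightarrow> twist_inv M (twist M m) = m"
  using bij_twist obj_bij[of M] by (auto simp: twist_inv_def bij_betw_def f_inv_into_f)

lemma twist_inv_eqI:
  "M \<in> yd_objects K H \<Longrightarrow> y \<in> carrier M \<Longrightarrow> twist M y = x \<Longrightarrow> twist_inv M x = y"
  by (auto simp: twist_twist_inv)

lemma yd_twist_act: "yd M \<Longrightarrow> h \<in> carrier H \<Longrightarrow> m \<in> carrier M \<Longrightarrow> twist M (h \<triangleright>\<^bsub>M\<^esub> m) = \<alpha> h \<triangleright>\<^bsub>M\<^esub> twist M m"
  unfolding yetter_drinfeld_def left_hom_module_def left_hom_module_axioms_def by blast

lemma yd_act_act: "yd M \<Longrightarrow> h \<in> carrier H \<Longrightarrow> h' \<in> carrier H \<Longrightarrow> m \<in> carrier M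
  \<Longrightarrow> \<alpha> h \<triangleright>\<^bsub>M\<^esub> (h' \<triangleright>\<^bsub>M\<^esub> m) = (h \<star> h') \<triangleright>\<^bsub>M\<^esub> twist M m"
  unfolding yetter_drinfeld_def left_hom_module_def left_hom_module_axioms_def by blast

text \<open>Normal form: twists act on atoms, products are bracketed to the right, at most one action.\<close>

lemma twist_normal [simp]:
  "h \<in> carrier H \<Longrightarrow> h' \<in> carrier H \<Longrightarrow> \<alpha> (h \<star> h') = \<alpha> h \<star> \<alpha> h'"
  "h \<in> carrier H \<Longrightarrow> h' \<in> carrier H \<Longrightarrow> \<beta> (h \<star> h') = \<beta> h \<star> \<beta> h'"
  "yd M \<Longrightarrow> h \<in> carrier H \<Longrightarrow> m \<in> carrier M \<Longrightarrow> twist M (h \<triangleright>\<^bsub>M\<^esub> m) = \<alpha> h \<triangleright>\<^bsub>M\<^esub> twist M m"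
  "M \<in> yd_objects K H \<Longrightarrow> h \<in> carrier H \<Longrightarrow> m \<in> carrier M
    \<Longrightarrow> twist_inv M (h \<triangleright>\<^bsub>M\<^esub> m) = \<beta> h \<triangleright>\<^bsub>M\<^esub> twist_inv M m"
  "\<lbrakk>h \<in> carrier H; h' \<in> carrier H; h'' \<in> carrier H\<rbrakk> \<Longrightarrow> h \<star> h' \<star> h'' = \<alpha> h \<star> (h' \<star> \<beta> h'')"
  "\<lbrakk>yd M; h \<in> carrier H; h' \<in> carrier H; m \<in> carrier M\<rbrakk>
    \<Longrightarrow> h \<triangleright>\<^bsub>M\<^esub> (h' \<triangleright>\<^bsub>M\<^esub> m) = (\<beta> h \<star> h') \<triangleright>\<^bsub>M\<^esub> twist M m"
proof -
  show "h \<in> carrier H \<Longrightarrow> h' \<in> carrier H \<Longrightarrow> \<beta> (h \<star> h') = \<beta> h \<star> \<beta> h'"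
    using twist_prd[of "\<beta> h" "\<beta> h'"] twist_twist_inv(2)[of "\<beta> h \<star> \<beta> h'"] by simp
  \<comment> \<open>Taking \<open>\<beta> h''\<close> as the last argument frees \<open>h''\<close>
    from its twist, so that Hom-associativity becomes a rewrite rule for every product bracketed to
    the left.\<close>
  show "\<lbrakk>h \<in> carrier H; h' \<in> carrier H; h'' \<in> carrier H\<rbrakk> \<Longrightarrow> h \<star> h' \<star> h'' = \<alpha> h \<star> (h' \<star> \<beta> h'')"
    using hom_associative[of h h' "\<beta> h''"] by simp
  show "\<lbrakk>yd M; h \<in> carrier H; h' \<in> carrier H; m \<in> carrier M\<rbrakk>
    \<Longrightarrow> h \<triangleright>\<^bsub>M\<^esub> (h' \<triangleright>\<^bsub>M\<^esub> m) = (\<beta> h \<star> h') \<triangleright>\<^bsub>M\<^esub> twist M m"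
    using yd_act_act[of M "\<beta> h" h' m] by simp
qed (simp_all add: twist_prd yd_twist_act twist_inv_eqI)

section \<open>Closure and congruence of sums\<close>

lemma comult_sum_closed [simp]:
  assumes "module K U" "h \<in> carrier H" "\<forall>a\<in>carrier H. \<forall>b\<in>carrier H. F a b \<in> carrier U"
  shows "D U h F \<in> carrier U"
  unfolding comult_sum_def by (rule sweedler_closed[OF _ _ _ hcomult_closed]) (use assms in auto)

lemma coact_sum_closed [simp]:
  assumes "yd_data M" "module K U" "m \<in> carrier M" "\<forall>a\<in>carrier H. \<forall>b\<in>carrier M. F a b \<in> carrier U"
  shows "C M U m F \<in> carrier U"
  unfolding coact_sum_def by (rule sweedler_closed[OF _ _ _ coaction_closed]) (use assms in auto)

text \<open>The simplifier receives \<open>a \<in> carrier H\<close> and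
  \<open>b \<in> carrier H\<close> under the binder; without them the conditional rules for twists,
  products and actions could not fire inside a sum.\<close>

lemma comult_sum_cong [cong]:
  assumes "h = h'" "h' \<in> carrier H"
    "\<And>a b. \<lbrakk>a \<in> carrier H; b \<in> carrier H\<rbrakk> \<Longrightarrow> F a b = G a b"
  shows "D U h F = D U h' G"
  unfolding comult_sum_def assms(1) by (rule sweedler_cong[OF _ _ hcomult_closed]) (use assms in auto)

lemma coact_sum_cong [cong]:
  assumes "m = m'" "yd_data M" "m' \<in> carrier M"
    "\<And>a b. \<lbrakk>a \<in> carrier H; b \<in> carrier M\<rbrakk> \<Longrightarrow> F a b = G a b"
  shows "C M U m F = C M U m' G"
  unfolding coact_sum_def assms(1) by (rule sweedler_cong[OF _ _ coaction_closed]) (use assms in auto)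

section \<open>Linearity in one variable at a time\<close>

declare bilinear_map_def [simp] ball_cong [cong]

lemma linear_id [simp]: "lin M M (\<lambda>x. x)"
  by (rule linear_map_id)

text \<open>Each rule peels off one operation and leaves an arbitrary linear map inside, so
  linearity of a nested expression in a chosen variable follows by recursion on the term. With
  \<open>bilinear_map_def\<close> unfolded, the multilinearity conditions of later rules are
  discharged in this way.\<close>

lemma linear_ops [simp]:
  "lin V H f \<Longrightarrow> lin V H (\<lambda>x. \<alpha> (f x))"
  "lin V H f \<Longrightarrow> lin V H (\<lambda>x. \<beta> (f x))"
  "yd_data M \<Longrightarrow> lin V M g \<Longrightarrow> lin V M (\<lambda>x. twist M (g x))"
  "M \<in> yd_objects K H \<Longrightarrow> lin V M g \<Longrightarrow> lin V M (\<lambda>x. twist_inv M (g x))"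
  "lin V H f \<Longrightarrow> h \<in> carrier H \<Longrightarrow> lin V H (\<lambda>x. f x \<star> h)"
  "lin V H f \<Longrightarrow> h \<in> carrier H \<Longrightarrow> lin V H (\<lambda>x. h \<star> f x)"
  "yd_data M \<Longrightarrow> lin V H f \<Longrightarrow> m \<in> carrier M \<Longrightarrow> lin V M (\<lambda>x. f x \<triangleright>\<^bsub>M\<^esub> m)"
  "yd_data M \<Longrightarrow> h \<in> carrier H \<Longrightarrow> lin V M g \<Longrightarrow> lin V M (\<lambda>x. h \<triangleright>\<^bsub>M\<^esub> g x)"
  using linear_map_comp[OF twist_linear, of V f] linear_map_comp[OF twist_inv_linear, of V f]
    linear_map_comp[OF twist_linear_yd[of M], of V g] linear_map_comp[OF twist_inv_linear_yd[of M], of V g]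
    linear_map_comp[of K H H "\<lambda>x. x \<star> h" V f] linear_map_comp[of K H H "\<lambda>x. h \<star> x" V f]
    linear_map_comp[of K H M "\<lambda>x. x \<triangleright>\<^bsub>M\<^esub> m" V f] linear_map_comp[of K M M "\<lambda>x. h \<triangleright>\<^bsub>M\<^esub> x" V g]
    bilinear_prd bilinear_act[of M]
  by simp_all

lemma linear_tns [simp]:
  "\<lbrakk>module K M; module K N; lin V M f; n \<in> carrier N\<rbrakk> \<Longrightarrow> lin V (tensor K M N) (\<lambda>x. tns K M N (f x) n)"
  "\<lbrakk>module K M; module K N; lin V N g; m \<in> carrier M\<rbrakk> \<Longrightarrow> lin V (tensor K M N) (\<lambda>x. tns K M N m (g x))"
  by (rule linear_map_tns_left; simp) (rule linear_map_tns_right; simp)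

lemma linear_tns_yd [simp]:
  fixes M N :: "('k, 'a) hom_yd"
  shows
  "\<lbrakk>module K M; module K N; lin V M f; n \<in> carrier N\<rbrakk> \<Longrightarrow> lin V (M \<boxtimes> N) (\<lambda>x. tns K M N (f x) n)"
  "\<lbrakk>module K M; module K N; lin V N g; m \<in> carrier M\<rbrakk> \<Longrightarrow> lin V (M \<boxtimes> N) (\<lambda>x. tns K M N m (g x))"
  using linear_tns(1)[of M N V f n] linear_tns(2)[of M N V g m] unfolding module_level(3) by blast+

lemma sweedler_yd:
  fixes M N :: "('k, 'a) hom_yd"
  assumes "module K M" "module K N" "module K U"
  shows "bilinear_map K M N U F \<Longrightarrow> lin (M \<boxtimes> N) U (\<lambda>t. sweedler U t F)"
    "bilinear_map K M N U F \<Longrightarrow> lin W (M \<boxtimes> N) f \<Longrightarrow> lin W U (\<lambda>x. sweedler U (f x) F)"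
    "\<lbrakk>t \<in> carrier (M \<boxtimes> N); \<And>x y. \<lbrakk>x \<in> carrier M; y \<in> carrier N\<rbrakk> \<Longrightarrow> lin V U (\<lambda>v. G v x y)\<rbrakk>
      \<Longrightarrow> lin V U (\<lambda>v. sweedler U t (G v))"
    "\<lbrakk>t \<in> carrier (M \<boxtimes> N); \<And>x y. \<lbrakk>x \<in> carrier M; y \<in> carrier N\<rbrakk> \<Longrightarrow> F x y \<in> carrier U\<rbrakk>
      \<Longrightarrow> sweedler U t F \<in> carrier U"
proof -
  show lin: "lin (M \<boxtimes> N) U (\<lambda>t. sweedler U t F)" if "bilinear_map K M N U F"
    using sweedler_linear[OF assms that] by (simp only: module_level)
  show "bilinear_map K M N U F \<Longrightarrow> lin W (M \<boxtimes> N) f \<Longrightarrow> lin W U (\<lambda>x. sweedler U (f x) F)"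
    by (rule linear_map_comp[OF lin])
  show "\<lbrakk>t \<in> carrier (M \<boxtimes> N); \<And>x y. \<lbrakk>x \<in> carrier M; y \<in> carrier N\<rbrakk> \<Longrightarrow> lin V U (\<lambda>v. G v x y)\<rbrakk>
      \<Longrightarrow> lin V U (\<lambda>v. sweedler U t (G v))"
    by (rule sweedler_param_linear[OF assms]) (simp_all only: module_level)
  show "\<lbrakk>t \<in> carrier (M \<boxtimes> N); \<And>x y. \<lbrakk>x \<in> carrier M; y \<in> carrier N\<rbrakk> \<Longrightarrow> F x y \<in> carrier U\<rbrakk>
      \<Longrightarrow> sweedler U t F \<in> carrier U"
    by (rule sweedler_closed[OF assms]) (simp_all only: module_level)
qed

text \<open>A variable can enter a sum in two places. In the argument of the comultiplication it
  needs \<open>F\<close> bilinear, because the chosen list of summands changes with it; as a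
  parameter of the summand it is linear term by term over one fixed list.\<close>

lemma linear_comult_sum [simp]:
  "\<lbrakk>module K U; lin V H f; bilinear_map K H H U F\<rbrakk> \<Longrightarrow> lin V U (\<lambda>x. D U (f x) F)"
  "\<lbrakk>module K U; h \<in> carrier H; \<forall>a\<in>carrier H. \<forall>b\<in>carrier H. lin V U (\<lambda>x. G x a b)\<rbrakk>
    \<Longrightarrow> lin V U (\<lambda>x. D U h (G x))"
  unfolding comult_sum_def
  by (rule linear_map_of_sweedler[OF _ _ _ _ linear_map_comp[OF hcomult_linear]]; simp)
    (rule sweedler_param_linear[OF _ _ _ hcomult_closed]; auto)

lemma linear_coact_sum [simp]:
  "\<lbrakk>yd_data M; module K U; lin V M f; bilinear_map K H M U F\<rbrakk> \<Longrightarrow> lin V U (\<lambda>x. C M U (f x) F)"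
  "\<lbrakk>yd_data M; module K U; m \<in> carrier M; \<forall>a\<in>carrier H. \<forall>b\<in>carrier M. lin V U (\<lambda>x. G x a b)\<rbrakk>
    \<Longrightarrow> lin V U (\<lambda>x. C M U m (G x))"
  unfolding coact_sum_def
  by (rule linear_map_of_sweedler[OF _ _ _ _ linear_map_comp[OF coaction_linear_yd]]; simp)
    (rule sweedler_param_linear[OF _ _ _ coaction_closed]; auto)

section \<open>Linear maps pass through sums\<close>

lemma apply_comult_sum:
  assumes "lin U W g" "module K U" "module K W" "h \<in> carrier H"
    "\<And>a b. \<lbrakk>a \<in> carrier H; b \<in> carrier H\<rbrakk> \<Longrightarrow> F a b \<in> carrier U"
  shows "g (D U h F) = D W h (\<lambda>a b. g (F a b))"
  unfolding comult_sum_def by (rule linear_map_sweedler[OF _ _ _ hcomult_closed]) (use assms in auto)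

lemma apply_coact_sum:
  assumes "lin U W g" "yd_data M" "module K U" "module K W" "m \<in> carrier M"
    "\<And>a b. \<lbrakk>a \<in> carrier H; b \<in> carrier M\<rbrakk> \<Longrightarrow> F a b \<in> carrier U"
  shows "g (C M U m F) = C M W m (\<lambda>a b. g (F a b))"
  unfolding coact_sum_def by (rule linear_map_sweedler[OF _ _ _ coaction_closed]) (use assms in auto)

text \<open>Together with the analogous rules for \<open>tns\<close> and for coaction sums, this
  pulls every sum outward: on pure tensors, a simplified expression is a nest of sums around one
  pure tensor.\<close>

lemma apply_comult_sum_simps [simp]:
  assumes "h \<in> carrier H" "module K U" "\<forall>a\<in>carrier H. \<forall>b\<in>carrier H. F a b \<in> carrier U"
  shows "yd_data U \<Longrightarrow> k \<in> carrier H \<Longrightarrow> k \<triangleright>\<^bsub>U\<^esub> D U h F = D U h (\<lambda>a b. k \<triangleright>\<^bsub>U\<^esub> F a b)"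
    "yd_data U \<Longrightarrow> twist U (D U h F) = D U h (\<lambda>a b. twist U (F a b))"
    "U \<in> yd_objects K H \<Longrightarrow> twist_inv U (D U h F) = D U h (\<lambda>a b. twist_inv U (F a b))"
    "yd_data U \<Longrightarrow> module K W \<Longrightarrow> bilinear_map K H U W G \<Longrightarrow> C U W (D U h F) G = D W h (\<lambda>a b. C U W (F a b) G)"
  by (rule apply_comult_sum[where U = U and F = F]; use assms in simp)+

lemma tns_comult_sum [simp]:
  assumes "h \<in> carrier H" "module K U" "\<forall>a\<in>carrier H. \<forall>b\<in>carrier H. F a b \<in> carrier U"
  shows "module K P \<Longrightarrow> p \<in> carrier P \<Longrightarrow> tns K U P (D U h F) p = D (tensor K U P) h (\<lambda>a b. tns K U P (F a b) p)"
    "module K P \<Longrightarrow> p \<in> carrier P \<Longrightarrow> tns K P U p (D U h F) = D (tensor K P U) h (\<lambda>a b. tns K P U p (F a b))"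
  by (rule apply_comult_sum[where U = U and F = F]; use assms in simp)+

lemma apply_coact_sum_simps [simp]:
  assumes "m \<in> carrier M" "yd_data M" "module K U" "\<forall>a\<in>carrier H. \<forall>b\<in>carrier M. F a b \<in> carrier U"
  shows "yd_data U \<Longrightarrow> k \<in> carrier H \<Longrightarrow> k \<triangleright>\<^bsub>U\<^esub> C M U m F = C M U m (\<lambda>a b. k \<triangleright>\<^bsub>U\<^esub> F a b)"
    "yd_data U \<Longrightarrow> twist U (C M U m F) = C M U m (\<lambda>a b. twist U (F a b))"
    "U \<in> yd_objects K H \<Longrightarrow> twist_inv U (C M U m F) = C M U m (\<lambda>a b. twist_inv U (F a b))"
    "yd_data U \<Longrightarrow> module K W \<Longrightarrow> bilinear_map K H U W G \<Longrightarrow> C U W (C M U m F) G = C M W m (\<lambda>a b. C U W (F a b) G)"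
  by (rule apply_coact_sum[where U = U and F = F]; use assms in simp)+

lemma tns_coact_sum [simp]:
  assumes "m \<in> carrier M" "yd_data M" "module K U" "\<forall>a\<in>carrier H. \<forall>b\<in>carrier M. F a b \<in> carrier U"
  shows "module K P \<Longrightarrow> p \<in> carrier P \<Longrightarrow> tns K U P (C M U m F) p = C M (tensor K U P) m (\<lambda>a b. tns K U P (F a b) p)"
    "module K P \<Longrightarrow> p \<in> carrier P \<Longrightarrow> tns K P U p (C M U m F) = C M (tensor K P U) m (\<lambda>a b. tns K P U p (F a b))"
  by (rule apply_coact_sum[where U = U and F = F]; use assms in simp)+

section \<open>The axioms as identities of sums\<close>

lemma comult_sum_twist [simp]:
  assumes "module K U" "h \<in> carrier H" "bilinear_map K H H U F"
  shows "D U (\<alpha> h) F = D U h (\<lambda>a b. F (\<alpha> a) (\<alpha> b))"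
  unfolding comult_sum_def hcomult_twist[OF assms(2)]
  by (rule sweedler_tensor_map[OF _ _ _ _ _ _ _ hcomult_closed])
    (use assms twist_linear in simp_all)

lemma comult_sum_twist_inv [simp]:
  assumes "module K U" "h \<in> carrier H" "bilinear_map K H H U F"
  shows "D U (\<beta> h) F = D U h (\<lambda>a b. F (\<beta> a) (\<beta> b))"
proof -
  have "D U (\<alpha> (\<beta> h)) (\<lambda>a b. F (\<beta> a) (\<beta> b)) = D U (\<beta> h) (\<lambda>a b. F (\<beta> (\<alpha> a)) (\<beta> (\<alpha> b)))"
    using bilinear_map_comp[OF assms(3) twist_inv_linear twist_inv_linear] assms
    by (intro comult_sum_twist) simp_all
  then show ?thesis using assms by simp
qed

lemma comult_sum_prd [simp]:
  assumes U: "module K U" and "h \<in> carrier H" "h' \<in> carrier H" and F: "bilinear_map K H H U F"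
  shows "D U (h \<star> h') F = D U h (\<lambda>a b. D U h' (\<lambda>c d. F (a \<star> c) (b \<star> d)))"
proof -
  let ?g = "\<lambda>t. sweedler U t F"
  have g: "lin (tensor K H H) U ?g"
    by (rule sweedler_linear) (use U F in simp_all)
  have "D U (h \<star> h') F = ?g (D (tensor K H H) h (\<lambda>a b. D (tensor K H H) h' (\<lambda>c d. tns K H H (a \<star> c) (b \<star> d))))"
    using assms by (simp add: comult_sum_def hcomult_prd)
  also have "\<dots> = D U h (\<lambda>a b. ?g (D (tensor K H H) h' (\<lambda>c d. tns K H H (a \<star> c) (b \<star> d))))"
    by (rule apply_comult_sum[where g = ?g, OF g]) (use assms in simp_all)
  also have "\<dots> = D U h (\<lambda>a b. D U h' (\<lambda>c d. ?g (tns K H H (a \<star> c) (b \<star> d))))"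
    by (intro comult_sum_cong HOL.refl apply_comult_sum[where g = ?g, OF g]) (use assms in simp_all)
  also have "\<dots> = D U h (\<lambda>a b. D U h' (\<lambda>c d. F (a \<star> c) (b \<star> d)))"
    by (intro comult_sum_cong HOL.refl sweedler_tns[OF _ _ U F]) (use assms in simp_all)
  finally show ?thesis .
qed

lemma coact_sum_twist [simp]:
  assumes "yd M" "module K U" "m \<in> carrier M" "bilinear_map K H M U F"
  shows "C M U (twist M m) F = C M U m (\<lambda>x y. F (\<alpha> x) (twist M y))"
proof -
  have *: "coaction M (twist M m) = tensor_map K H M \<alpha> (twist M) (coaction M m)"
    using assms(1,3) unfolding yetter_drinfeld_def left_hom_comodule_def left_hom_comodule_axioms_def by simp
  show ?thesis
    unfolding coact_sum_def *
    by (rule sweedler_tensor_map[OF _ _ _ _ _ _ _ coaction_closed])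
      (use assms twist_linear twist_linear_yd in simp_all)
qed

lemma coact_sum_twist_inv [simp]:
  assumes "M \<in> yd_objects K H" "module K U" "m \<in> carrier M" "bilinear_map K H M U F"
  shows "C M U (twist_inv M m) F = C M U m (\<lambda>x y. F (\<beta> x) (twist_inv M y))"
proof -
  have "C M U (twist M (twist_inv M m)) (\<lambda>x y. F (\<beta> x) (twist_inv M y))
      = C M U (twist_inv M m) (\<lambda>x y. F (\<beta> (\<alpha> x)) (twist_inv M (twist M y)))"
    using bilinear_map_comp[OF assms(4) twist_inv_linear twist_inv_linear_yd[OF assms(1)]] assms
    by (intro coact_sum_twist) simp_all
  then show ?thesis using assms by simp
qed

text \<open>Hom-coassociativity reads \<open>\<Delta>(h\<^sub>1) \<otimes> \<alpha>(h\<^sub>2) =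
  \<alpha>(h\<^sub>1) \<otimes> \<Delta>(h\<^sub>2)\<close>. Testing it against \<open>F\<close>
  with \<open>\<beta>\<close> put on the third argument cancels the twist on the left; the price on
  the right is \<open>\<alpha>\<close> on the first component and \<open>\<beta>\<close> on the
  last.\<close>

lemma comult_sum_coassoc:
  assumes U: "module K U" and h: "h \<in> carrier H"
    and F: "\<And>y z. \<lbrakk>y \<in> carrier H; z \<in> carrier H\<rbrakk> \<Longrightarrow> lin H U (\<lambda>x. F x y z)"
      "\<And>x z. \<lbrakk>x \<in> carrier H; z \<in> carrier H\<rbrakk> \<Longrightarrow> lin H U (\<lambda>y. F x y z)"
      "\<And>x y. \<lbrakk>x \<in> carrier H; y \<in> carrier H\<rbrakk> \<Longrightarrow> lin H U (\<lambda>z. F x y z)"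
  shows "D U h (\<lambda>a b. D U a (\<lambda>c d. F c d b)) = D U h (\<lambda>a b. D U b (\<lambda>c d. F (\<alpha> a) c (\<beta> d)))"
proof -
  have G: "lin H U (\<lambda>z. F x y (\<beta> z))" if "x \<in> carrier H" "y \<in> carrier H" for x y
    by (rule linear_map_comp[OF F(3) twist_inv_linear]) fact+
  have *: "sweedler U (tensor_map K (tensor K H H) H (hcomult H) \<alpha> (hcomult H h)) (\<lambda>x p. sweedler U x (\<lambda>m n. F m n (\<beta> p)))
    = sweedler U (tensor_map K H (tensor K H H) \<alpha> (hcomult H) (hcomult H h)) (\<lambda>m y. sweedler U y (\<lambda>n p. F m n (\<beta> p)))"
    by (rule sweedler_coassoc[OF _ _ _ _ _ hom_coassociative])
      (use U h F G hcomult_linear twist_linear in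
        \<open>auto intro!: linear_map_closed[OF tensor_map_linear[of K H H]] hcomult_closed\<close>)
  have "sweedler U (tensor_map K (tensor K H H) H (hcomult H) \<alpha> (hcomult H h)) (\<lambda>x p. sweedler U x (\<lambda>m n. F m n (\<beta> p)))
    = sweedler U (hcomult H h) (\<lambda>a b. sweedler U (hcomult H a) (\<lambda>m n. F m n (\<beta> (\<alpha> b))))"
    by (rule sweedler_tensor_map[of K H H "tensor K H H" H])
      (use U h F G hcomult_linear twist_linear in \<open>auto intro!: hcomult_closed sweedler_linear
         sweedler_param_linear[where K = K and M = H and N = H]\<close>)
  moreover have "sweedler U (tensor_map K H (tensor K H H) \<alpha> (hcomult H) (hcomult H h)) (\<lambda>m y. sweedler U y (\<lambda>n p. F m n (\<beta> p)))
    = sweedler U (hcomult H h) (\<lambda>a b. sweedler U (hcomult H b) (\<lambda>n p. F (\<alpha> a) n (\<beta> p)))"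
    by (rule sweedler_tensor_map[of K H H H "tensor K H H"])
      (use U h F G hcomult_linear twist_linear in \<open>auto intro!: hcomult_closed sweedler_linear
         sweedler_param_linear[where K = K and M = H and N = H]\<close>)
  moreover have "D U h (\<lambda>a b. D U a (\<lambda>c d. F c d b)) = D U h (\<lambda>a b. D U a (\<lambda>c d. F c d (\<beta> (\<alpha> b))))"
    by (intro comult_sum_cong) (use h in simp_all)
  ultimately show ?thesis using * by (simp only: comult_sum_def)
qed

text \<open>\<open>twist M\<close> stays in the summand, since it cannot be cancelled for a
  Yetter-Drinfeld module whose twist is not assumed bijective, and the tensor product theorem is
  stated in that generality.\<close>

lemma coact_sum_coassoc:
  assumes M: "yd M" and U: "module K U" and m: "m \<in> carrier M"
    and F: "\<And>y z. \<lbrakk>y \<in> carrier H; z \<in> carrier M\<rbrakk> \<Longrightarrow> lin H U (\<lambda>x. F x y z)"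
      "\<And>x z. \<lbrakk>x \<in> carrier H; z \<in> carrier M\<rbrakk> \<Longrightarrow> lin H U (\<lambda>y. F x y z)"
      "\<And>x y. \<lbrakk>x \<in> carrier H; y \<in> carrier H\<rbrakk> \<Longrightarrow> lin M U (\<lambda>z. F x y z)"
  shows "C M U m (\<lambda>x y. D U x (\<lambda>a b. F a b (twist M y))) = C M U m (\<lambda>x y. C M U y (\<lambda>z w. F (\<alpha> x) z w))"
proof -
  have coassoc: "rebracket K H H M (tensor_map K (tensor K H H) M (hcomult H) (twist M) (coaction M m))
        = tensor_map K H (tensor K H M) \<alpha> (coaction M) (coaction M m)"
    using M m unfolding yetter_drinfeld_def left_hom_comodule_def left_hom_comodule_axioms_def by simp
  have "sweedler U (tensor_map K (tensor K H H) M (hcomult H) (twist M) (coaction M m)) (\<lambda>x p. sweedler U x (\<lambda>m n. F m n p))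
    = sweedler U (tensor_map K H (tensor K H M) \<alpha> (coaction M) (coaction M m)) (\<lambda>m y. sweedler U y (F m))"
    by (rule sweedler_coassoc[OF _ _ _ _ _ coassoc])
      (use U m M F hcomult_linear twist_linear twist_linear_yd in
        \<open>auto intro!: linear_map_closed[OF tensor_map_linear[of K H M]] coaction_closed\<close>)
  moreover have "sweedler U (tensor_map K (tensor K H H) M (hcomult H) (twist M) (coaction M m)) (\<lambda>x p. sweedler U x (\<lambda>m n. F m n p))
    = sweedler U (coaction M m) (\<lambda>a b. sweedler U (hcomult H a) (\<lambda>m n. F m n (twist M b)))"
    by (rule sweedler_tensor_map[of K H M "tensor K H H" M])
      (use U m M F hcomult_linear twist_linear twist_linear_yd in \<open>auto intro!: coaction_closed sweedler_linear
         sweedler_param_linear[where K = K and M = H and N = H]\<close>)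
  moreover have "sweedler U (tensor_map K H (tensor K H M) \<alpha> (coaction M) (coaction M m)) (\<lambda>m y. sweedler U y (F m))
    = sweedler U (coaction M m) (\<lambda>a b. sweedler U (coaction M b) (F (\<alpha> a)))"
    by (rule sweedler_tensor_map[of K H M H "tensor K H M"])
      (use U m M F coaction_linear_yd twist_linear twist_linear_yd in \<open>auto intro!: coaction_closed sweedler_linear
         sweedler_param_linear[where K = K and M = H and N = M]\<close>)
  ultimately show ?thesis by (simp only: coact_sum_def comult_sum_def)
qed

text \<open>The twist on the first component belongs to \<open>H\<close> and is invertible, so
  precomposing with \<open>\<beta>\<close> makes the doubly iterated coaction accessible under any
  trilinear \<open>F\<close>.\<close>

lemma coact_sum_coassoc':
  assumes M: "M \<in> yd_objects K H" and U: "module K U" and m: "m \<in> carrier M"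
    and F: "\<And>y z. \<lbrakk>y \<in> carrier H; z \<in> carrier M\<rbrakk> \<Longrightarrow> lin H U (\<lambda>x. F x y z)"
      "\<And>x z. \<lbrakk>x \<in> carrier H; z \<in> carrier M\<rbrakk> \<Longrightarrow> lin H U (\<lambda>y. F x y z)"
      "\<And>x y. \<lbrakk>x \<in> carrier H; y \<in> carrier H\<rbrakk> \<Longrightarrow> lin M U (\<lambda>z. F x y z)"
  shows "C M U m (\<lambda>x y. C M U y (\<lambda>z w. F x z w)) = C M U m (\<lambda>x y. D U x (\<lambda>a b. F (\<beta> a) b (twist M y)))"
proof -
  have "C M U m (\<lambda>x y. D U x (\<lambda>a b. F (\<beta> a) b (twist M y)))
     = C M U m (\<lambda>x y. C M U y (\<lambda>z w. F (\<beta> (\<alpha> x)) z w))"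
    by (rule coact_sum_coassoc[where F = "\<lambda>a. F (\<beta> a)"])
      (use M U m F in \<open>auto intro: linear_map_comp[OF F(1) twist_inv_linear]\<close>)
  also have "\<dots> = C M U m (\<lambda>x y. C M U y (\<lambda>z w. F x z w))"
    by (intro coact_sum_cong HOL.refl) (use M m in simp_all)
  finally show ?thesis by simp
qed

lemma yd_compatible_sum:
  assumes M: "yd M" and U: "module K U" and h: "h \<in> carrier H" and m: "m \<in> carrier M" and F: "bilinear_map K H M U F"
  shows "D U h (\<lambda>a b. C M U (a \<triangleright>\<^bsub>M\<^esub> m) (\<lambda>x y. F (x \<star> \<alpha> (\<alpha> b)) y))
    = D U h (\<lambda>a b. C M U m (\<lambda>x y. F (\<alpha> (\<alpha> a) \<star> \<alpha> x) (\<alpha> b \<triangleright>\<^bsub>M\<^esub> y)))"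
proof -
  let ?g = "\<lambda>t. sweedler U t F" and ?T = "tensor K H M"
  have g: "lin ?T U ?g" by (rule sweedler_linear) (use M U F in simp_all)
  have T: "module K ?T" using M by simp
  have gt: "?g (tns K H M x y) = F x y" if "x \<in> carrier H" "y \<in> carrier M" for x y
    by (rule sweedler_tns) (use M U F that in simp_all)
  have *: "D ?T h (\<lambda>a b. C M ?T (a \<triangleright>\<^bsub>M\<^esub> m) (\<lambda>x y. tns K H M (x \<star> \<alpha> (\<alpha> b)) y))
    = D ?T h (\<lambda>a b. C M ?T m (\<lambda>x y. tns K H M (\<alpha> (\<alpha> a) \<star> \<alpha> x) (\<alpha> b \<triangleright>\<^bsub>M\<^esub> y)))"
    using M h m unfolding comult_sum_def coact_sum_def yetter_drinfeld_def yetter_drinfeld_axioms_def by blast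
  \<comment> \<open>Both sides of the axiom have this shape and differ only in the coacted element
    and the two tensor factors, so the map induced by \<open>F\<close> is moved down to the pure
    tensor once for both.\<close>
  have pull: "?g (D ?T h (\<lambda>a b. C M ?T (f a b) (\<lambda>x y. tns K H M (p a b x y) (q a b x y))))
    = D U h (\<lambda>a b. C M U (f a b) (\<lambda>x y. F (p a b x y) (q a b x y)))"
    if "\<And>a b. \<lbrakk>a \<in> carrier H; b \<in> carrier H\<rbrakk> \<Longrightarrow> f a b \<in> carrier M"
      "\<And>a b x y. \<lbrakk>a \<in> carrier H; b \<in> carrier H; x \<in> carrier H; y \<in> carrier M\<rbrakk>
        \<Longrightarrow> p a b x y \<in> carrier H \<and> q a b x y \<in> carrier M" for f p q
  proof -
    have "?g (D ?T h (\<lambda>a b. C M ?T (f a b) (\<lambda>x y. tns K H M (p a b x y) (q a b x y))))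
      = D U h (\<lambda>a b. ?g (C M ?T (f a b) (\<lambda>x y. tns K H M (p a b x y) (q a b x y))))"
      by (rule apply_comult_sum[OF g]) (use M U h T that in simp_all)
    also have "\<dots> = D U h (\<lambda>a b. C M U (f a b) (\<lambda>x y. ?g (tns K H M (p a b x y) (q a b x y))))"
      by (intro comult_sum_cong HOL.refl apply_coact_sum[OF g]) (use M U h T that in simp_all)
    also have "\<dots> = D U h (\<lambda>a b. C M U (f a b) (\<lambda>x y. F (p a b x y) (q a b x y)))"
      by (intro comult_sum_cong coact_sum_cong HOL.refl gt) (use M h that in simp_all)
    finally show ?thesis .
  qed
  show ?thesis
    using arg_cong[OF *, of ?g] M h m
    by (subst (asm) (1 2) pull) simp_all
qed

section \<open>Exchange of independent sums\<close>

lemma comult_comult_swap: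
  assumes "module K U" "h \<in> carrier H" "k \<in> carrier H"
    "\<And>a b c d. \<lbrakk>a \<in> carrier H; b \<in> carrier H; c \<in> carrier H; d \<in> carrier H\<rbrakk> \<Longrightarrow> F a b c d \<in> carrier U"
  shows "D U h (\<lambda>a b. D U k (\<lambda>c d. F a b c d)) = D U k (\<lambda>c d. D U h (\<lambda>a b. F a b c d))"
  unfolding comult_sum_def by (rule sweedler_swap[where K = K]) (use assms hcomult_closed in auto)

lemma comult_coact_swap:
  assumes "yd_data M" "module K U" "h \<in> carrier H" "m \<in> carrier M"
    "\<And>a b c d. \<lbrakk>a \<in> carrier H; b \<in> carrier H; c \<in> carrier H; d \<in> carrier M\<rbrakk> \<Longrightarrow> F a b c d \<in> carrier U"
  shows "D U h (\<lambda>a b. C M U m (\<lambda>c d. F a b c d)) = C M U m (\<lambda>c d. D U h (\<lambda>a b. F a b c d))"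
  unfolding comult_sum_def coact_sum_def
  by (rule sweedler_swap[where K = K]) (use assms hcomult_closed coaction_closed in auto)

lemma coact_coact_swap:
  assumes "yd_data M" "yd_data N" "module K U" "m \<in> carrier M" "n \<in> carrier N"
    "\<And>a b c d. \<lbrakk>a \<in> carrier H; b \<in> carrier M; c \<in> carrier H; d \<in> carrier N\<rbrakk> \<Longrightarrow> F a b c d \<in> carrier U"
  shows "C M U m (\<lambda>a b. C N U n (\<lambda>c d. F a b c d)) = C N U n (\<lambda>c d. C M U m (\<lambda>a b. F a b c d))"
  unfolding coact_sum_def
  by (rule sweedler_swap[where K = K]) (use assms coaction_closed in auto)


section \<open>The tensor product of Yetter-Drinfeld modules\<close>

context
  fixes M N :: "('k, 'a) hom_yd"
  assumes M [simp]: "yd_data M" and N [simp]: "yd_data N"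
begin

lemma bilinear_tensor_act:
  "bilinear_map K H (M \<boxtimes> N) (M \<boxtimes> N) (\<lambda>h x. sweedler (M \<boxtimes> N) x (\<lambda>m n.
     D (M \<boxtimes> N) h (\<lambda>a b. tns K M N (\<beta> (\<beta> a) \<triangleright>\<^bsub>M\<^esub> m) (\<beta> (\<beta> b) \<triangleright>\<^bsub>N\<^esub> n))))"
  unfolding bilinear_map_def
  by (auto intro!: sweedler_yd[of M N])

lemma tensor_action_sweedler:
  "action (M \<boxtimes> N) t = sweedler (M \<boxtimes> N) t (\<lambda>h x. sweedler (M \<boxtimes> N) x (\<lambda>m n.
     D (M \<boxtimes> N) h (\<lambda>a b. tns K M N (\<beta> (\<beta> a) \<triangleright>\<^bsub>M\<^esub> m) (\<beta> (\<beta> b) \<triangleright>\<^bsub>N\<^esub> n))))"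
  by (subst yd_tensor_def) (simp add: Let_def comult_sum_def)

lemma tensor_action_linear: "lin (tensor K H (M \<boxtimes> N)) (M \<boxtimes> N) (action (M \<boxtimes> N))"
  unfolding tensor_action_sweedler by (rule sweedler_linear) (simp_all only: bilinear_tensor_act, simp_all)

lemma tensor_act:
  assumes "h \<in> carrier H" "m \<in> carrier M" "n \<in> carrier N"
  shows "h \<triangleright>\<^bsub>M \<boxtimes> N\<^esub> tns K M N m n
    = D (M \<boxtimes> N) h (\<lambda>a b. tns K M N (\<beta> (\<beta> a) \<triangleright>\<^bsub>M\<^esub> m) (\<beta> (\<beta> b) \<triangleright>\<^bsub>N\<^esub> n))"
proof -
  have "h \<triangleright>\<^bsub>M \<boxtimes> N\<^esub> tns K M N m n = sweedler (M \<boxtimes> N) (tns K M N m n) (\<lambda>m n.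
     D (M \<boxtimes> N) h (\<lambda>a b. tns K M N (\<beta> (\<beta> a) \<triangleright>\<^bsub>M\<^esub> m) (\<beta> (\<beta> b) \<triangleright>\<^bsub>N\<^esub> n)))"
    unfolding act_def[of K H "M \<boxtimes> N"] tensor_action_sweedler
    by (rule sweedler_tns[OF _ _ _ bilinear_tensor_act]) (use assms in simp_all)
  also have "\<dots> = D (M \<boxtimes> N) h (\<lambda>a b. tns K M N (\<beta> (\<beta> a) \<triangleright>\<^bsub>M\<^esub> m) (\<beta> (\<beta> b) \<triangleright>\<^bsub>N\<^esub> n))"
    by (rule sweedler_tns) (use assms in simp_all)
  finally show ?thesis .
qed

lemma bilinear_tensor_coact:
  "bilinear_map K M N (tensor K H (M \<boxtimes> N)) (\<lambda>m n. C M (tensor K H (M \<boxtimes> N)) m (\<lambda>x y.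
     C N (tensor K H (M \<boxtimes> N)) n (\<lambda>z w. tns K H (M \<boxtimes> N) (x \<star> z) (tns K M N y w))))"
  by simp

lemma tensor_coaction_sweedler:
  "coaction (M \<boxtimes> N) t = sweedler (tensor K H (M \<boxtimes> N)) t (\<lambda>m n. C M (tensor K H (M \<boxtimes> N)) m (\<lambda>x y.
     C N (tensor K H (M \<boxtimes> N)) n (\<lambda>z w. tns K H (M \<boxtimes> N) (x \<star> z) (tns K M N y w))))"
  by (subst yd_tensor_def) (simp add: Let_def coact_sum_def)

lemma tensor_coaction_linear: "lin (M \<boxtimes> N) (tensor K H (M \<boxtimes> N)) (coaction (M \<boxtimes> N))"
  unfolding tensor_coaction_sweedler
  by (rule sweedler_yd(1)[OF _ _ _ bilinear_tensor_coact]) simp_all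

lemma tensor_coaction_tns:
  assumes "m \<in> carrier M" "n \<in> carrier N"
  shows "coaction (M \<boxtimes> N) (tns K M N m n) = C M (tensor K H (M \<boxtimes> N)) m (\<lambda>x y.
     C N (tensor K H (M \<boxtimes> N)) n (\<lambda>z w. tns K H (M \<boxtimes> N) (x \<star> z) (tns K M N y w)))"
  unfolding tensor_coaction_sweedler
  by (rule sweedler_tns[OF _ _ _ bilinear_tensor_coact]) (use assms in simp_all)

lemma tensor_coact_sum:
  assumes mn: "m \<in> carrier M" "n \<in> carrier N" and U: "module K U" and F: "bilinear_map K H (M \<boxtimes> N) U F"
  shows "C (M \<boxtimes> N) U (tns K M N m n) F = C M U m (\<lambda>x y. C N U n (\<lambda>z w. F (x \<star> z) (tns K M N y w)))"
proof -
  let ?T = "tensor K H (M \<boxtimes> N)" and ?g = "\<lambda>t. sweedler U t F"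
  have g: "lin ?T U ?g" by (rule sweedler_linear[OF _ _ U F]) simp_all
  have "C (M \<boxtimes> N) U (tns K M N m n) F
    = ?g (C M ?T m (\<lambda>x y. C N ?T n (\<lambda>z w. tns K H (M \<boxtimes> N) (x \<star> z) (tns K M N y w))))"
    by (simp only: coact_sum_def[of "M \<boxtimes> N"] tensor_coaction_tns[OF mn])
  also have "\<dots> = C M U m (\<lambda>x y. ?g (C N ?T n (\<lambda>z w. tns K H (M \<boxtimes> N) (x \<star> z) (tns K M N y w))))"
    by (rule apply_coact_sum[OF g]) (use mn U in simp_all)
  also have "\<dots> = C M U m (\<lambda>x y. C N U n (\<lambda>z w. ?g (tns K H (M \<boxtimes> N) (x \<star> z) (tns K M N y w))))"
    by (intro coact_sum_cong HOL.refl apply_coact_sum[OF g]) (use mn U in simp_all)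
  also have "\<dots> = C M U m (\<lambda>x y. C N U n (\<lambda>z w. F (x \<star> z) (tns K M N y w)))"
    by (intro coact_sum_cong HOL.refl sweedler_tns[OF _ _ U F]) (use mn in simp_all)
  finally show ?thesis .
qed

lemma tensor_twist_linear: "lin (M \<boxtimes> N) (M \<boxtimes> N) (twist (M \<boxtimes> N))"
proof -
  have "twist (M \<boxtimes> N) = tensor_map K M N (twist M) (twist N)"
    by (subst yd_tensor_def) (simp add: Let_def)
  moreover have "lin (M \<boxtimes> N) (M \<boxtimes> N) (tensor_map K M N (twist M) (twist N))"
    using tensor_map_linear[OF _ _ _ _ twist_linear_yd[OF M] twist_linear_yd[OF N]] by (simp only: module_level yd_data_module M N)
  ultimately show ?thesis by metis
qed

lemma tensor_twist:
  "m \<in> carrier M \<Longrightarrow> n \<in> carrier N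
    \<Longrightarrow> twist (M \<boxtimes> N) (tns K M N m n) = tns K M N (twist M m) (twist N n)"
  using tensor_map_tns[OF _ _ _ _ twist_linear_yd[OF M] twist_linear_yd[OF N], of m n]
  by (subst yd_tensor_def) (simp add: Let_def)

lemma yd_data_tensor: "yd_data (M \<boxtimes> N)"
  unfolding yd_data_def
  by (intro conjI bilinear_act_of_action tensor_action_linear tensor_twist_linear tensor_coaction_linear) simp_all

lemma linear_tensor_eqI:
  assumes "module K U" "lin (M \<boxtimes> N) U f" "lin (M \<boxtimes> N) U g"
    and "\<And>m n. \<lbrakk>m \<in> carrier M; n \<in> carrier N\<rbrakk> \<Longrightarrow> f (tns K M N m n) = g (tns K M N m n)"
    and "t \<in> carrier (M \<boxtimes> N)"
  shows "f t = g t"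
  by (rule linear_map_tensor_eqI[of K M N U]) (use assms in simp_all)

end

declare yd_data_tensor [simp] tensor_act [simp] tensor_coact_sum [simp] tensor_twist [simp]

section \<open>Yetter-Drinfeld axioms for the tensor product\<close>

lemma tensor_left_module:
  assumes [simp]: "yd M" "yd N"
  shows "left_hom_module K H (M \<boxtimes> N)"
proof (intro left_hom_module.intro left_hom_module_axioms.intro hom_space.intro hom_space_axioms.intro)
  let ?T = "M \<boxtimes> N"
  show "hom_bialgebra K H" "field K" by unfold_locales
  show "module K ?T" by simp
  show "lin ?T ?T (twist ?T)" by (simp add: tensor_twist_linear)
  show "lin (tensor K H ?T) ?T (action ?T)" by (simp add: tensor_action_linear)
  fix h x assume h: "h \<in> carrier H" and x: "x \<in> carrier ?T"
  show "twist ?T (h \<triangleright>\<^bsub>?T\<^esub> x) = \<alpha> h \<triangleright>\<^bsub>?T\<^esub> twist ?T x"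
    by (rule linear_tensor_eqI[where U = ?T, OF _ _ _ _ _ _ x]) (use h in simp_all)
  fix h' assume h': "h' \<in> carrier H"
  show "\<alpha> h \<triangleright>\<^bsub>?T\<^esub> (h' \<triangleright>\<^bsub>?T\<^esub> x) = (h \<star> h') \<triangleright>\<^bsub>?T\<^esub> twist ?T x"
    \<comment> \<open>\<open>\<Delta>\<close> is multiplicative and each factor is Hom-associative,
      so the sides differ only in the order of sums: the iterated action has the sum over
      \<open>h'\<close> outermost, the product has the sum over \<open>h\<close>.\<close>
    by (rule linear_tensor_eqI[where U = ?T, OF _ _ _ _ _ _ x]) (use h h' in \<open>simp_all add: comult_comult_swap[of _ h' h]\<close>)
qed

text \<open>Adding up the pure tensors of \<open>t\<close> gives back \<open>t\<close>, as this map
  and the identity are linear and agree on pure tensors. Equations in \<open>H \<otimes> M\<close>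
  such as the comodule axioms thereby become equations between sums.\<close>

lemma coaction_eq_coact_sum:
  assumes "yd_data M" "m \<in> carrier M"
  shows "coaction M m = C M (tensor K H M) m (tns K H M)"
proof -
  let ?g = "\<lambda>t. sweedler (tensor K H M) t (tns K H M)"
  have "?g t = t" if "t \<in> carrier (tensor K H M)" for t
  proof (rule linear_map_tensor_eqI[of K H M "tensor K H M" ?g "\<lambda>t. t"])
    show "lin (tensor K H M) (tensor K H M) ?g"
      by (rule sweedler_linear) (use assms tns_bilinear[of K H M] in simp_all)
    show "?g (tns K H M x y) = tns K H M x y" if "x \<in> carrier H" "y \<in> carrier M" for x y
      by (rule sweedler_tns) (use assms tns_bilinear[of K H M] that in simp_all)
  qed (use assms that in simp_all)
  then show ?thesis using coaction_closed[OF assms] by (simp add: coact_sum_def)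
qed

text \<open>This and the next lemma write the two sides of coassociativity as sums of pure tensors.
  They ask only for \<open>yd_data\<close>, so they apply to \<open>M \<boxtimes> N\<close> while
  its comodule axioms are still to be proved.\<close>

lemma comult_coaction_eq:
  assumes [simp]: "yd_data M" and m: "m \<in> carrier M"
  shows "rebracket K H H M (tensor_map K (tensor K H H) M (hcomult H) (twist M) (coaction M m))
    = C M (tensor K H (tensor K H M)) m (\<lambda>x y. D (tensor K H (tensor K H M)) x (\<lambda>a b.
        tns K H (tensor K H M) a (tns K H M b (twist M y))))" (is "?l = C M ?U m ?F")
proof -
  have t: "tensor_map K (tensor K H H) M (hcomult H) (twist M) (coaction M m) \<in> carrier (tensor K (tensor K H H) M)"
    using m by (intro linear_map_closed[OF tensor_map_linear[of K H M]] coaction_closed)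
      (simp_all add: hcomult_linear twist_linear_yd)
  have bil: "bilinear_map K (tensor K H H) M ?U (\<lambda>x p. sweedler ?U x (\<lambda>m n. tns K H (tensor K H M) m (tns K H M n p)))"
    by (rule rebracket_bilinear) simp_all
  have "?l = sweedler ?U (coaction M m) (\<lambda>x y. sweedler ?U (hcomult H x) (\<lambda>m n. tns K H (tensor K H M) m (tns K H M n (twist M y))))"
    unfolding rebracket_def
    by (rule sweedler_tensor_map[of K H M, OF _ _ _ _ _ _ _ _ bil])
      (use m in \<open>simp_all add: hcomult_linear twist_linear_yd coaction_closed\<close>)
  then show ?thesis by (simp only: comult_sum_def coact_sum_def)
qed

lemma coaction_coaction_eq:
  assumes [simp]: "yd_data M" and m: "m \<in> carrier M"
  shows "tensor_map K H (tensor K H M) \<alpha> (coaction M) (coaction M m)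
    = C M (tensor K H (tensor K H M)) m (\<lambda>x y. C M (tensor K H (tensor K H M)) y (\<lambda>z w.
        tns K H (tensor K H M) (\<alpha> x) (tns K H M z w)))"
proof -
  have "tensor_map K H (tensor K H M) \<alpha> (coaction M) (coaction M m)
    = C M (tensor K H (tensor K H M)) m (\<lambda>x y. tns K H (tensor K H M) (\<alpha> x) (coaction M y))"
    by (simp only: tensor_map_def coact_sum_def)
  also have "\<dots> = C M (tensor K H (tensor K H M)) m (\<lambda>x y. tns K H (tensor K H M) (\<alpha> x) (C M (tensor K H M) y (tns K H M)))"
    by (intro coact_sum_cong HOL.refl) (use m in \<open>simp_all add: coaction_eq_coact_sum\<close>)
  finally show ?thesis using m by simp
qed

lemma tensor_left_comodule:
  assumes [simp]: "yd M" "yd N"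
  shows "left_hom_comodule K H (M \<boxtimes> N)"
proof (intro left_hom_comodule.intro left_hom_comodule_axioms.intro hom_space.intro hom_space_axioms.intro)
  let ?T = "M \<boxtimes> N"
  let ?V = "tensor K H ?T"
  let ?U = "tensor K H ?V"
  show "hom_bialgebra K H" "field K" by unfold_locales
  show "module K ?T" by simp
  show "lin ?T ?T (twist ?T)" by (simp add: tensor_twist_linear)
  show "lin ?T ?V (coaction ?T)" by (simp add: tensor_coaction_linear)
  fix t assume t: "t \<in> carrier ?T"
  have "tensor_map K H ?T \<alpha> (twist ?T) (coaction ?T t) = C ?T ?V t (\<lambda>x y. tns K H ?T (\<alpha> x) (twist ?T y))"
    by (simp only: tensor_map_def coact_sum_def)
  also have "\<dots> = C ?T ?V (twist ?T t) (tns K H ?T)"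
    by (rule linear_tensor_eqI[where U = ?V, OF _ _ _ _ _ _ t]) simp_all
  also have "\<dots> = coaction ?T (twist ?T t)"
    using t by (simp add: coaction_eq_coact_sum)
  finally show "tensor_map K H ?T \<alpha> (twist ?T) (coaction ?T t) = coaction ?T (twist ?T t)" .
  show "rebracket K H H ?T (tensor_map K (tensor K H H) ?T (hcomult H) (twist ?T) (coaction ?T t))
    = tensor_map K H ?V \<alpha> (coaction ?T) (coaction ?T t)"
    unfolding comult_coaction_eq[OF yd_data_tensor[OF yd_yd_data yd_yd_data, OF assms] t] coaction_coaction_eq[OF yd_data_tensor[OF yd_yd_data yd_yd_data, OF assms] t]
  proof (rule linear_tensor_eqI[where U = ?U, OF _ _ _ _ _ _ t])
    fix m n assume [simp]: "m \<in> carrier M" "n \<in> carrier N"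
    \<comment> \<open>\<open>a b y\<close> stem from the iterated coaction of \<open>M\<close>,
      \<open>c d w\<close> from that of \<open>N\<close>. The two meet only in the products, so
      coassociativity can be applied to \<open>N\<close> and then to \<open>M\<close> once the sums
      are grouped by module.\<close>
    let ?t = "\<lambda>a b y c d w. tns K H ?V (a \<star> c) (tns K H ?T (b \<star> d) (tns K M N y w))"
    have "C ?T ?U (tns K M N m n) (\<lambda>x y. D ?U x (\<lambda>a b. tns K H ?V a (tns K H ?T b (twist ?T y))))
      = C M ?U m (\<lambda>x y. C N ?U n (\<lambda>z w. D ?U x (\<lambda>a b. D ?U z (\<lambda>c d. ?t a b (twist M y) c d (twist N w)))))"
      by simp
    also have "\<dots> = C M ?U m (\<lambda>x y. D ?U x (\<lambda>a b. C N ?U n (\<lambda>z w. D ?U z (\<lambda>c d. ?t a b (twist M y) c d (twist N w)))))"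
      by (intro coact_sum_cong HOL.refl comult_coact_swap[symmetric]) simp_all
    also have "\<dots> = C M ?U m (\<lambda>x y. D ?U x (\<lambda>a b. C N ?U n (\<lambda>z w. C N ?U w (\<lambda>r s. ?t a b (twist M y) (\<alpha> z) r s))))"
      by (intro coact_sum_cong comult_sum_cong HOL.refl coact_sum_coassoc) simp_all
    also have "\<dots> = C M ?U m (\<lambda>x y. C M ?U y (\<lambda>p q. C N ?U n (\<lambda>z w. C N ?U w (\<lambda>r s. ?t (\<alpha> x) p q (\<alpha> z) r s))))"
      by (intro coact_sum_coassoc) simp_all
    also have "\<dots> = C M ?U m (\<lambda>x y. C N ?U n (\<lambda>z w. C M ?U y (\<lambda>p q. C N ?U w (\<lambda>r s. ?t (\<alpha> x) p q (\<alpha> z) r s))))"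
      by (intro coact_sum_cong HOL.refl coact_coact_swap) simp_all
    also have "\<dots> = C ?T ?U (tns K M N m n) (\<lambda>x y. C ?T ?U y (\<lambda>z w. tns K H ?V (\<alpha> x) (tns K H ?T z w)))"
      by simp
    finally show "C ?T ?U (tns K M N m n) (\<lambda>x y. D ?U x (\<lambda>a b. tns K H ?V a (tns K H ?T b (twist ?T y))))
      = C ?T ?U (tns K M N m n) (\<lambda>x y. C ?T ?U y (\<lambda>z w. tns K H ?V (\<alpha> x) (tns K H ?T z w)))" .
  qed simp_all
qed

text \<open>Substituting \<open>\<beta> (\<beta> h)\<close> for \<open>h\<close> removes the square
  of \<open>\<alpha>\<close> from the axiom and puts \<open>\<beta> (\<beta> a)\<close> in front of
  \<open>m\<close>, exactly as in the diagonal action. Compatibility is used in this form from here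
  on, which explains the power -2 in the tensor product.\<close>

lemma yd_compatible_sum':
  assumes [simp]: "yd M" "module K U" "h \<in> carrier H" "m \<in> carrier M" and F: "bilinear_map K H M U F"
  shows "D U h (\<lambda>a b. C M U (\<beta> (\<beta> a) \<triangleright>\<^bsub>M\<^esub> m) (\<lambda>x y. F (x \<star> b) y))
    = D U h (\<lambda>a b. C M U m (\<lambda>x y. F (a \<star> \<alpha> x) (\<beta> b \<triangleright>\<^bsub>M\<^esub> y)))"
proof -
  let ?h = "\<beta> (\<beta> h)"
  have F1: "lin V U (\<lambda>x. F (f x) y)" if "lin V H f" "y \<in> carrier M" for V and f :: "'v \<Rightarrow> _" and y
    using F that by (auto intro: linear_map_comp[of K H U "\<lambda>x. F x y"])
  have F2: "lin V U (\<lambda>x. F y (f x))" if "lin V M f" "y \<in> carrier H" for V and f :: "'v \<Rightarrow> _" and y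
    using F that by (auto intro: linear_map_comp[of K M U "F y"])
  have "D U h (\<lambda>a b. C M U (\<beta> (\<beta> a) \<triangleright>\<^bsub>M\<^esub> m) (\<lambda>x y. F (x \<star> b) y))
    = D U (\<alpha> (\<alpha> ?h)) (\<lambda>a b. C M U (\<beta> (\<beta> a) \<triangleright>\<^bsub>M\<^esub> m) (\<lambda>x y. F (x \<star> b) y))"
    by simp
  also have "\<dots> = D U ?h (\<lambda>a b. C M U (a \<triangleright>\<^bsub>M\<^esub> m) (\<lambda>x y. F (x \<star> \<alpha> (\<alpha> b)) y))"
    \<comment> \<open>The cancellation rules are off in the first pass, as they would turn
      \<open>\<alpha> (\<alpha> ?h)\<close> back into \<open>h\<close> before the twists are
      distributed over the components; the second pass cancels them there.\<close>
    by (simp add: F1 F2 del: twist_twist_inv) (simp add: F1 F2)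
  also have "\<dots> = D U ?h (\<lambda>a b. C M U m (\<lambda>x y. F (\<alpha> (\<alpha> a) \<star> \<alpha> x) (\<alpha> b \<triangleright>\<^bsub>M\<^esub> y)))"
    by (rule yd_compatible_sum) (use F in simp_all)
  also have "\<dots> = D U h (\<lambda>a b. C M U m (\<lambda>x y. F (a \<star> \<alpha> x) (\<beta> b \<triangleright>\<^bsub>M\<^esub> y)))"
    by (simp add: F1 F2)
  finally show ?thesis .
qed

theorem yetter_drinfeld_tensor:
  assumes [simp]: "yd M" "yd N"
  shows "yd (M \<boxtimes> N)"
proof (rule yetter_drinfeld.intro[OF tensor_left_module[OF assms] tensor_left_comodule[OF assms]],
    rule yetter_drinfeld_axioms.intro)
  let ?T = "M \<boxtimes> N"
  let ?U = "tensor K H ?T"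
  fix h t assume h [simp]: "h \<in> carrier H" and t: "t \<in> carrier ?T"
  have "D ?U h (\<lambda>a b. C ?T ?U (a \<triangleright>\<^bsub>?T\<^esub> t) (\<lambda>x y. tns K H ?T (x \<star> \<alpha> (\<alpha> b)) y))
    = D ?U h (\<lambda>a b. C ?T ?U t (\<lambda>x y. tns K H ?T (\<alpha> (\<alpha> a) \<star> \<alpha> x) (\<alpha> b \<triangleright>\<^bsub>?T\<^esub> y)))"
  proof (rule linear_tensor_eqI[where U = ?U, OF _ _ _ _ _ _ t])
    fix m n assume [simp]: "m \<in> carrier M" "n \<in> carrier N"
    let ?t = "\<lambda>u y w. tns K H ?T u (tns K M N y w)"
    have "D ?U h (\<lambda>a b. C ?T ?U (a \<triangleright>\<^bsub>?T\<^esub> tns K M N m n) (\<lambda>x y. tns K H ?T (x \<star> \<alpha> (\<alpha> b)) y))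
      = D ?U h (\<lambda>a b. D ?U a (\<lambda>c d. C M ?U (\<beta> (\<beta> c) \<triangleright>\<^bsub>M\<^esub> m) (\<lambda>x y.
          C N ?U (\<beta> (\<beta> d) \<triangleright>\<^bsub>N\<^esub> n) (\<lambda>z w. ?t (\<alpha> x \<star> (z \<star> \<alpha> b)) y w))))"
      by simp
    \<comment> \<open>Compatibility for \<open>N\<close> needs \<open>d\<close> and
      \<open>b\<close>, which act on \<open>n\<close> and multiply its coaction, to be the halves of
      one comultiplication; coassociativity arranges this.\<close>
    also have "\<dots> = D ?U h (\<lambda>a b. D ?U b (\<lambda>c d. C M ?U (\<beta> (\<beta> (\<alpha> a)) \<triangleright>\<^bsub>M\<^esub> m) (\<lambda>x y.
          C N ?U (\<beta> (\<beta> c) \<triangleright>\<^bsub>N\<^esub> n) (\<lambda>z w. ?t (\<alpha> x \<star> (z \<star> \<alpha> (\<beta> d))) y w))))"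
      by (rule comult_sum_coassoc) simp_all
    also have "\<dots> = D ?U h (\<lambda>a b. C M ?U (\<beta> a \<triangleright>\<^bsub>M\<^esub> m) (\<lambda>x y.
          D ?U b (\<lambda>c d. C N ?U (\<beta> (\<beta> c) \<triangleright>\<^bsub>N\<^esub> n) (\<lambda>z w. ?t (\<alpha> x \<star> (z \<star> d)) y w))))"
      by (simp add: comult_coact_swap)
    also have "\<dots> = D ?U h (\<lambda>a b. C M ?U (\<beta> a \<triangleright>\<^bsub>M\<^esub> m) (\<lambda>x y.
          D ?U b (\<lambda>c d. C N ?U n (\<lambda>z w. ?t (\<alpha> x \<star> (c \<star> \<alpha> z)) y (\<beta> d \<triangleright>\<^bsub>N\<^esub> w)))))"
      by (intro comult_sum_cong coact_sum_cong HOL.refl yd_compatible_sum') simp_all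
    also have "\<dots> = D ?U h (\<lambda>a b. D ?U b (\<lambda>c d. C M ?U (\<beta> (\<beta> (\<alpha> a)) \<triangleright>\<^bsub>M\<^esub> m) (\<lambda>x y.
          C N ?U n (\<lambda>z w. ?t (\<alpha> x \<star> (c \<star> \<alpha> z)) y (\<beta> d \<triangleright>\<^bsub>N\<^esub> w)))))"
      by (simp add: comult_coact_swap)
    \<comment> \<open>Now \<open>a\<close> and \<open>c\<close> have to be rejoined: compatibility
      for \<open>M\<close> pairs the element acting on \<open>m\<close> with the one that multiplies
      its coaction.\<close>
    also have "\<dots> = D ?U h (\<lambda>a b. D ?U a (\<lambda>c d. C M ?U (\<beta> (\<beta> c) \<triangleright>\<^bsub>M\<^esub> m) (\<lambda>x y.
          C N ?U n (\<lambda>z w. ?t (\<alpha> x \<star> (d \<star> \<alpha> z)) y (b \<triangleright>\<^bsub>N\<^esub> w)))))"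
      by (rule comult_sum_coassoc[symmetric]) simp_all
    \<comment> \<open>Hom-associativity is run backwards to expose the factor
      \<open>x \<star> d\<close>.\<close>
    also have "\<dots> = D ?U h (\<lambda>a b. D ?U a (\<lambda>c d. C M ?U (\<beta> (\<beta> c) \<triangleright>\<^bsub>M\<^esub> m) (\<lambda>x y.
          C N ?U n (\<lambda>z w. ?t ((x \<star> d) \<star> \<alpha> (\<alpha> z)) y (b \<triangleright>\<^bsub>N\<^esub> w)))))"
      by simp
    also have "\<dots> = D ?U h (\<lambda>a b. D ?U a (\<lambda>c d. C M ?U m (\<lambda>x y.
          C N ?U n (\<lambda>z w. ?t ((c \<star> \<alpha> x) \<star> \<alpha> (\<alpha> z)) (\<beta> d \<triangleright>\<^bsub>M\<^esub> y) (b \<triangleright>\<^bsub>N\<^esub> w)))))"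
      by (intro comult_sum_cong HOL.refl yd_compatible_sum') simp_all
    \<comment> \<open>The last regrouping makes the elements acting on \<open>m\<close> and
      \<open>n\<close> the halves of \<open>h\<^sub>2\<close>, as the diagonal action on the
      right-hand side requires.\<close>
    also have "\<dots> = D ?U h (\<lambda>a b. D ?U b (\<lambda>c d. C M ?U m (\<lambda>x y.
          C N ?U n (\<lambda>z w. ?t ((\<alpha> a \<star> \<alpha> x) \<star> \<alpha> (\<alpha> z)) (\<beta> c \<triangleright>\<^bsub>M\<^esub> y) (\<beta> d \<triangleright>\<^bsub>N\<^esub> w)))))"
      by (rule comult_sum_coassoc) simp_all
    also have "\<dots> = D ?U h (\<lambda>a b. C ?T ?U (tns K M N m n) (\<lambda>x y.
          tns K H ?T (\<alpha> (\<alpha> a) \<star> \<alpha> x) (\<alpha> b \<triangleright>\<^bsub>?T\<^esub> y)))"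
      by (simp add: comult_coact_swap)
    finally show "D ?U h (\<lambda>a b. C ?T ?U (a \<triangleright>\<^bsub>?T\<^esub> tns K M N m n) (\<lambda>x y. tns K H ?T (x \<star> \<alpha> (\<alpha> b)) y))
      = D ?U h (\<lambda>a b. C ?T ?U (tns K M N m n) (\<lambda>x y. tns K H ?T (\<alpha> (\<alpha> a) \<star> \<alpha> x) (\<alpha> b \<triangleright>\<^bsub>?T\<^esub> y)))" .
  qed simp_all
  then show "sweedler ?U (hcomult H h) (\<lambda>a b. sweedler ?U (coaction ?T (a \<triangleright>\<^bsub>?T\<^esub> t)) (\<lambda>x y.
      tns K H ?T (x \<star> \<alpha> (\<alpha> b)) y))
    = sweedler ?U (hcomult H h) (\<lambda>a b. sweedler ?U (coaction ?T t) (\<lambda>x y.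
      tns K H ?T (\<alpha> (\<alpha> a) \<star> \<alpha> x) (\<alpha> b \<triangleright>\<^bsub>?T\<^esub> y)))"
    by (simp only: comult_sum_def coact_sum_def)
qed

declare yetter_drinfeld_tensor [simp]

section \<open>Objects and iterated tensor products\<close>

lemma tensor_obj [simp]:
  assumes [simp]: "M \<in> yd_objects K H" "N \<in> yd_objects K H"
  shows "M \<boxtimes> N \<in> yd_objects K H"
proof -
  let ?T = "M \<boxtimes> N" and ?g = "tensor_map K M N (twist_inv M) (twist_inv N)"
  have g: "lin ?T ?T ?g"
    using tensor_map_linear[of K M N M N, OF _ _ _ _ twist_inv_linear_yd twist_inv_linear_yd] by simp
  have g_tns: "?g (tns K M N m n) = tns K M N (twist_inv M m) (twist_inv N n)"
    if "m \<in> carrier M" "n \<in> carrier N" for m n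
    by (rule tensor_map_tns) (use that in simp_all)
  have t: "lin ?T ?T (twist ?T)" by (simp add: tensor_twist_linear)
  have "?g (twist ?T x) = x" "twist ?T (?g x) = x" if "x \<in> carrier ?T" for x
    by (rule linear_tensor_eqI[where U = ?T, OF _ _ _ _ _ _ that];
        simp add: g_tns linear_map_comp[OF g t] linear_map_comp[OF t g])+
  then have "bij_betw (twist ?T) (carrier ?T) (carrier ?T)"
    using linear_map_closed[OF g] linear_map_closed[OF t]
    by (intro bij_betwI[where g = ?g]) auto
  moreover have "yd ?T" by simp
  ultimately show ?thesis by (simp add: yd_objects_def del: obj_yd)
qed

lemma tensor_twist_inv [simp]:
  "\<lbrakk>M \<in> yd_objects K H; N \<in> yd_objects K H; m \<in> carrier M; n \<in> carrier N\<rbrakk>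
    \<Longrightarrow> twist_inv (M \<boxtimes> N) (tns K M N m n) = tns K M N (twist_inv M m) (twist_inv N n)"
  by (rule twist_inv_eqI) simp_all

lemma linear_tensor_left_eqI:
  assumes [simp]: "yd_data L" "yd_data M" "yd_data N" "module K U"
    and f: "lin ((L \<boxtimes> M) \<boxtimes> N) U f" and g: "lin ((L \<boxtimes> M) \<boxtimes> N) U g"
    and fg: "\<And>l m n. \<lbrakk>l \<in> carrier L; m \<in> carrier M; n \<in> carrier N\<rbrakk>
      \<Longrightarrow> f (tns K (L \<boxtimes> M) N (tns K L M l m) n) = g (tns K (L \<boxtimes> M) N (tns K L M l m) n)"
    and t: "t \<in> carrier ((L \<boxtimes> M) \<boxtimes> N)"
  shows "f t = g t"
proof (rule linear_tensor_eqI[where U = U, OF _ _ _ f g _ t])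
  fix x n assume "x \<in> carrier (L \<boxtimes> M)" "n \<in> carrier N"
  then show "f (tns K (L \<boxtimes> M) N x n) = g (tns K (L \<boxtimes> M) N x n)"
    by (intro linear_tensor_eqI[where U = U and t = x and M = L and N = M
          and f = "\<lambda>x. f (tns K (L \<boxtimes> M) N x n)" and g = "\<lambda>x. g (tns K (L \<boxtimes> M) N x n)"])
      (simp_all add: fg linear_map_comp[OF f] linear_map_comp[OF g])
qed simp_all

lemma linear_tensor_right_eqI:
  assumes [simp]: "yd_data L" "yd_data M" "yd_data N" "module K U"
    and f: "lin (L \<boxtimes> (M \<boxtimes> N)) U f" and g: "lin (L \<boxtimes> (M \<boxtimes> N)) U g"
    and fg: "\<And>l m n. \<lbrakk>l \<in> carrier L; m \<in> carrier M; n \<in> carrier N\<rbrakk>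
      \<Longrightarrow> f (tns K L (M \<boxtimes> N) l (tns K M N m n)) = g (tns K L (M \<boxtimes> N) l (tns K M N m n))"
    and t: "t \<in> carrier (L \<boxtimes> (M \<boxtimes> N))"
  shows "f t = g t"
proof (rule linear_tensor_eqI[where U = U, OF _ _ _ f g _ t])
  fix l x assume "l \<in> carrier L" "x \<in> carrier (M \<boxtimes> N)"
  then show "f (tns K L (M \<boxtimes> N) l x) = g (tns K L (M \<boxtimes> N) l x)"
    by (intro linear_tensor_eqI[where U = U and t = x and M = M and N = N
          and f = "\<lambda>x. f (tns K L (M \<boxtimes> N) l x)" and g = "\<lambda>x. g (tns K L (M \<boxtimes> N) l x)"])
      (simp_all add: fg linear_map_comp[OF f] linear_map_comp[OF g])
qed simp_all

section \<open>Morphisms of Yetter-Drinfeld modules\<close>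

text \<open>A bundle of simplification rules for one linear map. It is instantiated for the
  associator, the braiding, morphisms and their tensor products, so that inside sums they behave
  like the basic operations.\<close>

lemma linear_map_rules:
  assumes f: "lin S T f"
  shows "lin V S e \<Longrightarrow> lin V T (\<lambda>x. f (e x))"
    and "t \<in> carrier S \<Longrightarrow> f t \<in> carrier T"
    and "\<lbrakk>module K S; module K T; h \<in> carrier H; \<forall>a\<in>carrier H. \<forall>b\<in>carrier H. F a b \<in> carrier S\<rbrakk>
      \<Longrightarrow> f (D S h F) = D T h (\<lambda>a b. f (F a b))"
    and "\<lbrakk>module K S; module K T; yd_data Q; q \<in> carrier Q; \<forall>a\<in>carrier H. \<forall>b\<in>carrier Q. G a b \<in> carrier S\<rbrakk>
      \<Longrightarrow> f (C Q S q G) = C Q T q (\<lambda>a b. f (G a b))"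
  by (rule linear_map_comp[OF f] linear_map_closed[OF f] apply_comult_sum[OF f] apply_coact_sum[OF f]; simp)+

definition yd_hom :: "('k, 'a) hom_yd \<Rightarrow> ('k, 'a) hom_yd \<Rightarrow> ('a univ \<Rightarrow> 'a univ) \<Rightarrow> bool"
  where "yd_hom M N f \<longleftrightarrow> hom_module_morphism K H M N f \<and> hom_comodule_morphism K H M N f"

lemma yd_hom_iff:
  assumes "yd_data M" "yd_data N"
  shows "yd_hom M N f \<longleftrightarrow> lin M N f \<and>
    (\<forall>m\<in>carrier M. twist N (f m) = f (twist M m)) \<and>
    (\<forall>h\<in>carrier H. \<forall>m\<in>carrier M. f (h \<triangleright>\<^bsub>M\<^esub> m) = h \<triangleright>\<^bsub>N\<^esub> f m) \<and>
    (\<forall>m\<in>carrier M. C M (tensor K H N) m (\<lambda>x y. tns K H N x (f y))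
      = C N (tensor K H N) (f m) (tns K H N))"
proof -
  have "tensor_map K H N (\<lambda>h. h) f (coaction M m) = C M (tensor K H N) m (\<lambda>x y. tns K H N x (f y))" for m
    by (simp only: tensor_map_def coact_sum_def)
  then show ?thesis
    using assms coaction_eq_coact_sum[OF assms(2)] linear_map_closed[of K M N f]
    by (auto simp: yd_hom_def hom_module_morphism_def hom_comodule_morphism_def)
qed

context
  fixes M N f
  assumes M [simp]: "yd_data M" and N [simp]: "yd_data N" and f: "yd_hom M N f"
begin

lemma yd_hom_linear: "lin M N f"
  using f by (simp add: yd_hom_iff)

lemma yd_hom_lin: "lin V M e \<Longrightarrow> lin V N (\<lambda>x. f (e x))"
  by (rule linear_map_comp[OF yd_hom_linear])

lemma yd_hom_closed: "m \<in> carrier M \<Longrightarrow> f m \<in> carrier N"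
  by (rule linear_map_closed[OF yd_hom_linear])

lemma yd_hom_twist: "m \<in> carrier M \<Longrightarrow> f (twist M m) = twist N (f m)"
  and yd_hom_act: "h \<in> carrier H \<Longrightarrow> m \<in> carrier M \<Longrightarrow> f (h \<triangleright>\<^bsub>M\<^esub> m) = h \<triangleright>\<^bsub>N\<^esub> f m"
  using f by (simp_all add: yd_hom_iff)

text \<open>The comodule condition is an identity in \<open>H \<otimes> N\<close>; applying the
  linear map induced by \<open>F\<close> frees it from the particular summand
  \<open>tns K H N\<close>.\<close>

lemma yd_hom_coact_sum:
  assumes U: "module K U" and m: "m \<in> carrier M" and F: "bilinear_map K H N U F"
  shows "C N U (f m) F = C M U m (\<lambda>x y. F x (f y))"
proof -
  let ?g = "\<lambda>t. sweedler U t F" and ?V = "tensor K H N"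
  have g: "lin ?V U ?g" by (rule sweedler_linear) (use U F in simp_all)
  have gt: "?g (tns K H N x y) = F x y" if "x \<in> carrier H" "y \<in> carrier N" for x y
    by (rule sweedler_tns) (use U F that in simp_all)
  have "C N U (f m) F = ?g (C N ?V (f m) (tns K H N))"
    using m by (simp only: coact_sum_def[of N U] flip: coaction_eq_coact_sum[OF N yd_hom_closed])
  also have "\<dots> = ?g (C M ?V m (\<lambda>x y. tns K H N x (f y)))"
    using f m by (simp add: yd_hom_iff)
  also have "\<dots> = C M U m (\<lambda>x y. ?g (tns K H N x (f y)))"
    by (rule apply_coact_sum[OF g]) (use m U yd_hom_closed in simp_all)
  also have "\<dots> = C M U m (\<lambda>x y. F x (f y))"
    by (intro coact_sum_cong HOL.refl gt) (use m yd_hom_closed in simp_all)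
  finally show ?thesis .
qed

end

lemma yd_hom_twist_inv:
  assumes [simp]: "M \<in> yd_objects K H" "N \<in> yd_objects K H" "m \<in> carrier M" and f: "yd_hom M N f"
  shows "f (twist_inv M m) = twist_inv N (f m)"
  by (rule twist_inv_eqI[symmetric])
    (simp_all add: yd_hom_closed[OF _ _ f] yd_hom_twist[OF _ _ f, symmetric])

text \<open>Arrows of the category carry functions that are \<open>undefined\<close> off the
  carrier, while the calculus works with unrestricted ones; being a morphism must not depend on
  which is taken.\<close>

lemma yd_hom_cong:
  assumes [simp]: "yd M" "yd N" and fg: "\<And>m. m \<in> carrier M \<Longrightarrow> f m = g m" and f: "yd_hom M N f"
  shows "yd_hom M N g"
proof -
  have "C M (tensor K H N) m (\<lambda>x y. tns K H N x (f y)) = C M (tensor K H N) m (\<lambda>x y. tns K H N x (g y))"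
    if "m \<in> carrier M" for m
    by (intro coact_sum_cong HOL.refl) (use that fg in simp_all)
  moreover have [simp]: "g m \<in> carrier N" if "m \<in> carrier M" for m
    using yd_hom_closed[OF _ _ f that] that by (simp add: fg)
  ultimately show ?thesis
    using f linear_map_cong[of K M f g N] by (simp add: yd_hom_iff fg)
qed

lemma yd_hom_id: "yd M \<Longrightarrow> yd_hom M M (\<lambda>x. x)"
  by (simp add: yd_hom_iff)

lemma yd_hom_comp:
  assumes [simp]: "yd M" "yd N" "yd P" and f: "yd_hom M N f" and g: "yd_hom N P g"
  shows "yd_hom M P (\<lambda>x. g (f x))"
proof -
  note [simp] = yd_hom_lin[OF _ _ f] yd_hom_lin[OF _ _ g] yd_hom_closed[OF _ _ f] yd_hom_closed[OF _ _ g]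
    yd_hom_twist[OF _ _ f] yd_hom_twist[OF _ _ g] yd_hom_act[OF _ _ f] yd_hom_act[OF _ _ g]
    yd_hom_coact_sum[OF _ _ f] yd_hom_coact_sum[OF _ _ g]
  show ?thesis by (simp add: yd_hom_iff)
qed

text \<open>Each law for \<open>g\<close> is the corresponding law for \<open>f\<close>, transported
  by applying \<open>g\<close>. For the inverse associator this leaves only linearity and the two
  cancellation identities to check.\<close>

lemma yd_hom_inverse:
  assumes [simp]: "yd M" "yd N" and f: "yd_hom M N f" and g: "lin N M g"
    and gf: "\<And>x. x \<in> carrier M \<Longrightarrow> g (f x) = x" and fg: "\<And>y. y \<in> carrier N \<Longrightarrow> f (g y) = y"
  shows "yd_hom N M g"
proof -
  note [simp] = linear_map_closed[OF g] linear_map_comp[OF g]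
  have "g (twist N y) = twist M (g y)" if "y \<in> carrier N" for y
    using gf[of "twist M (g y)"] that by (simp add: yd_hom_twist[OF _ _ f] fg)
  moreover have "g (h \<triangleright>\<^bsub>N\<^esub> y) = h \<triangleright>\<^bsub>M\<^esub> g y" if "h \<in> carrier H" "y \<in> carrier N" for h y
    using gf[of "h \<triangleright>\<^bsub>M\<^esub> g y"] that by (simp add: yd_hom_act[OF _ _ f] fg)
  moreover have "C N (tensor K H M) y (\<lambda>x y. tns K H M x (g y)) = C M (tensor K H M) (g y) (tns K H M)"
    if "y \<in> carrier N" for y
  proof -
    have "C N (tensor K H M) (f (g y)) (\<lambda>x y. tns K H M x (g y))
      = C M (tensor K H M) (g y) (\<lambda>x y. tns K H M x (g (f y)))"
      by (rule yd_hom_coact_sum[OF _ _ f]) (use that in simp_all)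
    also have "\<dots> = C M (tensor K H M) (g y) (tns K H M)"
      by (intro coact_sum_cong HOL.refl) (use that gf in simp_all)
    finally show ?thesis using that by (simp add: fg)
  qed
  ultimately show ?thesis using g by (simp add: yd_hom_iff)
qed

lemma yd_hom_tensorI:
  assumes [simp]: "yd M" "yd N" "yd P" and f: "lin (M \<boxtimes> N) P f"
    and "\<And>m n. \<lbrakk>m \<in> carrier M; n \<in> carrier N\<rbrakk>
      \<Longrightarrow> f (tns K M N (twist M m) (twist N n)) = twist P (f (tns K M N m n))"
    and "\<And>h m n. \<lbrakk>h \<in> carrier H; m \<in> carrier M; n \<in> carrier N\<rbrakk>
      \<Longrightarrow> f (h \<triangleright>\<^bsub>M \<boxtimes> N\<^esub> tns K M N m n) = h \<triangleright>\<^bsub>P\<^esub> f (tns K M N m n)"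
    and "\<And>m n. \<lbrakk>m \<in> carrier M; n \<in> carrier N\<rbrakk>
      \<Longrightarrow> C (M \<boxtimes> N) (tensor K H P) (tns K M N m n) (\<lambda>x y. tns K H P x (f y))
        = C P (tensor K H P) (f (tns K M N m n)) (tns K H P)"
  shows "yd_hom (M \<boxtimes> N) P f"
proof -
  note [simp] = linear_map_closed[OF f] linear_map_comp[OF f]
  have "f (twist (M \<boxtimes> N) t) = twist P (f t)" if "t \<in> carrier (M \<boxtimes> N)" for t
    by (rule linear_tensor_eqI[where U = P, OF _ _ _ _ _ _ that]) (simp_all add: assms)
  moreover have "f (h \<triangleright>\<^bsub>M \<boxtimes> N\<^esub> t) = h \<triangleright>\<^bsub>P\<^esub> f t" if "h \<in> carrier H" "t \<in> carrier (M \<boxtimes> N)" for h t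
    \<comment> \<open>\<open>tensor_act\<close> is switched off so that the goal on pure tensors
      keeps the form of the assumption, which speaks of the unexpanded action.\<close>
    by (rule linear_tensor_eqI[where U = P, OF _ _ _ _ _ _ that(2)]) (simp_all add: assms that(1) del: tensor_act)
  moreover have "C (M \<boxtimes> N) (tensor K H P) t (\<lambda>x y. tns K H P x (f y))
        = C P (tensor K H P) (f t) (tns K H P)" if "t \<in> carrier (M \<boxtimes> N)" for t
    by (rule linear_tensor_eqI[where U = "tensor K H P", OF _ _ _ _ _ _ that])
      (simp_all add: assms del: tensor_coact_sum)
  ultimately show ?thesis using f by (simp add: yd_hom_iff)
qed

lemma yd_hom_tensor_leftI:
  assumes [simp]: "yd L" "yd M" "yd N" "yd P" and f: "lin ((L \<boxtimes> M) \<boxtimes> N) P f"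
    and "\<And>l m n. \<lbrakk>l \<in> carrier L; m \<in> carrier M; n \<in> carrier N\<rbrakk>
      \<Longrightarrow> f (tns K (L \<boxtimes> M) N (tns K L M (twist L l) (twist M m)) (twist N n))
        = twist P (f (tns K (L \<boxtimes> M) N (tns K L M l m) n))"
    and "\<And>h l m n. \<lbrakk>h \<in> carrier H; l \<in> carrier L; m \<in> carrier M; n \<in> carrier N\<rbrakk>
      \<Longrightarrow> f (h \<triangleright>\<^bsub>(L \<boxtimes> M) \<boxtimes> N\<^esub> tns K (L \<boxtimes> M) N (tns K L M l m) n)
        = h \<triangleright>\<^bsub>P\<^esub> f (tns K (L \<boxtimes> M) N (tns K L M l m) n)"
    and "\<And>l m n. \<lbrakk>l \<in> carrier L; m \<in> carrier M; n \<in> carrier N\<rbrakk>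
      \<Longrightarrow> C ((L \<boxtimes> M) \<boxtimes> N) (tensor K H P) (tns K (L \<boxtimes> M) N (tns K L M l m) n) (\<lambda>x y. tns K H P x (f y))
        = C P (tensor K H P) (f (tns K (L \<boxtimes> M) N (tns K L M l m) n)) (tns K H P)"
  shows "yd_hom ((L \<boxtimes> M) \<boxtimes> N) P f"
proof -
  note [simp] = linear_map_closed[OF f] linear_map_comp[OF f]
  let ?S = "(L \<boxtimes> M) \<boxtimes> N"
  have "f (twist ?S t) = twist P (f t)" if "t \<in> carrier ?S" for t
    by (rule linear_tensor_left_eqI[where U = P, OF _ _ _ _ _ _ _ that]) (simp_all add: assms)
  moreover have "f (h \<triangleright>\<^bsub>?S\<^esub> t) = h \<triangleright>\<^bsub>P\<^esub> f t" if "h \<in> carrier H" "t \<in> carrier ?S" for h t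
    by (rule linear_tensor_left_eqI[where U = P, OF _ _ _ _ _ _ _ that(2)]) (simp_all add: assms that(1) del: tensor_act)
  moreover have "C ?S (tensor K H P) t (\<lambda>x y. tns K H P x (f y))
        = C P (tensor K H P) (f t) (tns K H P)" if "t \<in> carrier ?S" for t
    by (rule linear_tensor_left_eqI[where U = "tensor K H P", OF _ _ _ _ _ _ _ that])
      (simp_all add: assms del: tensor_coact_sum)
  ultimately show ?thesis using f by (simp add: yd_hom_iff)
qed

lemma tensor_map_tns_simp [simp]:
  "\<lbrakk>module K V; module K W; module K M; module K N; lin V M f; lin W N g; v \<in> carrier V; w \<in> carrier W\<rbrakk>
    \<Longrightarrow> tensor_map K M N f g (tns K V W v w) = tns K M N (f v) (g w)"
  by (rule tensor_map_tns)

lemma yd_hom_tensor_map: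
  assumes [simp]: "yd M" "yd M'" "yd N" "yd N'" and f: "yd_hom M M' f" and g: "yd_hom N N' g"
  shows "yd_hom (M \<boxtimes> N) (M' \<boxtimes> N') (tensor_map K M' N' f g)"
proof -
  note [simp] = yd_hom_linear[OF _ _ f] yd_hom_linear[OF _ _ g] yd_hom_lin[OF _ _ f] yd_hom_lin[OF _ _ g]
    yd_hom_closed[OF _ _ f] yd_hom_closed[OF _ _ g]
    yd_hom_twist[OF _ _ f] yd_hom_twist[OF _ _ g] yd_hom_act[OF _ _ f] yd_hom_act[OF _ _ g]
    yd_hom_coact_sum[OF _ _ f] yd_hom_coact_sum[OF _ _ g]
  have l: "lin (M \<boxtimes> N) (M' \<boxtimes> N') (tensor_map K M' N' f g)"
    using tensor_map_linear[of K M N M' N' f g] by simp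
  note [simp] = apply_comult_sum[OF l] linear_map_comp[OF l] linear_map_closed[OF l]
  show ?thesis by (rule yd_hom_tensorI) (simp_all add: l)
qed


section \<open>Associator and braiding as linear maps\<close>

definition assoc_map where
  "assoc_map M N P t = sweedler (M \<boxtimes> (N \<boxtimes> P)) t (\<lambda>x p. sweedler (M \<boxtimes> (N \<boxtimes> P)) x (\<lambda>m n.
     tns K M (N \<boxtimes> P) (twist M m) (tns K N P n (twist_inv P p))))"

definition assoc_inv where
  "assoc_inv M N P t = sweedler ((M \<boxtimes> N) \<boxtimes> P) t (\<lambda>m x. sweedler ((M \<boxtimes> N) \<boxtimes> P) x (\<lambda>n p.
     tns K (M \<boxtimes> N) P (tns K M N (twist_inv M m) n) (twist P p)))"

definition braid_map where
  "braid_map M N t = sweedler (N \<boxtimes> M) t (\<lambda>m n. C M (N \<boxtimes> M) m (\<lambda>x y.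
     tns K N M (twist_inv N (\<beta> x \<triangleright>\<^bsub>N\<^esub> n)) (twist_inv M y)))"

context
  fixes M N P
  assumes M [simp]: "M \<in> yd_objects K H" and N [simp]: "N \<in> yd_objects K H" and P [simp]: "P \<in> yd_objects K H"
begin

lemma assoc_map_bilinear:
  "bilinear_map K (M \<boxtimes> N) P (M \<boxtimes> (N \<boxtimes> P)) (\<lambda>x p. sweedler (M \<boxtimes> (N \<boxtimes> P)) x (\<lambda>m n.
     tns K M (N \<boxtimes> P) (twist M m) (tns K N P n (twist_inv P p))))"
  unfolding bilinear_map_def by (auto intro!: sweedler_yd[of M N])

lemma assoc_inv_bilinear:
  "bilinear_map K M (N \<boxtimes> P) ((M \<boxtimes> N) \<boxtimes> P) (\<lambda>m x. sweedler ((M \<boxtimes> N) \<boxtimes> P) x (\<lambda>n p.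
     tns K (M \<boxtimes> N) P (tns K M N (twist_inv M m) n) (twist P p)))"
  unfolding bilinear_map_def by (auto intro!: sweedler_yd[of N P])

lemma assoc_map_linear: "lin ((M \<boxtimes> N) \<boxtimes> P) (M \<boxtimes> (N \<boxtimes> P)) (assoc_map M N P)"
  unfolding assoc_map_def[abs_def] by (rule sweedler_yd(1)[OF _ _ _ assoc_map_bilinear]) simp_all

lemma assoc_inv_linear: "lin (M \<boxtimes> (N \<boxtimes> P)) ((M \<boxtimes> N) \<boxtimes> P) (assoc_inv M N P)"
  unfolding assoc_inv_def[abs_def] by (rule sweedler_yd(1)[OF _ _ _ assoc_inv_bilinear]) simp_all

lemma assoc_map_tns:
  assumes "m \<in> carrier M" "n \<in> carrier N" "p \<in> carrier P"
  shows "assoc_map M N P (tns K (M \<boxtimes> N) P (tns K M N m n) p)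
    = tns K M (N \<boxtimes> P) (twist M m) (tns K N P n (twist_inv P p))"
  unfolding assoc_map_def
  by (subst sweedler_tns[OF _ _ _ assoc_map_bilinear], use assms in simp_all)
    (rule sweedler_tns, use assms in simp_all)

lemma assoc_inv_tns:
  assumes "m \<in> carrier M" "n \<in> carrier N" "p \<in> carrier P"
  shows "assoc_inv M N P (tns K M (N \<boxtimes> P) m (tns K N P n p))
    = tns K (M \<boxtimes> N) P (tns K M N (twist_inv M m) n) (twist P p)"
  unfolding assoc_inv_def
  by (subst sweedler_tns[OF _ _ _ assoc_inv_bilinear], use assms in simp_all)
    (rule sweedler_tns, use assms in simp_all)

end

context
  fixes M N
  assumes M [simp]: "M \<in> yd_objects K H" and N [simp]: "N \<in> yd_objects K H"
begin

lemma braid_map_bilinear: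
  "bilinear_map K M N (N \<boxtimes> M) (\<lambda>m n. C M (N \<boxtimes> M) m (\<lambda>x y.
     tns K N M (twist_inv N (\<beta> x \<triangleright>\<^bsub>N\<^esub> n)) (twist_inv M y)))"
  by simp

lemma braid_map_linear: "lin (M \<boxtimes> N) (N \<boxtimes> M) (braid_map M N)"
  unfolding braid_map_def[abs_def] by (rule sweedler_yd(1)[OF _ _ _ braid_map_bilinear]) simp_all

text \<open>In normal form the inverse twist of \<open>N\<close> is distributed over the action,
  which yields the same power \<open>\<beta> (\<beta> x)\<close> as in the diagonal action.\<close>

lemma braid_map_tns:
  assumes "m \<in> carrier M" "n \<in> carrier N"
  shows "braid_map M N (tns K M N m n)
    = C M (N \<boxtimes> M) m (\<lambda>x y. tns K N M (\<beta> (\<beta> x) \<triangleright>\<^bsub>N\<^esub> twist_inv N n) (twist_inv M y))"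
  unfolding braid_map_def
  by (subst sweedler_tns[OF _ _ _ braid_map_bilinear]) (use assms in simp_all)

end

declare assoc_map_tns [simp] assoc_inv_tns [simp] braid_map_tns [simp]

lemmas assoc_map_simps [simp] = linear_map_rules[OF assoc_map_linear]
lemmas assoc_inv_simps [simp] = linear_map_rules[OF assoc_inv_linear]
lemmas braid_map_simps [simp] = linear_map_rules[OF braid_map_linear]

text \<open>For the action, coassociativity of \<open>H\<close> shifts the first component by
  \<open>\<alpha>\<close> and the third by \<open>\<beta>\<close>, and the weights on
  \<open>m\<close> and \<open>p\<close> absorb precisely this. For the coaction the same shift comes
  from Hom-associativity of the product, which the normal form performs by itself.\<close>

lemma yd_hom_assoc_map:
  assumes [simp]: "M \<in> yd_objects K H" "N \<in> yd_objects K H" "P \<in> yd_objects K H"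
  shows "yd_hom ((M \<boxtimes> N) \<boxtimes> P) (M \<boxtimes> (N \<boxtimes> P)) (assoc_map M N P)"
proof (rule yd_hom_tensor_leftI)
  let ?S = "(M \<boxtimes> N) \<boxtimes> P" and ?T = "M \<boxtimes> (N \<boxtimes> P)"
  fix h m n p assume [simp]: "h \<in> carrier H" "m \<in> carrier M" "n \<in> carrier N" "p \<in> carrier P"
  let ?t = "tns K (M \<boxtimes> N) P (tns K M N m n) p"
  have "assoc_map M N P (h \<triangleright>\<^bsub>?S\<^esub> ?t) = D ?T h (\<lambda>a b. D ?T a (\<lambda>c d.
      tns K M (N \<boxtimes> P) (\<beta> (\<beta> (\<beta> c)) \<triangleright>\<^bsub>M\<^esub> twist M m)
        (tns K N P (\<beta> (\<beta> (\<beta> (\<beta> d))) \<triangleright>\<^bsub>N\<^esub> n) (\<beta> (\<beta> (\<beta> b)) \<triangleright>\<^bsub>P\<^esub> twist_inv P p))))"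
    by simp
  also have "\<dots> = D ?T h (\<lambda>a b. D ?T b (\<lambda>c d.
      tns K M (N \<boxtimes> P) (\<beta> (\<beta> (\<beta> (\<alpha> a))) \<triangleright>\<^bsub>M\<^esub> twist M m)
        (tns K N P (\<beta> (\<beta> (\<beta> (\<beta> c))) \<triangleright>\<^bsub>N\<^esub> n) (\<beta> (\<beta> (\<beta> (\<beta> d))) \<triangleright>\<^bsub>P\<^esub> twist_inv P p))))"
    by (rule comult_sum_coassoc) simp_all
  also have "\<dots> = h \<triangleright>\<^bsub>?T\<^esub> assoc_map M N P ?t" by simp
  finally show "assoc_map M N P (h \<triangleright>\<^bsub>?S\<^esub> ?t) = h \<triangleright>\<^bsub>?T\<^esub> assoc_map M N P ?t" .
qed (simp_all add: assoc_map_linear)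

lemma assoc_inv_assoc_map:
  assumes [simp]: "M \<in> yd_objects K H" "N \<in> yd_objects K H" "P \<in> yd_objects K H"
  shows "t \<in> carrier ((M \<boxtimes> N) \<boxtimes> P) \<Longrightarrow> assoc_inv M N P (assoc_map M N P t) = t"
    "s \<in> carrier (M \<boxtimes> (N \<boxtimes> P)) \<Longrightarrow> assoc_map M N P (assoc_inv M N P s) = s"
  by (rule linear_tensor_left_eqI[where L = M and M = N and N = P and U = "(M \<boxtimes> N) \<boxtimes> P"]; simp)
    (rule linear_tensor_right_eqI[where L = M and M = N and N = P and U = "M \<boxtimes> (N \<boxtimes> P)"]; simp)

lemma yd_hom_assoc_inv:
  assumes [simp]: "M \<in> yd_objects K H" "N \<in> yd_objects K H" "P \<in> yd_objects K H"
  shows "yd_hom (M \<boxtimes> (N \<boxtimes> P)) ((M \<boxtimes> N) \<boxtimes> P) (assoc_inv M N P)"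
  by (rule yd_hom_inverse[OF _ _ yd_hom_assoc_map])
    (simp_all add: assoc_inv_linear assoc_inv_assoc_map)

lemma yd_hom_braid_map:
  assumes [simp]: "M \<in> yd_objects K H" "N \<in> yd_objects K H"
  shows "yd_hom (M \<boxtimes> N) (N \<boxtimes> M) (braid_map M N)"
proof (rule yd_hom_tensorI)
  let ?S = "M \<boxtimes> N" and ?T = "N \<boxtimes> M"
  fix m n assume [simp]: "m \<in> carrier M" "n \<in> carrier N"
  show "braid_map M N (h \<triangleright>\<^bsub>?S\<^esub> tns K M N m n) = h \<triangleright>\<^bsub>?T\<^esub> braid_map M N (tns K M N m n)"
    if [simp]: "h \<in> carrier H" for h
  proof -
    \<comment> \<open>The two successive actions on \<open>n\<close> merge by Hom-associativity into
      the action of a twist of \<open>x \<star> b\<close>, the product that compatibility for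
      \<open>M\<close> rewrites.\<close>
    have "braid_map M N (h \<triangleright>\<^bsub>?S\<^esub> tns K M N m n) = D ?T h (\<lambda>a b. C M ?T (\<beta> (\<beta> a) \<triangleright>\<^bsub>M\<^esub> m) (\<lambda>x y.
        tns K N M (\<beta> (\<beta> (\<beta> (x \<star> b))) \<triangleright>\<^bsub>N\<^esub> n) (twist_inv M y)))"
      by simp
    also have "\<dots> = D ?T h (\<lambda>a b. C M ?T m (\<lambda>x y.
        tns K N M (\<beta> (\<beta> (\<beta> (a \<star> \<alpha> x))) \<triangleright>\<^bsub>N\<^esub> n) (twist_inv M (\<beta> b \<triangleright>\<^bsub>M\<^esub> y))))"
      by (rule yd_compatible_sum') simp_all
    also have "\<dots> = h \<triangleright>\<^bsub>?T\<^esub> braid_map M N (tns K M N m n)"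
      by (simp add: comult_coact_swap)
    finally show ?thesis .
  qed
  let ?V = "tensor K H ?T"
  let ?t = "\<lambda>u q y. tns K H ?T u (tns K N M q y)"
  have "C ?S ?V (tns K M N m n) (\<lambda>x y. tns K H ?T x (braid_map M N y))
    = C M ?V m (\<lambda>x y. C M ?V y (\<lambda>p q. C N ?V n (\<lambda>z w.
        ?t (x \<star> z) (\<beta> (\<beta> p) \<triangleright>\<^bsub>N\<^esub> twist_inv N w) (twist_inv M q))))"
    by (simp add: coact_coact_swap[of N])
  \<comment> \<open>The braiding coacts on \<open>M\<close> a second time. Coassociativity trades
    this for a comultiplication of \<open>x\<close>, whose halves can then take part in
    compatibility for \<open>N\<close>.\<close>
  also have "\<dots> = C M ?V m (\<lambda>x y. D ?V x (\<lambda>a b. C N ?V n (\<lambda>z w.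
        ?t (\<beta> a \<star> z) (\<beta> (\<beta> b) \<triangleright>\<^bsub>N\<^esub> twist_inv N w) (twist_inv M (twist M y)))))"
    by (rule coact_sum_coassoc') simp_all
  \<comment> \<open>The twists are redistributed to fit \<open>yd_compatible_sum'\<close>, with
    \<open>\<beta> x\<close> in the role of \<open>h\<close> and \<open>twist_inv N n\<close> as the
    module element.\<close>
  also have "\<dots> = C M ?V m (\<lambda>x y. D ?V (\<beta> x) (\<lambda>a b. C N ?V (twist_inv N n) (\<lambda>p q.
        ?t (a \<star> \<alpha> p) (\<beta> b \<triangleright>\<^bsub>N\<^esub> q) y)))"
    by simp
  also have "\<dots> = C M ?V m (\<lambda>x y. D ?V (\<beta> x) (\<lambda>a b. C N ?V (\<beta> (\<beta> a) \<triangleright>\<^bsub>N\<^esub> twist_inv N n) (\<lambda>p q.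
        ?t (p \<star> b) q y)))"
    by (intro coact_sum_cong HOL.refl yd_compatible_sum'[symmetric]) simp_all
  also have "\<dots> = C M ?V m (\<lambda>x y. D ?V x (\<lambda>a b. C N ?V (\<beta> (\<beta> (\<beta> a)) \<triangleright>\<^bsub>N\<^esub> twist_inv N n) (\<lambda>p q.
        ?t (p \<star> \<beta> b) q (twist_inv M (twist M y)))))"
    by simp
  also have "\<dots> = C M ?V m (\<lambda>x y. C M ?V y (\<lambda>r s. C N ?V (\<beta> (\<beta> x) \<triangleright>\<^bsub>N\<^esub> twist_inv N n) (\<lambda>p q.
        ?t (p \<star> \<beta> r) q (twist_inv M s))))"
    by (rule coact_sum_coassoc'[symmetric]) simp_all
  also have "\<dots> = C ?T ?V (braid_map M N (tns K M N m n)) (tns K H ?T)"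
    by (simp add: coact_coact_swap[of M N])
  finally show "C ?S ?V (tns K M N m n) (\<lambda>x y. tns K H ?T x (braid_map M N y))
    = C ?T ?V (braid_map M N (tns K M N m n)) (tns K H ?T)" .
qed (simp_all add: braid_map_linear)


section \<open>The category of Yetter-Drinfeld modules is quasi-braided\<close>

text \<open>Restriction identifies functions that agree on \<open>carrier M\<close>, so an equation
  between arrows reduces to one between values on the carrier.\<close>

definition yd_arrow :: "('k, 'a) hom_yd \<Rightarrow> ('a univ \<Rightarrow> 'a univ) \<Rightarrow> ('k, 'a) hom_yd \<Rightarrow> ('k, 'a) yd_arr"
  where "yd_arrow M f N = (M, restrict f (carrier M), N)"

lemma yd_hom_restrict: "yd M \<Longrightarrow> yd N \<Longrightarrow> yd_hom M N (restrict f (carrier M)) \<longleftrightarrow> yd_hom M N f"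
  using yd_hom_cong[of M N "restrict f (carrier M)" f] yd_hom_cong[of M N f "restrict f (carrier M)"] by auto

lemma homs_YD:
  "F \<in> homs (YD K H) M N \<longleftrightarrow>
    M \<in> yd_objects K H \<and> N \<in> yd_objects K H \<and> (\<exists>f. F = yd_arrow M f N \<and> yd_hom M N f)"
proof
  assume "F \<in> homs (YD K H) M N"
  then obtain f where f: "F = (M, f, N)" "M \<in> yd_objects K H" "N \<in> yd_objects K H"
    "f \<in> extensional (carrier M)" "yd_hom M N f"
    by (auto simp: homs_def YD_def yd_hom_def)
  then show "M \<in> yd_objects K H \<and> N \<in> yd_objects K H \<and> (\<exists>f. F = yd_arrow M f N \<and> yd_hom M N f)"
    by (auto simp: yd_arrow_def extensional_restrict intro!: exI[of _ f])
next
  assume "M \<in> yd_objects K H \<and> N \<in> yd_objects K H \<and> (\<exists>f. F = yd_arrow M f N \<and> yd_hom M N f)"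
  then show "F \<in> homs (YD K H) M N"
    using yd_hom_restrict[of M N] by (auto simp: homs_def YD_def yd_arrow_def yd_hom_def)
qed

lemma homs_YD_E:
  assumes "F \<in> homs (YD K H) M N"
  obtains f where "F = yd_arrow M f N" "yd_hom M N f" "M \<in> yd_objects K H" "N \<in> yd_objects K H"
  using assms by (auto simp: homs_YD)

lemma yd_arrow_homs:
  "\<lbrakk>M \<in> yd_objects K H; N \<in> yd_objects K H; yd_hom M N f\<rbrakk> \<Longrightarrow> yd_arrow M f N \<in> homs (YD K H) M N"
  by (auto simp: homs_YD)

lemma yd_arrow_eqI: "(\<And>x. x \<in> carrier M \<Longrightarrow> f x = g x) \<Longrightarrow> yd_arrow M f N = yd_arrow M g N"
  by (auto simp: yd_arrow_def restrict_def)

lemma yd_arrow_cmp: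
  "\<lbrakk>yd_data M; yd_data N; yd_hom M N f\<rbrakk>
    \<Longrightarrow> yd_arrow N g P \<cdot>\<^bsub>YD K H\<^esub> yd_arrow M f N = yd_arrow M (\<lambda>x. g (f x)) P"
  using yd_hom_closed[of M N f] by (auto simp: YD_def yd_arrow_def compose_def restrict_def fun_eq_iff)

lemma yd_arrow_cmp3:
  "\<lbrakk>yd M; yd N; yd P; yd_hom M N f; yd_hom N P g\<rbrakk>
    \<Longrightarrow> yd_arrow P h Q \<cdot>\<^bsub>YD K H\<^esub> yd_arrow N g P \<cdot>\<^bsub>YD K H\<^esub> yd_arrow M f N = yd_arrow M (\<lambda>x. h (g (f x))) Q"
  using yd_hom_comp[of M N P f g] by (simp add: yd_arrow_cmp)

lemma idn_YD: "idn (YD K H) M = yd_arrow M (\<lambda>x. x) M"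
  by (simp add: YD_def yd_arrow_def)

lemma obj_YD: "obj (YD K H) = yd_objects K H"
  by (simp add: YD_def)

section \<open>The category laws\<close>

lemma category_YD: "category (YD K H)"
proof
  fix f assume "f \<in> arr (YD K H)"
  then show "dom (YD K H) f \<in> obj (YD K H)" "cod (YD K H) f \<in> obj (YD K H)"
    by (auto simp: YD_def)
next
  fix M assume "M \<in> obj (YD K H)"
  then show "idn (YD K H) M \<in> homs (YD K H) M M"
    by (simp add: obj_YD idn_YD yd_arrow_homs yd_hom_id)
next
  fix f g A B E assume "f \<in> homs (YD K H) A B" "g \<in> homs (YD K H) B E"
  then show "g \<cdot>\<^bsub>YD K H\<^esub> f \<in> homs (YD K H) A E"
    using yd_hom_comp[of A B E] by (auto elim!: homs_YD_E simp: yd_arrow_cmp intro!: yd_arrow_homs)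
  fix h E' assume "h \<in> homs (YD K H) E E'"
  with \<open>f \<in> _\<close> \<open>g \<in> _\<close> show "(h \<cdot>\<^bsub>YD K H\<^esub> g) \<cdot>\<^bsub>YD K H\<^esub> f = h \<cdot>\<^bsub>YD K H\<^esub> (g \<cdot>\<^bsub>YD K H\<^esub> f)"
    by (elim homs_YD_E) (simp add: yd_arrow_cmp3, simp add: yd_arrow_cmp)
qed (auto elim!: homs_YD_E simp: yd_arrow_cmp idn_YD yd_hom_id)

section \<open>The structure arrows and the inverse associator\<close>

lemma yd_tensor_arr_yd_arrow:
  assumes [simp]: "yd_data M" "yd_data N"
  shows "yd_tensor_arr K H (yd_arrow M f M') (yd_arrow N g N')
    = yd_arrow (M \<boxtimes> N) (tensor_map K M' N' f g) (M' \<boxtimes> N')"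
proof -
  have "tensor_map K M' N' (restrict f (carrier M)) (restrict g (carrier N)) x = tensor_map K M' N' f g x"
    if "x \<in> carrier (M \<boxtimes> N)" for x
    unfolding tensor_map_def by (rule sweedler_cong[of K M N]) (use that in simp_all)
  then show ?thesis
    by (auto simp: yd_tensor_arr_def yd_arrow_def restrict_def)
qed

lemma yd_assoc_yd_arrow:
  "yd_assoc K H M N P = yd_arrow ((M \<boxtimes> N) \<boxtimes> P) (assoc_map M N P) (M \<boxtimes> (N \<boxtimes> P))"
  by (simp add: yd_assoc_def Let_def yd_arrow_def assoc_map_def[abs_def])

lemma yd_braid_yd_arrow:
  "yd_braid K H M N = yd_arrow (M \<boxtimes> N) (braid_map M N) (N \<boxtimes> M)"
  by (simp add: yd_braid_def Let_def yd_arrow_def braid_map_def[abs_def] coact_sum_def)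

lemma inverse_assoc:
  assumes [simp]: "M \<in> yd_objects K H" "N \<in> yd_objects K H" "P \<in> yd_objects K H"
  shows "inverse_arrows (YD K H) (yd_assoc K H M N P)
    (yd_arrow (M \<boxtimes> (N \<boxtimes> P)) (assoc_inv M N P) ((M \<boxtimes> N) \<boxtimes> P))"
proof -
  have "dom (YD K H) (yd_assoc K H M N P) = (M \<boxtimes> N) \<boxtimes> P" "cod (YD K H) (yd_assoc K H M N P) = M \<boxtimes> (N \<boxtimes> P)"
    by (simp_all add: YD_def yd_assoc_yd_arrow yd_arrow_def)
  then show ?thesis
    by (simp add: inverse_arrows_def yd_arrow_homs yd_hom_assoc_inv)
      (auto simp: yd_assoc_yd_arrow yd_arrow_cmp yd_hom_assoc_map yd_hom_assoc_inv idn_YD assoc_inv_assoc_map intro: yd_arrow_eqI)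
qed

lemma inv_assoc:
  assumes [simp]: "M \<in> yd_objects K H" "N \<in> yd_objects K H" "P \<in> yd_objects K H"
  shows "inv_arr (YD K H) (yd_assoc K H M N P)
    = yd_arrow (M \<boxtimes> (N \<boxtimes> P)) (assoc_inv M N P) ((M \<boxtimes> N) \<boxtimes> P)"
proof -
  interpret category "YD K H" by (rule category_YD)
  let ?a = "yd_assoc K H M N P"
  have a: "?a \<in> homs (YD K H) ((M \<boxtimes> N) \<boxtimes> P) (M \<boxtimes> (N \<boxtimes> P))"
    by (simp add: yd_assoc_yd_arrow yd_arrow_homs yd_hom_assoc_map)
  \<comment> \<open>\<open>inv_arr\<close> is a definite description, so uniqueness is required; it
    is the usual comparison of a left inverse with a right inverse.\<close>
  have "g = g'" if g: "inverse_arrows (YD K H) ?a g" and g': "inverse_arrows (YD K H) ?a g'" for g g'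
  proof -
    have h: "g \<in> homs (YD K H) (M \<boxtimes> (N \<boxtimes> P)) ((M \<boxtimes> N) \<boxtimes> P)" "g' \<in> homs (YD K H) (M \<boxtimes> (N \<boxtimes> P)) ((M \<boxtimes> N) \<boxtimes> P)"
      using a g g' by (auto simp: inverse_arrows_def homs_def)
    have "g = idn (YD K H) ((M \<boxtimes> N) \<boxtimes> P) \<cdot>\<^bsub>YD K H\<^esub> g" by (simp add: idn_cmp[OF h(1)])
    also have "\<dots> = (g' \<cdot>\<^bsub>YD K H\<^esub> ?a) \<cdot>\<^bsub>YD K H\<^esub> g" using a g' by (simp add: inverse_arrows_def homs_def)
    also have "\<dots> = g' \<cdot>\<^bsub>YD K H\<^esub> (?a \<cdot>\<^bsub>YD K H\<^esub> g)" by (rule cmp_assoc[OF h(1) a h(2)])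
    also have "\<dots> = g' \<cdot>\<^bsub>YD K H\<^esub> idn (YD K H) (M \<boxtimes> (N \<boxtimes> P))" using a g by (simp add: inverse_arrows_def homs_def)
    also have "\<dots> = g'" by (rule cmp_idn[OF h(2)])
    finally show ?thesis .
  qed
  then show ?thesis
    unfolding inv_arr_def using inverse_assoc[OF assms] by (intro the_equality) simp_all
qed

section \<open>Naturality, pentagon and hexagons\<close>

lemma linear_tensor_map_yd [simp]:
  fixes M N M' N' :: "('k, 'a) hom_yd"
  assumes "yd_data M" "yd_data N" "yd_data M'" "yd_data N'" "lin M M' f" "lin N N' g"
  shows "lin (M \<boxtimes> N) (M' \<boxtimes> N') (tensor_map K M' N' f g)"
  using tensor_map_linear[of K M N M' N' f g] assms by simp

text \<open>The weights of the associator commute with morphisms: \<open>f\<close> with the twists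
  by definition, \<open>h\<close> with their inverses because the twists of objects are
  bijective.\<close>

lemma assoc_natural_YD:
  assumes [simp]: "M \<in> yd_objects K H" "N \<in> yd_objects K H" "P \<in> yd_objects K H"
    "M' \<in> yd_objects K H" "N' \<in> yd_objects K H" "P' \<in> yd_objects K H"
    and f: "yd_hom M M' f" and g: "yd_hom N N' g" and h: "yd_hom P P' h"
    and t: "t \<in> carrier ((M \<boxtimes> N) \<boxtimes> P)"
  shows "assoc_map M' N' P' (tensor_map K (M' \<boxtimes> N') P' (tensor_map K M' N' f g) h t)
    = tensor_map K M' (N' \<boxtimes> P') f (tensor_map K N' P' g h) (assoc_map M N P t)"
proof -
  note [simp] = linear_map_rules[OF yd_hom_linear[OF _ _ f]] linear_map_rules[OF yd_hom_linear[OF _ _ g]]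
    linear_map_rules[OF yd_hom_linear[OF _ _ h]] yd_hom_linear[OF _ _ f] yd_hom_linear[OF _ _ g] yd_hom_linear[OF _ _ h]
    yd_hom_twist[OF _ _ f] yd_hom_twist_inv[OF _ _ _ h]
  have l: "lin ((M \<boxtimes> N) \<boxtimes> P) ((M' \<boxtimes> N') \<boxtimes> P') (tensor_map K (M' \<boxtimes> N') P' (tensor_map K M' N' f g) h)"
    "lin (M \<boxtimes> (N \<boxtimes> P)) (M' \<boxtimes> (N' \<boxtimes> P')) (tensor_map K M' (N' \<boxtimes> P') f (tensor_map K N' P' g h))"
    by simp_all
  note [simp] = linear_map_rules[OF l(1)] linear_map_rules[OF l(2)]
  show ?thesis
    by (rule linear_tensor_left_eqI[where U = "M' \<boxtimes> (N' \<boxtimes> P')", OF _ _ _ _ _ _ _ t]) simp_all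
qed

text \<open>\<open>M \<boxtimes> N\<close> and \<open>P \<boxtimes> Q\<close> are twisted in both
  factors. Hence on pure tensors either side applies the square of the twist to the first factor,
  the twist to the second, its inverse to the third and the square of the inverse to the
  fourth.\<close>

lemma pentagon_YD:
  assumes [simp]: "M \<in> yd_objects K H" "N \<in> yd_objects K H" "P \<in> yd_objects K H" "Q \<in> yd_objects K H"
    and t: "t \<in> carrier (((M \<boxtimes> N) \<boxtimes> P) \<boxtimes> Q)"
  shows "assoc_map M N (P \<boxtimes> Q) (assoc_map (M \<boxtimes> N) P Q t)
    = tensor_map K M (N \<boxtimes> (P \<boxtimes> Q)) (\<lambda>x. x) (assoc_map N P Q) (assoc_map M (N \<boxtimes> P) Q
        (tensor_map K (M \<boxtimes> (N \<boxtimes> P)) Q (assoc_map M N P) (\<lambda>x. x) t))"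
    (is "?f t = ?g t")
proof -
  let ?U = "M \<boxtimes> (N \<boxtimes> (P \<boxtimes> Q))"
  have l: "lin (((M \<boxtimes> N) \<boxtimes> P) \<boxtimes> Q) ((M \<boxtimes> (N \<boxtimes> P)) \<boxtimes> Q) (tensor_map K (M \<boxtimes> (N \<boxtimes> P)) Q (assoc_map M N P) (\<lambda>x. x))"
    "lin (M \<boxtimes> ((N \<boxtimes> P) \<boxtimes> Q)) ?U (tensor_map K M (N \<boxtimes> (P \<boxtimes> Q)) (\<lambda>x. x) (assoc_map N P Q))"
    by simp_all
  note [simp] = linear_map_rules[OF l(1)] linear_map_rules[OF l(2)]
  have f: "lin (((M \<boxtimes> N) \<boxtimes> P) \<boxtimes> Q) ?U ?f" and g: "lin (((M \<boxtimes> N) \<boxtimes> P) \<boxtimes> Q) ?U ?g"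
    by simp_all
  show ?thesis
  proof (rule linear_tensor_eqI[where U = ?U, OF _ _ _ f g _ t])
    fix x q assume x: "x \<in> carrier ((M \<boxtimes> N) \<boxtimes> P)" and [simp]: "q \<in> carrier Q"
    show "?f (tns K ((M \<boxtimes> N) \<boxtimes> P) Q x q) = ?g (tns K ((M \<boxtimes> N) \<boxtimes> P) Q x q)"
      by (rule linear_tensor_left_eqI[where U = ?U, OF _ _ _ _ _ _ _ x]) simp_all
  qed simp_all
qed

text \<open>\<open>f\<close> passes through as a comodule map and \<open>g\<close> as a module map,
  and both commute with the inverse twists.\<close>

lemma braid_natural_YD:
  assumes [simp]: "M \<in> yd_objects K H" "N \<in> yd_objects K H" "M' \<in> yd_objects K H" "N' \<in> yd_objects K H"
    and f: "yd_hom M M' f" and g: "yd_hom N N' g"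
    and t: "t \<in> carrier (M \<boxtimes> N)"
  shows "braid_map M' N' (tensor_map K M' N' f g t) = tensor_map K N' M' g f (braid_map M N t)"
proof -
  note [simp] = linear_map_rules[OF yd_hom_linear[OF _ _ f]] linear_map_rules[OF yd_hom_linear[OF _ _ g]]
    yd_hom_linear[OF _ _ f] yd_hom_linear[OF _ _ g]
    yd_hom_act[OF _ _ g] yd_hom_twist_inv[OF _ _ _ f] yd_hom_twist_inv[OF _ _ _ g] yd_hom_coact_sum[OF _ _ f]
  have l: "lin (M \<boxtimes> N) (M' \<boxtimes> N') (tensor_map K M' N' f g)" "lin (N \<boxtimes> M) (N' \<boxtimes> M') (tensor_map K N' M' g f)"
    by simp_all
  note [simp] = linear_map_rules[OF l(1)] linear_map_rules[OF l(2)]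
  show ?thesis
    by (rule linear_tensor_eqI[where U = "N' \<boxtimes> M'", OF _ _ _ _ _ _ t]) simp_all
qed

lemma hexagon1_YD:
  assumes [simp]: "M \<in> yd_objects K H" "N \<in> yd_objects K H" "P \<in> yd_objects K H"
    and t: "t \<in> carrier ((M \<boxtimes> N) \<boxtimes> P)"
  shows "assoc_map N P M (braid_map M (N \<boxtimes> P) (assoc_map M N P t))
    = tensor_map K N (P \<boxtimes> M) (\<lambda>x. x) (braid_map M P) (assoc_map N M P
        (tensor_map K (N \<boxtimes> M) P (braid_map M N) (\<lambda>x. x) t))"
proof -
  let ?U = "N \<boxtimes> (P \<boxtimes> M)"
  have l: "lin ((M \<boxtimes> N) \<boxtimes> P) ((N \<boxtimes> M) \<boxtimes> P) (tensor_map K (N \<boxtimes> M) P (braid_map M N) (\<lambda>x. x))"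
    "lin (N \<boxtimes> (M \<boxtimes> P)) ?U (tensor_map K N (P \<boxtimes> M) (\<lambda>x. x) (braid_map M P))"
    by simp_all
  note [simp] = linear_map_rules[OF l(1)] linear_map_rules[OF l(2)]
  show ?thesis
  proof (rule linear_tensor_left_eqI[where U = ?U, OF _ _ _ _ _ _ _ t])
    fix m n p assume [simp]: "m \<in> carrier M" "n \<in> carrier N" "p \<in> carrier P"
    let ?t = "tns K (M \<boxtimes> N) P (tns K M N m n) p"
    have "tensor_map K N (P \<boxtimes> M) (\<lambda>x. x) (braid_map M P) (assoc_map N M P
        (tensor_map K (N \<boxtimes> M) P (braid_map M N) (\<lambda>x. x) ?t))
      = C M ?U m (\<lambda>x y. C M ?U y (\<lambda>z w. tns K N (P \<boxtimes> M) (\<beta> x \<triangleright>\<^bsub>N\<^esub> n)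
          (tns K P M (\<beta> (\<beta> (\<beta> z)) \<triangleright>\<^bsub>P\<^esub> twist_inv P (twist_inv P p)) (twist_inv M (twist_inv M w)))))"
      by simp
    \<comment> \<open>Braiding \<open>m\<close> past \<open>n\<close> and then past \<open>p\<close>
      coacts twice, while braiding it past the pair acts diagonally through \<open>\<Delta>\<close>
      of a single coaction.\<close>
    also have "\<dots> = C M ?U m (\<lambda>x y. D ?U x (\<lambda>a b. tns K N (P \<boxtimes> M) (\<beta> (\<beta> a) \<triangleright>\<^bsub>N\<^esub> n)
          (tns K P M (\<beta> (\<beta> (\<beta> b)) \<triangleright>\<^bsub>P\<^esub> twist_inv P (twist_inv P p)) (twist_inv M (twist_inv M (twist M y))))))"
      by (rule coact_sum_coassoc') simp_all
    also have "\<dots> = assoc_map N P M (braid_map M (N \<boxtimes> P) (assoc_map M N P ?t))"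
      by simp
    finally show "assoc_map N P M (braid_map M (N \<boxtimes> P) (assoc_map M N P ?t))
      = tensor_map K N (P \<boxtimes> M) (\<lambda>x. x) (braid_map M P) (assoc_map N M P
        (tensor_map K (N \<boxtimes> M) P (braid_map M N) (\<lambda>x. x) ?t))" by simp
  qed simp_all
qed

lemma hexagon2_YD:
  assumes [simp]: "M \<in> yd_objects K H" "N \<in> yd_objects K H" "P \<in> yd_objects K H"
    and t: "t \<in> carrier (M \<boxtimes> (N \<boxtimes> P))"
  shows "assoc_inv P M N (braid_map (M \<boxtimes> N) P (assoc_inv M N P t))
    = tensor_map K (P \<boxtimes> M) N (braid_map M P) (\<lambda>x. x) (assoc_inv M P N
        (tensor_map K M (P \<boxtimes> N) (\<lambda>x. x) (braid_map N P) t))"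
proof -
  let ?U = "(P \<boxtimes> M) \<boxtimes> N"
  have l: "lin (M \<boxtimes> (N \<boxtimes> P)) (M \<boxtimes> (P \<boxtimes> N)) (tensor_map K M (P \<boxtimes> N) (\<lambda>x. x) (braid_map N P))"
    "lin ((M \<boxtimes> P) \<boxtimes> N) ?U (tensor_map K (P \<boxtimes> M) N (braid_map M P) (\<lambda>x. x))"
    by simp_all
  note [simp] = linear_map_rules[OF l(1)] linear_map_rules[OF l(2)]
  show ?thesis
    \<comment> \<open>The right-hand side braids \<open>n\<close> before \<open>m\<close>, so its
      two coaction sums come in the opposite order.\<close>
    by (rule linear_tensor_right_eqI[where U = ?U, OF _ _ _ _ _ _ _ t]) (simp_all add: coact_coact_swap[of N M])
qed

theorem quasi_braided_YD:
  "quasi_braided_pretensor_category (YD K H)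
     (yd_tensor K H) (yd_tensor_arr K H) (yd_assoc K H) (yd_braid K H)"
proof -
  interpret category "YD K H" by (rule category_YD)
  note [simp] = yd_tensor_arr_yd_arrow yd_assoc_yd_arrow yd_braid_yd_arrow idn_YD
    yd_hom_tensor_map yd_hom_assoc_map yd_hom_assoc_inv yd_hom_braid_map yd_hom_id
  show ?thesis
  proof
    show "U \<boxtimes> V \<in> obj (YD K H)" if "U \<in> obj (YD K H)" "V \<in> obj (YD K H)" for U V
      using that by (simp add: obj_YD)
    show "yd_tensor_arr K H f g \<in> homs (YD K H) (U \<boxtimes> V) (U' \<boxtimes> V')"
      if "f \<in> homs (YD K H) U U'" "g \<in> homs (YD K H) V V'" for f g U U' V V'
      using that by (auto elim!: homs_YD_E intro!: yd_arrow_homs)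
    show "yd_tensor_arr K H (idn (YD K H) U) (idn (YD K H) V) = idn (YD K H) (U \<boxtimes> V)"
      if [unfolded obj_YD, simp]: "U \<in> obj (YD K H)" "V \<in> obj (YD K H)" for U V
      by (simp, rule yd_arrow_eqI, rule linear_tensor_eqI[where U = "U \<boxtimes> V" and M = U and N = V]) simp_all
    show "yd_tensor_arr K H (f' \<cdot>\<^bsub>YD K H\<^esub> f) (g' \<cdot>\<^bsub>YD K H\<^esub> g)
      = yd_tensor_arr K H f' g' \<cdot>\<^bsub>YD K H\<^esub> yd_tensor_arr K H f g"
      if "f \<in> homs (YD K H) U U'" "f' \<in> homs (YD K H) U' U''"
         "g \<in> homs (YD K H) V V'" "g' \<in> homs (YD K H) V' V''" for f f' g g' U U' U'' V V' V''
      using that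
    proof (elim homs_YD_E)
      fix p p' q q'
      assume [simp]: "f = yd_arrow U p U'" "f' = yd_arrow U' p' U''" "g = yd_arrow V q V'" "g' = yd_arrow V' q' V''"
        and [simp]: "U \<in> yd_objects K H" "U' \<in> yd_objects K H" "U'' \<in> yd_objects K H"
          "V \<in> yd_objects K H" "V' \<in> yd_objects K H" "V'' \<in> yd_objects K H"
        and h [simp]: "yd_hom U U' p" "yd_hom U' U'' p'" "yd_hom V V' q" "yd_hom V' V'' q'"
      note [simp] = linear_map_rules[OF yd_hom_linear[OF _ _ h(1)]] linear_map_rules[OF yd_hom_linear[OF _ _ h(2)]]
        linear_map_rules[OF yd_hom_linear[OF _ _ h(3)]] linear_map_rules[OF yd_hom_linear[OF _ _ h(4)]]
        yd_hom_linear[OF _ _ h(1)] yd_hom_linear[OF _ _ h(2)] yd_hom_linear[OF _ _ h(3)] yd_hom_linear[OF _ _ h(4)]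
      have l: "lin (U \<boxtimes> V) (U' \<boxtimes> V') (tensor_map K U' V' p q)"
        "lin (U' \<boxtimes> V') (U'' \<boxtimes> V'') (tensor_map K U'' V'' p' q')" by simp_all
      have "tensor_map K U'' V'' (\<lambda>x. p' (p x)) (\<lambda>x. q' (q x)) t = tensor_map K U'' V'' p' q' (tensor_map K U' V' p q t)"
        if "t \<in> carrier (U \<boxtimes> V)" for t
        by (rule linear_tensor_eqI[where U = "U'' \<boxtimes> V''", OF _ _ _ _ linear_map_comp[OF l(2,1)] _ that]) simp_all
      then show ?thesis by (simp add: yd_arrow_cmp) (rule yd_arrow_eqI)
    qed
    show "yd_assoc K H U V W \<in> homs (YD K H) ((U \<boxtimes> V) \<boxtimes> W) (U \<boxtimes> (V \<boxtimes> W))"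
      if "U \<in> obj (YD K H)" "V \<in> obj (YD K H)" "W \<in> obj (YD K H)" for U V W
      using that by (auto simp: obj_YD intro!: yd_arrow_homs)
    then show "is_iso (YD K H) (yd_assoc K H U V W)"
      if "U \<in> obj (YD K H)" "V \<in> obj (YD K H)" "W \<in> obj (YD K H)" for U V W
      using that inverse_assoc[of U V W] unfolding obj_YD is_iso_def homs_def by blast
    show "yd_assoc K H U' V' W' \<cdot>\<^bsub>YD K H\<^esub> yd_tensor_arr K H (yd_tensor_arr K H f g) h
      = yd_tensor_arr K H f (yd_tensor_arr K H g h) \<cdot>\<^bsub>YD K H\<^esub> yd_assoc K H U V W"
      if "f \<in> homs (YD K H) U U'" "g \<in> homs (YD K H) V V'" "h \<in> homs (YD K H) W W'" for f g h U U' V V' W W'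
      using that by (elim homs_YD_E) (simp add: yd_arrow_cmp, rule yd_arrow_eqI, rule assoc_natural_YD; assumption)
    show "yd_assoc K H U V (W \<boxtimes> X) \<cdot>\<^bsub>YD K H\<^esub> yd_assoc K H (U \<boxtimes> V) W X
      = yd_tensor_arr K H (idn (YD K H) U) (yd_assoc K H V W X) \<cdot>\<^bsub>YD K H\<^esub>
        yd_assoc K H U (V \<boxtimes> W) X \<cdot>\<^bsub>YD K H\<^esub> yd_tensor_arr K H (yd_assoc K H U V W) (idn (YD K H) X)"
      if [unfolded obj_YD, simp]: "U \<in> obj (YD K H)" "V \<in> obj (YD K H)" "W \<in> obj (YD K H)" "X \<in> obj (YD K H)"
      for U V W X
      by (simp add: yd_arrow_cmp3, simp add: yd_arrow_cmp, rule yd_arrow_eqI, rule pentagon_YD) simp_all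
    show "yd_braid K H V W \<in> homs (YD K H) (V \<boxtimes> W) (W \<boxtimes> V)"
      if "V \<in> obj (YD K H)" "W \<in> obj (YD K H)" for V W
      using that by (auto simp: obj_YD intro!: yd_arrow_homs)
    show "yd_braid K H V' W' \<cdot>\<^bsub>YD K H\<^esub> yd_tensor_arr K H f g
      = yd_tensor_arr K H g f \<cdot>\<^bsub>YD K H\<^esub> yd_braid K H V W"
      if "f \<in> homs (YD K H) V V'" "g \<in> homs (YD K H) W W'" for f g V V' W W'
      using that by (elim homs_YD_E) (simp add: yd_arrow_cmp, rule yd_arrow_eqI, rule braid_natural_YD; assumption)
    show "yd_assoc K H V W U \<cdot>\<^bsub>YD K H\<^esub> yd_braid K H U (V \<boxtimes> W) \<cdot>\<^bsub>YD K H\<^esub> yd_assoc K H U V W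
      = yd_tensor_arr K H (idn (YD K H) V) (yd_braid K H U W) \<cdot>\<^bsub>YD K H\<^esub>
        yd_assoc K H V U W \<cdot>\<^bsub>YD K H\<^esub> yd_tensor_arr K H (yd_braid K H U V) (idn (YD K H) W)"
      if [unfolded obj_YD, simp]: "U \<in> obj (YD K H)" "V \<in> obj (YD K H)" "W \<in> obj (YD K H)" for U V W
      by (simp add: yd_arrow_cmp3, rule yd_arrow_eqI, rule hexagon1_YD) simp_all
    show "inv_arr (YD K H) (yd_assoc K H W U V) \<cdot>\<^bsub>YD K H\<^esub> yd_braid K H (U \<boxtimes> V) W \<cdot>\<^bsub>YD K H\<^esub>
        inv_arr (YD K H) (yd_assoc K H U V W)
      = yd_tensor_arr K H (yd_braid K H U W) (idn (YD K H) V) \<cdot>\<^bsub>YD K H\<^esub>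
        inv_arr (YD K H) (yd_assoc K H U W V) \<cdot>\<^bsub>YD K H\<^esub> yd_tensor_arr K H (idn (YD K H) U) (yd_braid K H V W)"
      if [unfolded obj_YD, simp]: "U \<in> obj (YD K H)" "V \<in> obj (YD K H)" "W \<in> obj (YD K H)" for U V W
      \<comment> \<open>The inverse associators are replaced before simplification, since
        \<open>yd_assoc_yd_arrow\<close> would otherwise rewrite \<open>yd_assoc\<close> under
        \<open>inv_arr\<close> and \<open>inv_assoc\<close> would no longer match.\<close>
      unfolding inv_assoc[OF that(1)[unfolded obj_YD] that(2)[unfolded obj_YD] that(3)[unfolded obj_YD]]
        inv_assoc[OF that(3)[unfolded obj_YD] that(1)[unfolded obj_YD] that(2)[unfolded obj_YD]]
        inv_assoc[OF that(1)[unfolded obj_YD] that(3)[unfolded obj_YD] that(2)[unfolded obj_YD]]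
      by (simp add: yd_arrow_cmp3, rule yd_arrow_eqI, rule hexagon2_YD) simp_all
  qed
qed

end

theorem theorem4p1:
  fixes K :: "'k ring" and H :: "('k, 'a) hom_bialg"
  assumes "field K"
    and "hom_bialgebra K H"
    and "bij_betw (twist H) (carrier H) (carrier H)"
  shows "(\<forall>M N. yetter_drinfeld K H M \<and> yetter_drinfeld K H N
            \<longrightarrow> yetter_drinfeld K H (yd_tensor K H M N)) \<and>
         quasi_braided_pretensor_category (YD K H)
           (yd_tensor K H) (yd_tensor_arr K H) (yd_assoc K H) (yd_braid K H)"
proof -
  interpret bij_hom_bialgebra K H
    using assms(2,3) by (simp add: bij_hom_bialgebra_def bij_hom_bialgebra_axioms_def)
  show ?thesis using yetter_drinfeld_tensor quasi_braided_YD by blast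
qed

end
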